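(* Let $G=G_0$ be a $p$-perfect centerless finite group, with $\ker_k$, $\ker_k^*$, $\ker_{k+1}'$, $R_k$, $G_k$ as in the context. Denote ${}_p\tilde G/\ker_{k+1}'$ by $R_{k+1}'$. Then $G_{k+1}$ acts trivially on $\ker_{k+1}/\ker_{k+1}'$. For $k\ge0$, the $\mathbb Z/p$ module map of $\ker_k/\ker_k^*$ to $\ker_{k+1}/\ker_{k+1}'$ by the $p$th power is injective. So a lift of $m\in\ker(\phi_{k+1,k})$ to $\ker(R_{k+1}'\to G_k)$ has order $p^2$ if and only if the image of $m$ in $\ker(R_k\to G_k)$ is nontrivial. This characterizes $R_{k+1}'$ as a quotient of $R_{k+1}$.
   Context: $p$ is a prime dividing $|G|$; $G$ is $p$-perfect if it has no quotient $\mathbb Z/p$. ${}_p\tilde G\to G$ is the universal $p$-Frattini cover (largest profinite Frattini cover of $G$ with pro-$p$ kernel), $\ker_0$ its kernel (a free pro-$p$ group), $\ker_{k+1}$ the closed subgroup of $\ker_k$ generated by commutators and $p$th powers, $G_k={}_p\tilde G/\ker_k$, and $\phi_{k+1,k}:G_{k+1}\to G_k$ the canonical map. $\psi_k:R_k\to G_k$ is the universal exponent $p$ central extension of $G_k$ (the universal central extension of $G_k$ with kernel an elementary abelian $p$-group); it is a Frattini cover, so it is a quotient of ${}_p\tilde G$, written $R_k={}_p\tilde G/\ker_k^*$, and $\phi_{k+1,k}$ factors through $\psi_k$. $\ker_{k+1}'$ is the closure of $(\ker_k,\ker_k^* )(\ker_k^* )^p$ in $\ker_{k+1}$, where $(A,B)$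 denotes the subgroup generated by commutators and $A^p$ the subgroup generated by $p$th powers.
   Formalization: The pth power map is injective for all p but a module map only if p is odd or |ker_k/ker_k^*| ≤ 2 (else false); "characterizes" means largest quotient of R_{k+1} with the order property, for odd p also requiring ker(Q→R_k) central in ker(Q→G_k). *)

theory Defs
  imports "HOL-Analysis.Analysis" "HOL-Algebra.Algebra"
begin

section \<open>Profinite groups\<close>

definition topological_group :: "('a, 'm) monoid_scheme \<Rightarrow> 'a topology \<Rightarrow> bool" where
  "topological_group H T \<longleftrightarrow>
     group H \<and> topspace T = carrier H \<and>
     continuous_map (prod_topology T T) T (\<lambda>(x, y). x \<otimes>\<^bsub>H\<^esub> y) \<and>
     continuous_map T T (\<lambda>x. inv\<^bsub>H\<^esub> x)"

text \<open>The last conjunct is total disconnectedness.\<close>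

definition profinite_group :: "('a, 'm) monoid_scheme \<Rightarrow> 'a topology \<Rightarrow> bool" where
  "profinite_group H T \<longleftrightarrow>
     topological_group H T \<and> compact_space T \<and> Hausdorff_space T \<and>
     (\<forall>C. connectedin T C \<longrightarrow> (\<forall>x\<in>C. \<forall>y\<in>C. x = y))"

definition pro_p_group :: "nat \<Rightarrow> ('a, 'm) monoid_scheme \<Rightarrow> 'a topology \<Rightarrow> bool" where
  "pro_p_group p H T \<longleftrightarrow>
     profinite_group H T \<and>
     (\<forall>U. U \<lhd> H \<and> openin T U \<longrightarrow> (\<exists>n. order (H Mod U) = p ^ n))"

definition frattini_cover ::
    "('a, 'm) monoid_scheme \<Rightarrow> 'a topology \<Rightarrow> ('b, 'n) monoid_scheme \<Rightarrow> 'b topology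
      \<Rightarrow> ('a \<Rightarrow> 'b) \<Rightarrow> bool" where
  "frattini_cover H T G S f \<longleftrightarrow>
     profinite_group H T \<and> profinite_group G S \<and> continuous_map T S f \<and> f \<in> epi H G \<and>
     (\<forall>A. subgroup A H \<and> closedin T A \<and> f ` A = carrier G \<longrightarrow> A = carrier H)"

definition p_frattini_cover ::
    "nat \<Rightarrow> ('a, 'm) monoid_scheme \<Rightarrow> 'a topology \<Rightarrow> ('b, 'n) monoid_scheme \<Rightarrow> 'b topology
      \<Rightarrow> ('a \<Rightarrow> 'b) \<Rightarrow> bool" where
  "p_frattini_cover p H T G S f \<longleftrightarrow>
     frattini_cover H T G S f \<and>
     pro_p_group p (H\<lparr>carrier := kernel H G f\<rparr>) (subtopology T (kernel H G f))"

text \<open>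
  The largest Frattini cover of a (finite, hence discrete) group with pro-\<open>p\<close> kernel: it maps
  onto every other one, compatibly with the projections to \<open>G\<close>.  HOL cannot quantify over all
  types, so the covers \<open>H\<close> compared with \<open>P\<close> are taken on the type \<open>(nat \<times> 'a) set\<close>.  No cover is
  missed up to isomorphism: a Frattini cover of a finite group is topologically finitely
  generated, so it has at most continuum many elements, and \<open>(nat \<times> 'a) set\<close> has at least that
  many for every \<open>'a\<close>.
\<close>

definition universal_p_frattini_cover ::
    "nat \<Rightarrow> 'a monoid \<Rightarrow> 'a topology \<Rightarrow> 'g monoid \<Rightarrow> ('a \<Rightarrow> 'g) \<Rightarrow> bool" where
  "universal_p_frattini_cover p P T G \<phi> \<longleftrightarrow>
     p_frattini_cover p P T G (discrete_topology (carrier G)) \<phi> \<and>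
     (\<forall>(H :: (nat \<times> 'a) set monoid) S \<psi>.
        p_frattini_cover p H S G (discrete_topology (carrier G)) \<psi> \<longrightarrow>
        (\<exists>\<theta>. \<theta> \<in> epi P H \<and> continuous_map T S \<theta> \<and> (\<forall>x\<in>carrier P. \<psi> (\<theta> x) = \<phi> x)))"


section \<open>Finite groups and central extensions\<close>

definition p_perfect :: "nat \<Rightarrow> ('a, 'm) monoid_scheme \<Rightarrow> bool" where
  "p_perfect p G \<longleftrightarrow> \<not> (\<exists>N. N \<lhd> G \<and> (G Mod N) \<cong> integer_mod_group p)"

definition group_center :: "('a, 'm) monoid_scheme \<Rightarrow> 'a set" where
  "group_center G = {z \<in> carrier G. \<forall>x\<in>carrier G. z \<otimes>\<^bsub>G\<^esub> x = x \<otimes>\<^bsub>G\<^esub> z}"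

definition exp_p_central_ext ::
    "nat \<Rightarrow> ('e, 'm) monoid_scheme \<Rightarrow> ('q, 'n) monoid_scheme \<Rightarrow> ('e \<Rightarrow> 'q) \<Rightarrow> bool" where
  "exp_p_central_ext p E Q \<pi> \<longleftrightarrow>
     group E \<and> finite (carrier E) \<and> group Q \<and> \<pi> \<in> epi E Q \<and>
     kernel E Q \<pi> \<subseteq> group_center E \<and>
     (\<forall>x\<in>kernel E Q \<pi>. x [^]\<^bsub>E\<^esub> p = \<one>\<^bsub>E\<^esub>)"

text \<open>
  All extensions \<open>E\<close> in question are finite, so groups on the type \<open>nat\<close> represent all of them
  up to isomorphism.
\<close>

definition universal_exp_p_central_ext ::
    "nat \<Rightarrow> ('r, 'm) monoid_scheme \<Rightarrow> ('q, 'n) monoid_scheme \<Rightarrow> ('r \<Rightarrow> 'q) \<Rightarrow> bool" where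
  "universal_exp_p_central_ext p R Q \<psi> \<longleftrightarrow>
     exp_p_central_ext p R Q \<psi> \<and>
     (\<forall>(E :: nat monoid) \<pi>. exp_p_central_ext p E Q \<pi> \<longrightarrow>
        (\<exists>!\<theta>. \<theta> \<in> hom R E \<and> \<theta> \<in> extensional (carrier R) \<and>
              (\<forall>x\<in>carrier R. \<pi> (\<theta> x) = \<psi> x)))"


section \<open>The characteristic series\<close>

definition comm_subgroup :: "('a, 'm) monoid_scheme \<Rightarrow> 'a set \<Rightarrow> 'a set \<Rightarrow> 'a set" where
  "comm_subgroup P A B =
     generate P {a \<otimes>\<^bsub>P\<^esub> b \<otimes>\<^bsub>P\<^esub> inv\<^bsub>P\<^esub> a \<otimes>\<^bsub>P\<^esub> inv\<^bsub>P\<^esub> b | a b. a \<in> A \<and> b \<in> B}"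

definition pow_subgroup :: "nat \<Rightarrow> ('a, 'm) monoid_scheme \<Rightarrow> 'a set \<Rightarrow> 'a set" where
  "pow_subgroup p P A = generate P {a [^]\<^bsub>P\<^esub> p | a. a \<in> A}"

text \<open>\<open>pker p P T G \<phi> k\<close> is \<open>ker\<^sub>k\<close>.\<close>

primrec pker ::
    "nat \<Rightarrow> 'a monoid \<Rightarrow> 'a topology \<Rightarrow> 'g monoid \<Rightarrow> ('a \<Rightarrow> 'g) \<Rightarrow> nat \<Rightarrow> 'a set" where
  "pker p P T G \<phi> 0 = kernel P G \<phi>"
| "pker p P T G \<phi> (Suc k) =
     T closure_of (generate P
       (comm_subgroup P (pker p P T G \<phi> k) (pker p P T G \<phi> k) \<union>
        pow_subgroup p P (pker p P T G \<phi> k)))"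

text \<open>
  For normal subgroups \<open>M \<subseteq> N\<close> of \<open>P\<close>, the canonical map from \<open>P Mod M\<close> to \<open>P Mod N\<close>: it sends
  the coset \<open>M #> x\<close> to \<open>N <#> (M #> x) = N #> x\<close>.
\<close>

definition quot_map :: "('a, 'm) monoid_scheme \<Rightarrow> 'a set \<Rightarrow> 'a set \<Rightarrow> 'a set" where
  "quot_map P N C = N <#>\<^bsub>P\<^esub> C"

abbreviation subquotient :: "'a monoid \<Rightarrow> 'a set \<Rightarrow> 'a set \<Rightarrow> 'a set monoid" where
  "subquotient P K L \<equiv> (P\<lparr>carrier := K\<rparr>) Mod L"

text \<open>
  \<open>Ks\<close> is \<open>ker\<^sub>k\<^sup>*\<close> for \<open>K = ker\<^sub>k\<close>: the closed normal subgroup such that \<open>P/Ks \<rightarrow> P/K\<close> is the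
  universal exponent \<open>p\<close> central extension \<open>R\<^sub>k \<rightarrow> G\<^sub>k\<close>.
\<close>

definition is_ker_star :: "nat \<Rightarrow> 'a monoid \<Rightarrow> 'a topology \<Rightarrow> 'a set \<Rightarrow> 'a set \<Rightarrow> bool" where
  "is_ker_star p P T K Ks \<longleftrightarrow>
     Ks \<lhd> P \<and> closedin T Ks \<and> Ks \<subseteq> K \<and>
     universal_exp_p_central_ext p (P Mod Ks) (P Mod K) (quot_map P K)"

text \<open>\<open>ker_prime\<close> gives \<open>ker'\<^sub>k\<^sub>+\<^sub>1\<close> from \<open>K = ker\<^sub>k\<close> and \<open>Ks = ker\<^sub>k\<^sup>*\<close>.\<close>

definition ker_prime :: "nat \<Rightarrow> 'a monoid \<Rightarrow> 'a topology \<Rightarrow> 'a set \<Rightarrow> 'a set \<Rightarrow> 'a set" where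
  "ker_prime p P T K Ks = T closure_of (comm_subgroup P K Ks <#>\<^bsub>P\<^esub> pow_subgroup p P Ks)"

text \<open>
  As \<open>ker_prime\<close>, but killing all commutators of \<open>K\<close>.  For \<open>p = 2\<close> the squaring map from \<open>K/Ks\<close> to
  \<open>ker\<^sub>k\<^sub>+\<^sub>1/ker'\<^sub>k\<^sub>+\<^sub>1\<close> is injective, but it is additive only up to commutators of \<open>K\<close>, and these are
  nontrivial when \<open>K/Ks\<close> is not cyclic; modulo \<open>ker_prime_ab\<close> it is additive for every \<open>p\<close>.
\<close>

definition ker_prime_ab :: "nat \<Rightarrow> 'a monoid \<Rightarrow> 'a topology \<Rightarrow> 'a set \<Rightarrow> 'a set \<Rightarrow> 'a set" where
  "ker_prime_ab p P T K Ks = T closure_of (comm_subgroup P K K <#>\<^bsub>P\<^esub> pow_subgroup p P Ks)"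

text \<open>An abelian group of exponent dividing \<open>p\<close>, i.e. a \<open>\<int>/p\<close> module.\<close>

definition zp_module :: "nat \<Rightarrow> ('a, 'm) monoid_scheme \<Rightarrow> bool" where
  "zp_module p V \<longleftrightarrow> comm_group V \<and> (\<forall>x\<in>carrier V. x [^]\<^bsub>V\<^esub> p = \<one>\<^bsub>V\<^esub>)"

text \<open>
  Here \<open>K = ker\<^sub>k\<close>, \<open>K1 = ker\<^sub>k\<^sub>+\<^sub>1\<close>, \<open>Ks = ker\<^sub>k\<^sup>*\<close> and \<open>L \<subseteq> K1\<close>.  Every lift \<open>r\<close> to the kernel of
  \<open>P/L \<rightarrow> G\<^sub>k\<close> of an element \<open>m\<close> of the kernel of \<open>G\<^sub>k\<^sub>+\<^sub>1 \<rightarrow> G\<^sub>k\<close> has order \<open>p\<^sup>2\<close> if and only if the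
  image of \<open>m\<close> in \<open>R\<^sub>k\<close> is nontrivial.
\<close>

definition lift_order_property ::
    "nat \<Rightarrow> 'a monoid \<Rightarrow> 'a set \<Rightarrow> 'a set \<Rightarrow> 'a set \<Rightarrow> 'a set \<Rightarrow> bool" where
  "lift_order_property p P K K1 Ks L \<longleftrightarrow>
     (\<forall>m \<in> kernel (P Mod K1) (P Mod K) (quot_map P K).
      \<forall>r \<in> kernel (P Mod L) (P Mod K) (quot_map P K).
        quot_map P K1 r = m \<longrightarrow>
        (group.ord (P Mod L) r = p\<^sup>2 \<longleftrightarrow> quot_map P Ks m \<noteq> \<one>\<^bsub>P Mod Ks\<^esub>))"

text \<open>The kernel of \<open>P/L \<rightarrow> R\<^sub>k\<close> is central in the kernel of \<open>P/L \<rightarrow> G\<^sub>k\<close>.\<close>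

definition star_central :: "'a monoid \<Rightarrow> 'a set \<Rightarrow> 'a set \<Rightarrow> 'a set \<Rightarrow> bool" where
  "star_central P K Ks L \<longleftrightarrow>
     (\<forall>u \<in> kernel (P Mod L) (P Mod Ks) (quot_map P Ks).
      \<forall>v \<in> kernel (P Mod L) (P Mod K) (quot_map P K).
        u \<otimes>\<^bsub>P Mod L\<^esub> v = v \<otimes>\<^bsub>P Mod L\<^esub> u)"

end

theory Submission
  imports Defs
begin

text \<open>
  Write \<open>K = ker\<^sub>k\<close>, \<open>K1 = ker\<^sub>k\<^sub>+\<^sub>1\<close>, \<open>Ks = ker\<^sub>k\<^sup>*\<close> and \<open>K' = ker'\<^sub>k\<^sub>+\<^sub>1\<close>.  The extension
  \<open>R\<^sub>k \<rightarrow> G\<^sub>k\<close> is central of exponent \<open>p\<close>, so \<open>[P, K]\<close> and \<open>K\<^sup>p\<close> lie in \<open>Ks\<close>.  Modulo \<open>K'\<close> the group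
  \<open>Ks\<close> is central in \<open>K\<close> and killed by \<open>p\<close>, hence \<open>x\<^sup>p\<close> and \<open>[x, y]\<close>, for \<open>x, y\<close> in \<open>K\<close>, depend only on
  the classes of \<open>x\<close> and \<open>y\<close> modulo \<open>Ks\<close>.  Conjugation by \<open>P\<close> does not change these classes, so it fixes
  the generators of \<open>K1/K'\<close> (\<open>trivial_action\<close>).  As there are finitely many classes, \<open>K1/K'\<close> is finite
  (\<open>K'_open\<close>), and \<open>P/K' \<rightarrow> G\<^sub>k\<^sub>+\<^sub>1\<close> is one of the extensions that \<open>R\<^sub>k\<^sub>+\<^sub>1\<close> maps to.  Two maps from \<open>P\<close> to
  such an extension over the same quotient differ by a homomorphism to an elementary abelian \<open>p\<close>-group,
  which is trivial because \<open>G\<close> is \<open>p\<close>-perfect and \<open>P \<rightarrow> G\<close> is Frattini.  So \<open>R\<^sub>k\<^sub>+\<^sub>1 \<rightarrow> P/K'\<close> is the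
  canonical map and \<open>ker\<^sub>k\<^sub>+\<^sub>1\<^sup>* \<subseteq> K'\<close> (\<open>star_least\<close>).

  Injectivity of the \<open>p\<close>th power is where the universality of \<open>P\<close> enters.  It amounts to
  \<open>pth_power_in_verbal\<close>: if \<open>x\<close> in \<open>K\<close> is not in \<open>Ks\<close>, then \<open>x\<^sup>p\<close> is not in the closure of
  \<open>[K, K] Ks\<^sup>p\<close>.  Some character \<open>K/Ks \<rightarrow> \<int>/p\<close> is nonzero at \<open>x\<close>.  If it lifts to a continuous character
  \<open>K \<rightarrow> \<int>/p\<^sup>2\<close>, the lift kills \<open>[K, K] Ks\<^sup>p\<close> but not \<open>x\<^sup>p\<close>.  A lift exists because \<open>ker\<^sub>0\<close> is free
  pro-\<open>p\<close>; in place of freeness the proof uses that \<open>P\<close> is projective for extensions of finite groups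
  whose kernel is a \<open>p\<close>-group (\<open>projective\<close>), and induces the character from \<open>K\<close> to a homomorphism from
  \<open>P\<close> to a wreath product (\<open>character_lifts_mod_p_squared\<close>).

  Projectivity comes from universality.  In the fibre product of \<open>P\<close> with an extension \<open>E \<rightarrow> Q\<close>, a minimal
  closed subgroup mapping onto \<open>P\<close> is again a Frattini cover of \<open>G\<close> with pro-\<open>p\<close> kernel, so \<open>P\<close> maps onto
  it.  Composed with the projection to \<open>P\<close> this gives a surjective endomorphism \<open>\<beta>\<close> of \<open>P\<close>, and a lift to
  \<open>E\<close> of the given map \<open>P \<rightarrow> Q\<close> composed with \<open>\<beta>\<close>.  Since \<open>P\<close> has only finitely many continuous
  homomorphisms to \<open>E\<close>, composition with \<open>\<beta>\<close> permutes them, and \<open>\<beta>\<close> can be cancelled.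

  For the characterization of \<open>K'\<close>, the order property of a subgroup \<open>L\<close> says that \<open>y\<^sup>p \<in> L\<close> if and only if
  \<open>y \<in> Ks\<close>.  For odd \<open>p\<close> the commutators \<open>[K, Ks]\<close> lie in \<open>L\<close> by assumption.  For \<open>p = 2\<close> they do so
  automatically (\<open>squares_determine_star_central\<close>): modulo \<open>L\<close>, squaring is a \<open>P\<close>-invariant quadratic form on
  \<open>K/K1\<close> with the commutator as its polar form, and it vanishes on \<open>Ks\<close>.  This forces squares of elements
  of \<open>P\<close>, and hence, \<open>G\<close> being \<open>2\<close>-perfect, all elements of \<open>P\<close>, to preserve the polar form when acting on one
  argument only.  So \<open>[P, K]\<close> is in the radical of the form, and so is \<open>Ks\<close>.
\<close>

section \<open>Finite groups\<close>

lemma (in group) pow_mult_commuting: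
  assumes "x \<in> carrier G" "s \<in> carrier G" "x \<otimes> s = s \<otimes> x" "s [^] (n::nat) = \<one>"
  shows "(x \<otimes> s) [^] n = x [^] n"
  using assms by (simp add: pow_mult_distrib)

text \<open>
  A subgroup \<open>N\<close> that is maximal among those avoiding \<open>x\<close> has index \<open>p\<close>: together with any element outside
  \<open>N\<close> it generates \<open>x\<close>.  So every element is \<open>n \<otimes> x [^] i\<close> with \<open>n\<close> in \<open>N\<close>, and \<open>i\<close> modulo \<open>p\<close> is the character.
\<close>

lemma (in comm_group) separating_character:
  assumes fin: "finite (carrier G)" and p: "Factorial_Ring.prime (p::nat)"
    and expp: "\<And>v. v \<in> carrier G \<Longrightarrow> v [^] p = \<one>"
    and x: "x \<in> carrier G" "x \<noteq> \<one>"
  shows "\<exists>l \<in> hom G (integer_mod_group p). l x = 1"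
proof -
  define \<N> where "\<N> = {N. subgroup N G \<and> x \<notin> N}"
  have "finite \<N>"
    by (rule finite_subset[of _ "Pow (carrier G)"]) (auto simp: \<N>_def fin dest: subgroup.subset)
  moreover have "{\<one>} \<in> \<N>" using x triv_subgroup by (auto simp: \<N>_def)
  ultimately obtain N where N: "N \<in> \<N>" and Nmax: "\<And>M. M \<in> \<N> \<Longrightarrow> card M \<le> card N"
    using obtains_MAX[of \<N> card] Max_ge by (metis empty_iff finite_imageI image_eqI)
  have sN: "subgroup N G" and xN: "x \<notin> N" using N by (auto simp: \<N>_def)
  interpret N: subgroup N G by (rule sN)
  have ipow: "v [^] (i * int p) = \<one>" if "v \<in> carrier G" for v i
    using that expp[of v] by (metis int_pow_int int_pow_one int_pow_pow mult.commute)
  have inverse_exp: "\<exists>b. \<exists>c. b * i = 1 + c * int p" if "\<not> int p dvd i" for i :: int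
  proof -
    have "coprime i (int p)"
      using p that prime_imp_coprime[of "int p" i] by (simp add: ac_simps)
    then obtain a c where "a * i + c * int p = 1"
      by (metis bezout_int coprime_iff_gcd_eq_1)
    then have "a * i = 1 + (-c) * int p" by (simp add: algebra_simps)
    then show ?thesis by blast
  qed
  have dec: "\<exists>n\<in>N. \<exists>i::int. v = n \<otimes> x [^] i" if v: "v \<in> carrier G" for v
  proof (cases "v \<in> N")
    case True
    then show ?thesis by (intro bexI[of _ v] exI[of _ 0]) (use v in auto)
  next
    case False
    define M where "M = {n \<otimes> v [^] (j::int) | n j. n \<in> N}"
    have sM: "subgroup M G"
    proof
      show "M \<subseteq> carrier G" using v by (auto simp: M_def)
      show "\<one> \<in> M" unfolding M_def using v by (auto intro!: exI[of _ \<one>] exI[of _ "0::int"])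
      fix a b assume "a \<in> M" "b \<in> M"
      then obtain n j m k where ab: "n \<in> N" "m \<in> N" "a = n \<otimes> v [^] (j::int)" "b = m \<otimes> v [^] (k::int)"
        by (auto simp: M_def)
      have "a \<otimes> b = (n \<otimes> m) \<otimes> v [^] (j + k)"
        using ab v by (simp add: int_pow_mult m_ac)
      then show "a \<otimes> b \<in> M" unfolding M_def using ab by blast
      have "inv a = inv n \<otimes> v [^] (- j)"
        using ab v by (simp add: int_pow_neg inv_mult)
      then show "inv a \<in> M" unfolding M_def using ab by blast
    qed
    have NM: "N \<subseteq> M"
    proof
      fix n assume "n \<in> N"
      then show "n \<in> M"
        unfolding M_def by (auto intro!: exI[of _ n] exI[of _ "0::int"])
    qed
    have "v \<in> M"
      unfolding M_def using v by (auto intro!: exI[of _ \<one>] exI[of _ "1::int"] simp: int_pow_1)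
    then have "card N < card M"
      using NM False finite_subset[OF subgroup.subset[OF sM] fin]
      by (intro psubset_card_mono) auto
    then have "x \<in> M" using Nmax[of M] sM by (force simp: \<N>_def)
    then obtain n j where nj: "n \<in> N" "x = n \<otimes> v [^] (j::int)" by (auto simp: M_def)
    have "\<not> int p dvd j"
    proof
      assume "int p dvd j"
      then have "v [^] j = \<one>" using ipow[OF v] by (metis dvd_def mult.commute)
      then show False using nj xN by simp
    qed
    then obtain b c where bc: "b * j = 1 + c * int p" using inverse_exp by blast
    have "x [^] b = n [^] b \<otimes> v [^] (j * b)"
      using nj v by (simp add: int_pow_distrib int_pow_pow)
    also have "v [^] (j * b) = v"
      using v bc ipow[OF v, of c] by (simp add: mult.commute int_pow_mult int_pow_1)
    finally have "v = inv (n [^] b) \<otimes> x [^] b"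
      using v nj by (simp flip: m_assoc)
    moreover have "inv (n [^] b) \<in> N" using nj by (simp add: subgroup_int_pow_closed sN)
    ultimately show ?thesis by blast
  qed
  have uniq: "int p dvd i - j" if "n \<otimes> x [^] (i::int) = m \<otimes> x [^] j" "n \<in> N" "m \<in> N" for n m i j
  proof (rule ccontr)
    assume "\<not> int p dvd i - j"
    then obtain b c where bc: "b * (i - j) = 1 + c * int p" using inverse_exp by blast
    have "x [^] (i - j) = x [^] i \<otimes> inv (x [^] j)" using x by (simp add: int_pow_diff)
    also have "\<dots> = inv n \<otimes> m"
    proof -
      have "x [^] i = inv n \<otimes> (m \<otimes> x [^] j)" using that x by (metis N.mem_carrier int_pow_closed inv_solve_left m_closed)
      then show ?thesis using that x by (simp add: m_assoc)
    qed
    finally have "x [^] (i - j) \<in> N" using that by simp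
    then have "x [^] ((i - j) * b) \<in> N" using x sN by (metis int_pow_pow subgroup_int_pow_closed)
    moreover have "x [^] ((i - j) * b) = x"
      using x bc ipow[of x c] by (simp add: mult.commute int_pow_mult int_pow_1)
    ultimately show False using xN by simp
  qed
  define l where "l v = (SOME i::int. \<exists>n\<in>N. v = n \<otimes> x [^] i) mod int p" for v
  have lI: "l (n \<otimes> x [^] i) = i mod int p" if "n \<in> N" for n i
  proof -
    let ?j = "SOME j::int. \<exists>m\<in>N. n \<otimes> x [^] i = m \<otimes> x [^] j"
    have "\<exists>m\<in>N. n \<otimes> x [^] i = m \<otimes> x [^] ?j" by (rule someI[of _ i]) (use that in auto)
    then have "int p dvd i - ?j" using uniq that by blast
    then have "i mod int p = ?j mod int p" by (simp only: mod_eq_dvd_iff)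
    then show ?thesis by (simp only: l_def)
  qed
  have p1: "1 < int p" using p prime_gt_1_nat by force
  have "l \<in> hom G (integer_mod_group p)"
  proof (rule homI)
    fix v assume "v \<in> carrier G"
    then show "l v \<in> carrier (integer_mod_group p)"
      using p1 by (simp add: l_def carrier_integer_mod_group)
  next
    fix v w assume "v \<in> carrier G" "w \<in> carrier G"
    then obtain n i m j where vw: "n \<in> N" "m \<in> N" "v = n \<otimes> x [^] (i::int)" "w = m \<otimes> x [^] (j::int)"
      using dec by meson
    have e: "v \<otimes> w = (n \<otimes> m) \<otimes> x [^] (i + j)"
      using vw x by (simp add: int_pow_mult m_ac)
    have "l (v \<otimes> w) = (i + j) mod int p"
      unfolding e by (rule lI) (use vw in auto)
    then show "l (v \<otimes> w) = l v \<otimes>\<^bsub>integer_mod_group p\<^esub> l w"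
      using vw lI by (simp add: mod_add_eq)
  qed
  moreover have "l x = 1"
    using lI[of \<one> 1] x p1 by (simp add: int_pow_1)
  ultimately show ?thesis by blast
qed

text \<open>
  A Sylow subgroup for another prime would contain nontrivial elements of order prime to \<open>p\<close>.
\<close>

lemma (in group) prime_power_order_if_torsion:
  assumes fin: "finite (carrier G)" and p: "Factorial_Ring.prime (p::nat)"
    and tor: "\<And>x. x \<in> carrier G \<Longrightarrow> \<exists>n. x [^] (p ^ n) = \<one>"
  shows "\<exists>n. order G = p ^ n"
proof -
  have o0: "order G \<noteq> 0" using fin order_gt_0_iff_finite by simp
  obtain m where m: "order G = p ^ multiplicity p (order G) * m" "\<not> p dvd m"
    using multiplicity_decompose'[of "order G" p] o0 p by (metis not_prime_unit)
  have "m = 1"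
  proof (rule ccontr)
    assume "m \<noteq> 1"
    then obtain q where q: "Factorial_Ring.prime q" "q dvd m"
      using prime_factor_nat by blast
    then have qp: "q \<noteq> p" using m by blast
    define a where "a = multiplicity q (order G)"
    obtain r where r: "order G = q ^ a * r"
      using multiplicity_dvd[of q "order G"] unfolding a_def by (auto simp: dvd_def)
    obtain H where H: "subgroup H G" "card H = q ^ a"
      using sylow_thm[OF q(1) is_group r fin] by blast
    have "q dvd order G" using q m by (metis dvd_mult)
    then have "a > 0" using o0 q unfolding a_def
      by (simp add: prime_multiplicity_gt_zero_iff)
    then have "card H > 1" using H prime_gt_1_nat[OF q(1)] by (simp only: one_less_power)
    then obtain h where h: "h \<in> H" "h \<noteq> \<one>"
      by (metis card_le_Suc0_iff_eq One_nat_def card.infinite leD less_nat_zero_code subgroup.one_closed H(1))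
    interpret H: subgroup H G by (rule H)
    have hG: "h \<in> carrier G" using h by auto
    obtain n where n: "h [^] (p ^ n) = \<one>" using tor hG by blast
    have "h [^]\<^bsub>G\<lparr>carrier := H\<rparr>\<^esub> order (G\<lparr>carrier := H\<rparr>) = \<one>\<^bsub>G\<lparr>carrier := H\<rparr>\<^esub>"
      by (rule group.pow_order_eq_1) (use H h subgroup_imp_group in auto)
    then have "h [^] (q ^ a) = \<one>" using H(2) by (simp add: order_def flip: nat_pow_consistent)
    then have "ord h dvd q ^ a" "ord h dvd p ^ n" using n hG pow_eq_id by blast+
    moreover have "coprime (q ^ a) (p ^ n)" using q p qp by (simp add: primes_coprime)
    ultimately have "ord h = 1" using coprime_common_divisor_nat by blast
    then show False using h hG by (metis ord_eq_1)
  qed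
  then show ?thesis using m by auto
qed

text \<open>
  The universal properties in question speak about groups on one fixed type; copies on \<open>nat\<close> make them
  applicable to all finite groups.
\<close>

lemma finite_group_nat_copy:
  assumes "group H" "finite (carrier H)"
  shows "\<exists>(E :: nat monoid) h. group E \<and> h \<in> iso H E"
proof -
  obtain h :: "'a \<Rightarrow> nat" where h: "inj_on h (carrier H)"
    using assms(2) finite_imp_inj_to_nat_seg by metis
  show ?thesis
    using group.inj_imp_image_group_is_group[OF assms(1) h] inj_imp_image_group_iso[OF h]
    by blast
qed

lemma group_hom_iff: "group_hom G H h \<longleftrightarrow> group G \<and> group H \<and> h \<in> hom G H"
  by (auto simp: group_hom_def group_hom_axioms_def)

section \<open>Quotients by normal subgroups\<close>

lemma (in group) rcos_eq_iff:
  assumes "N \<lhd> G" "x \<in> carrier G" "y \<in> carrier G"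
  shows "N #> x = N #> y \<longleftrightarrow> x \<otimes> inv y \<in> N"
proof -
  interpret N: normal N G by fact
  show ?thesis
    using assms N.rcos_module[OF is_group] repr_independence[OF _ _ N.is_subgroup] rcos_self[OF _ N.is_subgroup]
    by (metis N.subset)
qed

lemma (in group) quot_map_rcos:
  assumes "N \<lhd> G" "M \<lhd> G" "N \<subseteq> M" "x \<in> carrier G"
  shows "quot_map G M (N #> x) = M #> x"
proof -
  interpret N: normal N G by fact
  interpret M: normal M G by fact
  have "M <#> N = M"
    using set_mult_subgroup_idem[OF M.is_subgroup] subgroup_incl[OF N.is_subgroup M.is_subgroup] assms by simp
  then show ?thesis
    unfolding quot_map_def using setmult_rcos_assoc[OF M.subset N.subset assms(4)] by simp
qed

lemma (in group) rcos_hom: "N \<lhd> G \<Longrightarrow> group_hom G (G Mod N) (\<lambda>x. N #> x)"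
  by (simp add: group_hom_iff normal.factorgroup_is_group normal.r_coset_hom_Mod)

lemma (in group) rcos_eq_one_iff:
  assumes "N \<lhd> G" "x \<in> carrier G"
  shows "N #> x = N \<longleftrightarrow> x \<in> N"
proof -
  interpret N: normal N G by fact
  show ?thesis using rcos_eq_iff[OF assms one_closed] assms N.subset by simp
qed

lemma (in group) quot_map_epi:
  assumes "N \<lhd> G" "M \<lhd> G" "N \<subseteq> M"
  shows "quot_map G M \<in> epi (G Mod N) (G Mod M)"
proof -
  interpret N: group_hom G "G Mod N" "\<lambda>x. N #> x" by (rule rcos_hom) fact
  interpret M: group_hom G "G Mod M" "\<lambda>x. M #> x" by (rule rcos_hom) fact
  show ?thesis
    unfolding epi_def hom_def mem_Collect_eq
  proof (intro conjI ballI funcsetI)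
    fix x y assume "x \<in> carrier (G Mod N)" "y \<in> carrier (G Mod N)"
    then obtain a b where ab: "a \<in> carrier G" "b \<in> carrier G" "x = N #> a" "y = N #> b"
      by (auto simp: carrier_FactGroup)
    show "quot_map G M (x \<otimes>\<^bsub>G Mod N\<^esub> y) = quot_map G M x \<otimes>\<^bsub>G Mod M\<^esub> quot_map G M y"
      unfolding ab(3,4) N.hom_mult[OF ab(1,2), symmetric]
      using ab assms by (simp only: quot_map_rcos m_closed M.hom_mult)
  qed (use assms quot_map_rcos in \<open>auto simp: carrier_FactGroup image_image cong: image_cong_simp\<close>)
qed

lemma (in group) kernel_quot_map:
  assumes "N \<lhd> G" "M \<lhd> G" "N \<subseteq> M"
  shows "kernel (G Mod N) (G Mod M) (quot_map G M) = (\<lambda>x. N #> x) ` M"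
proof -
  interpret M: normal M G by fact
  show ?thesis
  proof (intro equalityI subsetI)
    fix C assume "C \<in> kernel (G Mod N) (G Mod M) (quot_map G M)"
    then obtain x where "x \<in> carrier G" "C = N #> x" "quot_map G M C = M"
      by (auto simp: kernel_def carrier_FactGroup)
    then show "C \<in> (\<lambda>x. N #> x) ` M"
      using assms quot_map_rcos rcos_eq_one_iff by auto
  next
    fix C assume "C \<in> (\<lambda>x. N #> x) ` M"
    then obtain x where "x \<in> M" "C = N #> x" by auto
    then show "C \<in> kernel (G Mod N) (G Mod M) (quot_map G M)"
      using assms quot_map_rcos[OF assms] rcos_eq_one_iff M.mem_carrier
      by (simp add: kernel_def carrier_FactGroup)
  qed
qed

lemma carrier_subquotient: "carrier (subquotient P K L) = (\<lambda>x. L #>\<^bsub>P\<^esub> x) ` K"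
  by (simp add: carrier_FactGroup)

section \<open>Topological groups\<close>

locale topgroup = group G for G (structure) +
  fixes T :: "'a topology"
  assumes topological_group: "topological_group G T"
begin

lemma topspace: "topspace T = carrier G"
  using topological_group by (simp add: topological_group_def)

lemma continuous_mult:
  assumes "continuous_map S T f" "continuous_map S T g"
  shows "continuous_map S T (\<lambda>x. f x \<otimes> g x)"
proof -
  have "continuous_map (prod_topology T T) T (\<lambda>(x, y). x \<otimes> y)"
    using topological_group by (simp add: topological_group_def)
  with continuous_map_pairedI[OF assms] 
  have "continuous_map S T ((\<lambda>(x, y). x \<otimes> y) \<circ> (\<lambda>x. (f x, g x)))"
    by (rule continuous_map_compose)
  then show ?thesis by (simp add: o_def)
qed

lemma continuous_inv:
  assumes "continuous_map S T f"
  shows "continuous_map S T (\<lambda>x. inv f x)"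
proof -
  have "continuous_map T T (\<lambda>x. inv x)"
    using topological_group by (simp add: topological_group_def)
  with assms have "continuous_map S T ((\<lambda>x. inv x) \<circ> f)"
    by (rule continuous_map_compose)
  then show ?thesis by (simp add: o_def)
qed

lemma continuous_const: "a \<in> carrier G \<Longrightarrow> continuous_map S T (\<lambda>x. a)"
  by (simp add: topspace)

lemma continuous_id: "continuous_map T T (\<lambda>x. x)"
  using continuous_map_id by (simp add: id_def)

lemma continuous_pow:
  assumes "continuous_map S T f"
  shows "continuous_map S T (\<lambda>x. f x [^] (n::nat))"
proof (induction n)
  case 0
  show ?case using continuous_const[of \<one>] by simp
next
  case (Suc n)
  then show ?case using continuous_mult[OF _ assms] by simp
qed

lemmas continuous_group = continuous_mult continuous_inv continuous_const continuous_id continuous_pow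

lemma rcos_eq_vimage:
  assumes "A \<subseteq> carrier G" "a \<in> carrier G"
  shows "{x \<in> topspace T. x \<otimes> inv a \<in> A} = A #> a"
proof (intro equalityI subsetI)
  fix x assume "x \<in> {x \<in> topspace T. x \<otimes> inv a \<in> A}"
  then have "x \<in> carrier G" "x \<otimes> inv a \<in> A" by (auto simp: topspace)
  moreover from this have "x = x \<otimes> inv a \<otimes> a" using assms by (simp add: m_assoc)
  ultimately show "x \<in> A #> a" unfolding r_coset_def by auto
next
  fix x assume "x \<in> A #> a"
  then obtain b where "b \<in> A" "x = b \<otimes> a" unfolding r_coset_def by auto
  then show "x \<in> {x \<in> topspace T. x \<otimes> inv a \<in> A}"
    using assms by (auto simp: topspace m_assoc)
qed

lemma closed_rcos:
  assumes "closedin T A" "a \<in> carrier G"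
  shows "closedin T (A #> a)"
proof -
  have A: "A \<subseteq> carrier G" using assms closedin_subset topspace by blast
  have "closedin T {x \<in> topspace T. x \<otimes> inv a \<in> A}"
    by (rule closedin_continuous_map_preimage[OF _ assms(1)])
      (intro continuous_group, use assms in auto)
  then show ?thesis unfolding rcos_eq_vimage[OF A assms(2)] .
qed

lemma open_rcos:
  assumes "openin T A" "a \<in> carrier G"
  shows "openin T (A #> a)"
proof -
  have A: "A \<subseteq> carrier G" using assms openin_subset topspace by blast
  have "openin T {x \<in> topspace T. x \<otimes> inv a \<in> A}"
    by (rule openin_continuous_map_preimage[OF _ assms(1)])
      (intro continuous_group, use assms in auto)
  then show ?thesis unfolding rcos_eq_vimage[OF A assms(2)] .
qed

lemma closure_subgroup:
  assumes "subgroup A G" shows "subgroup (T closure_of A) G"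
proof -
  interpret A: subgroup A G by fact
  have AT: "A \<subseteq> topspace T" using A.subset topspace by simp
  have sub: "T closure_of A \<subseteq> carrier G" using closure_of_subset_topspace topspace by metis
  have mult: "x \<otimes> y \<in> T closure_of A" if "x \<in> T closure_of A" "y \<in> T closure_of A" for x y
  proof -
    have 1: "u \<otimes> y \<in> T closure_of A" if u: "u \<in> A" for u
    proof (rule forall_in_closure_of[OF \<open>y \<in> T closure_of A\<close>])
      show "closedin T {y \<in> topspace T. u \<otimes> y \<in> T closure_of A}"
        by (rule closedin_continuous_map_preimage[OF _ closedin_closure_of])
          (intro continuous_group, use u in auto)
      show "u \<otimes> y \<in> T closure_of A" if "y \<in> A" for y
        using that u closure_of_subset[OF AT] by auto
    qed
    show ?thesis
    proof (rule forall_in_closure_of[OF \<open>x \<in> T closure_of A\<close>])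
      show "closedin T {x \<in> topspace T. x \<otimes> y \<in> T closure_of A}"
        by (rule closedin_continuous_map_preimage[OF _ closedin_closure_of])
          (intro continuous_group, use that sub in auto)
    qed (rule 1)
  qed
  have inv: "inv x \<in> T closure_of A" if "x \<in> T closure_of A" for x
  proof (rule forall_in_closure_of[OF that])
    show "closedin T {x \<in> topspace T. inv x \<in> T closure_of A}"
      by (rule closedin_continuous_map_preimage[OF _ closedin_closure_of]) (intro continuous_group)
    show "inv x \<in> T closure_of A" if "x \<in> A" for x
      using that closure_of_subset[OF AT] by auto
  qed
  show ?thesis
    by standard (use sub mult inv closure_of_subset[OF AT] in auto)
qed

lemma closure_normal:
  assumes "N \<lhd> G" shows "(T closure_of N) \<lhd> G"
proof -
  interpret N: normal N G by fact
  have NT: "N \<subseteq> topspace T" using N.subset topspace by simp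
  show ?thesis
    unfolding normal_inv_iff
  proof (intro conjI ballI closure_subgroup N.is_subgroup)
    fix x h assume x: "x \<in> carrier G" and h: "h \<in> T closure_of N"
    show "x \<otimes> h \<otimes> inv x \<in> T closure_of N"
    proof (rule forall_in_closure_of[OF h])
      show "closedin T {h \<in> topspace T. x \<otimes> h \<otimes> inv x \<in> T closure_of N}"
        by (rule closedin_continuous_map_preimage[OF _ closedin_closure_of])
          (intro continuous_group, use x in auto)
      show "x \<otimes> h \<otimes> inv x \<in> T closure_of N" if "h \<in> N" for h
        using that closure_of_subset[OF NT] N.inv_op_closed2 x by auto
    qed
  qed
qed

lemma open_if_closed_finite_index:
  assumes A: "subgroup A G" "closedin T A" and fin: "finite (rcosets A)"
  shows "openin T A"
proof -
  interpret A: subgroup A G by fact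
  have "carrier G - A = \<Union>(rcosets A - {A})"
  proof (intro equalityI subsetI)
    fix x assume x: "x \<in> carrier G - A"
    then have "A #> x \<in> rcosets A - {A}" 
      using rcosetsI[OF A.subset] rcos_self[OF _ A(1)] by blast
    then show "x \<in> \<Union>(rcosets A - {A})" using rcos_self[OF _ A(1), of x] x by blast
  next
    fix x assume "x \<in> \<Union>(rcosets A - {A})"
    then obtain C where C: "C \<in> rcosets A" "C \<noteq> A" "x \<in> C" by blast
    moreover have "A \<in> rcosets A" using A.subgroup_in_rcosets is_group .
    ultimately show "x \<in> carrier G - A"
      using rcos_disjoint[OF A(1)] A.rcosets_carrier[OF is_group]
      by (auto simp: pairwise_def disjnt_def)
  qed
  moreover have "closedin T (\<Union>(rcosets A - {A}))"
    using fin closed_rcos[OF A(2)] by (intro closedin_Union) (auto simp: RCOSETS_def)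
  ultimately have "closedin T (carrier G - A)" by simp
  then show ?thesis using topspace A.subset by (simp add: openin_closedin_eq)
qed

lemma closed_if_contains_open:
  assumes A: "subgroup A G" and B: "openin T B" "B \<subseteq> A" "\<one> \<in> B"
  shows "openin T A" "closedin T A"
proof -
  interpret A: subgroup A G by fact
  have nb: "\<exists>U. openin T U \<and> x \<in> U \<and> (\<forall>y\<in>U. y \<otimes> inv x \<in> A)" if x: "x \<in> carrier G" for x
  proof (intro exI conjI ballI)
    show "openin T {y \<in> topspace T. y \<otimes> inv x \<in> B}"
      by (rule openin_continuous_map_preimage[OF _ B(1)]) (intro continuous_group, use x in auto)
  qed (use B x topspace in auto)
  show "openin T A"
    unfolding openin_subopen[of T A]
  proof
    fix x assume x: "x \<in> A"
    then obtain U where U: "openin T U" "x \<in> U" "\<forall>y\<in>U. y \<otimes> inv x \<in> A" using nb[of x] by auto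
    have "y \<in> A" if "y \<in> U" for y
    proof -
      have "y \<in> carrier G" using that U openin_subset topspace by blast
      then have "y = y \<otimes> inv x \<otimes> x" using x by (simp add: m_assoc)
      then show ?thesis using U that x A.m_closed by metis
    qed
    then show "\<exists>U. openin T U \<and> x \<in> U \<and> U \<subseteq> A" using U by blast
  qed
  have "openin T (carrier G - A)"
    unfolding openin_subopen[of T "carrier G - A"]
  proof
    fix x assume x: "x \<in> carrier G - A"
    then obtain U where U: "openin T U" "x \<in> U" "\<forall>y\<in>U. y \<otimes> inv x \<in> A" using nb[of x] by auto
    have "y \<notin> A" if "y \<in> U" for y
    proof
      assume y: "y \<in> A"
      then have "inv (y \<otimes> inv x) \<otimes> y \<in> A" using U that by auto
      moreover have "inv (y \<otimes> inv x) \<otimes> y = x"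
        using x y by (simp add: inv_mult_group m_assoc)
      ultimately show False using x by simp
    qed
    then show "\<exists>U. openin T U \<and> x \<in> U \<and> U \<subseteq> carrier G - A"
      using U openin_subset[OF U(1)] topspace by blast
  qed
  then show "closedin T A" using A.subset by (simp add: closedin_def topspace)
qed

end

lemma topgroupI: "topological_group G T \<Longrightarrow> topgroup G T"
  by (simp add: topgroup_def topgroup_axioms_def topological_group_def)

lemma profinite_imp_topgroup: "profinite_group G T \<Longrightarrow> topgroup G T"
  by (simp add: topgroupI profinite_group_def)

lemma profinite_connected:
  "\<lbrakk>profinite_group G T; connectedin T C; x \<in> C; y \<in> C\<rbrakk> \<Longrightarrow> x = y"
  by (auto simp: profinite_group_def)

lemma profinite_closed_subgroup:
  fixes G (structure)
  assumes prof: "profinite_group G T" and A: "subgroup A G" "closedin T A"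
  shows "profinite_group (G\<lparr>carrier := A\<rparr>) (subtopology T A)"
proof -
  interpret topgroup G T by (rule profinite_imp_topgroup) fact
  interpret A: subgroup A G by fact
  have sub: "topspace (subtopology T A) = A" using A closedin_subset by fastforce
  have "topological_group (G\<lparr>carrier := A\<rparr>) (subtopology T A)"
    unfolding topological_group_def
  proof (intro conjI)
    show "group (G\<lparr>carrier := A\<rparr>)" using A subgroup_imp_group by blast
    show "topspace (subtopology T A) = carrier (G\<lparr>carrier := A\<rparr>)" using sub by simp
    have fst: "continuous_map (prod_topology (subtopology T A) (subtopology T A)) T fst"
      and snd: "continuous_map (prod_topology (subtopology T A) (subtopology T A)) T snd"
      using continuous_map_fst continuous_map_snd continuous_map_in_subtopology by blast+
    have "continuous_map (prod_topology (subtopology T A) (subtopology T A)) T (\<lambda>z. fst z \<otimes> snd z)"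
      by (rule continuous_mult[OF fst snd])
    then show "continuous_map (prod_topology (subtopology T A) (subtopology T A)) (subtopology T A)
       (\<lambda>(x, y). x \<otimes>\<^bsub>G\<lparr>carrier := A\<rparr>\<^esub> y)"
      by (auto simp: continuous_map_in_subtopology case_prod_unfold sub)
    have "continuous_map (subtopology T A) T (\<lambda>x. inv x)"
      using continuous_inv[OF continuous_id] continuous_map_from_subtopology by blast
    then have "continuous_map (subtopology T A) (subtopology T A) (\<lambda>x. inv x)"
      by (auto simp: continuous_map_in_subtopology sub)
    then show "continuous_map (subtopology T A) (subtopology T A) (\<lambda>x. inv\<^bsub>G\<lparr>carrier := A\<rparr>\<^esub> x)"
      by (rule continuous_map_eq) (simp add: sub m_inv_consistent[OF A(1)])
  qed
  then show ?thesis
    using prof A unfolding profinite_group_def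
    by (auto simp: connectedin_subtopology Hausdorff_space_subtopology
        intro: compact_space_subtopology closedin_compact_space)
qed

lemma profinite_transport:
  fixes G (structure)
  assumes prof: "profinite_group G T" and h: "h \<in> iso G H" "group H" "homeomorphic_map T S h"
  shows "profinite_group H S"
proof -
  interpret topgroup G T by (rule profinite_imp_topgroup) fact
  interpret h: group_hom G H h
    using h by (simp add: group_hom_iff iso_def is_group)
  obtain g where g: "homeomorphic_maps T S h g" using h homeomorphic_map_maps by blast
  have S: "topspace S = carrier H"
    using h topspace homeomorphic_imp_surjective_map[OF h(3)] by (simp add: iso_iff)
  have ch: "continuous_map T S h" and cg: "continuous_map S T g"
    and hg: "\<And>y. y \<in> carrier H \<Longrightarrow> h (g y) = y" and gh: "\<And>x. x \<in> carrier G \<Longrightarrow> g (h x) = x"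
    using g S topspace by (auto simp: homeomorphic_maps_def)
  have gG: "g y \<in> carrier G" if "y \<in> carrier H" for y
    using cg that S topspace by (auto simp: continuous_map_def)
  have "topological_group H S"
    unfolding topological_group_def
  proof (intro conjI h S)
    have "continuous_map (prod_topology S S) T (\<lambda>z. g (fst z) \<otimes> g (snd z))"
      by (rule continuous_mult) (rule continuous_map_compose[OF _ cg, unfolded o_def], 
          rule continuous_map_fst continuous_map_snd)+
    from continuous_map_compose[OF this ch]
    show "continuous_map (prod_topology S S) S (\<lambda>(x, y). x \<otimes>\<^bsub>H\<^esub> y)"
      by (rule continuous_map_eq) (auto simp: S hg gG)
    have "continuous_map S T (\<lambda>z. inv (g z))"
      by (rule continuous_inv[OF cg])
    from continuous_map_compose[OF this ch]
    show "continuous_map S S (\<lambda>x. inv\<^bsub>H\<^esub> x)"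
      by (rule continuous_map_eq) (auto simp: S hg gG)
  qed
  moreover have "compact_space S" "Hausdorff_space S"
    using prof homeomorphic_compact_space[OF homeomorphic_map_imp_homeomorphic_space[OF h(3)]]
      homeomorphic_Hausdorff_space[OF homeomorphic_map_imp_homeomorphic_space[OF h(3)]]
    by (simp_all add: profinite_group_def)
  moreover have "x = y" if C: "connectedin S C" "x \<in> C" "y \<in> C" for x y C
  proof -
    have "connectedin T (g ` C)" using C cg connectedin_continuous_map_image by blast
    then have "g x = g y" using profinite_connected[OF prof, of "g ` C" "g x" "g y"] C by simp
    moreover have "x \<in> carrier H" "y \<in> carrier H" using C connectedin_subset_topspace S by blast+
    ultimately show ?thesis using hg by metis
  qed
  ultimately show ?thesis unfolding profinite_group_def by blast
qed

lemma profinite_finite_discrete: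
  assumes "group E" "finite (carrier E)"
  shows "profinite_group E (discrete_topology (carrier E))"
proof -
  interpret group E by fact
  have "continuous_map (prod_topology (discrete_topology (carrier E)) (discrete_topology (carrier E)))
     (discrete_topology (carrier E)) (\<lambda>(x, y). x \<otimes>\<^bsub>E\<^esub> y)"
    by (simp flip: prod_topology_discrete_topology add: case_prod_unfold Pi_iff)
  then show ?thesis
    using assms unfolding profinite_group_def topological_group_def
    by (simp add: compact_space_discrete_topology connectedin_discrete_topology) blast
qed

lemma profinite_DirProd:
  fixes G (structure)
  assumes E: "profinite_group E S" and G: "profinite_group G T"
  shows "profinite_group (E \<times>\<times> G) (prod_topology S T)"
proof -
  interpret E: topgroup E S by (rule profinite_imp_topgroup) fact
  interpret topgroup G T by (rule profinite_imp_topgroup) fact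
  have ts: "topspace (prod_topology S T) = carrier (E \<times>\<times> G)"
    by (simp add: E.topspace topspace)
  let ?X = "prod_topology S T"
  have f: "continuous_map (prod_topology ?X ?X) S (\<lambda>z. fst (fst z))" "continuous_map (prod_topology ?X ?X) S (\<lambda>z. fst (snd z))"
     "continuous_map (prod_topology ?X ?X) T (\<lambda>z. snd (fst z))" "continuous_map (prod_topology ?X ?X) T (\<lambda>z. snd (snd z))"
    using continuous_map_compose[OF continuous_map_fst continuous_map_fst]
      continuous_map_compose[OF continuous_map_fst continuous_map_snd]
      continuous_map_compose[OF continuous_map_snd continuous_map_fst]
      continuous_map_compose[OF continuous_map_snd continuous_map_snd]
    by (simp_all add: o_def)
  have "continuous_map (prod_topology ?X ?X) ?X
      (\<lambda>z. (fst (fst z) \<otimes>\<^bsub>E\<^esub> fst (snd z), snd (fst z) \<otimes>\<^bsub>G\<^esub> snd (snd z)))"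
    by (intro continuous_map_pairedI E.continuous_mult continuous_mult f)
  then have 1: "continuous_map (prod_topology ?X ?X) ?X (\<lambda>(x, y). x \<otimes>\<^bsub>E \<times>\<times> G\<^esub> y)"
    by (simp add: DirProd_def case_prod_unfold)
  have "continuous_map ?X ?X (\<lambda>z. (inv\<^bsub>E\<^esub> (fst z), inv\<^bsub>G\<^esub> (snd z)))"
    by (intro continuous_map_pairedI E.continuous_inv continuous_inv continuous_map_fst continuous_map_snd)
  then have 2: "continuous_map ?X ?X (\<lambda>x. inv\<^bsub>E \<times>\<times> G\<^esub> x)"
  proof (rule continuous_map_eq)
    fix z assume "z \<in> topspace ?X"
    then show "(inv\<^bsub>E\<^esub> (fst z), inv (snd z)) = inv\<^bsub>E \<times>\<times> G\<^esub> z"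
      using inv_DirProd[OF E.is_group is_group, of "fst z" "snd z"] by (simp add: E.topspace topspace mem_Times_iff)
  qed
  have "x = y" if C: "connectedin ?X C" "x \<in> C" "y \<in> C" for x y C
  proof -
    have "connectedin S (fst ` C)" "connectedin T (snd ` C)"
      by (rule connectedin_continuous_map_image[OF _ C(1)], rule continuous_map_fst continuous_map_snd)+
    moreover have "fst x \<in> fst ` C" "fst y \<in> fst ` C" "snd x \<in> snd ` C" "snd y \<in> snd ` C"
      using C by auto
    ultimately have "fst x = fst y" "snd x = snd y"
      using profinite_connected[OF E] profinite_connected[OF G] by blast+
    then show ?thesis by (simp add: prod_eq_iff)
  qed
  moreover have "topological_group (E \<times>\<times> G) ?X"
    unfolding topological_group_def using 1 2 ts DirProd_group E.is_group is_group by blast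
  moreover have "compact_space ?X" "Hausdorff_space ?X"
    using E G by (simp_all add: profinite_group_def compact_space_prod_topology Hausdorff_space_prod_topology)
  ultimately show ?thesis
    unfolding profinite_group_def by blast
qed

lemma epi_hom: "f \<in> epi G H \<Longrightarrow> f \<in> hom G H" and epi_image: "f \<in> epi G H \<Longrightarrow> f ` carrier G = carrier H"
  by (simp_all add: epi_def)

context topgroup
begin

lemma finite_index_if_open:
  assumes "compact_space T" "subgroup A G" "openin T A"
  shows "finite (rcosets A)"
proof -
  interpret A: subgroup A G by fact
  have "\<forall>U\<in>rcosets A. openin T U" using open_rcos[OF assms(3)] by (auto simp: RCOSETS_def)
  moreover have "topspace T \<subseteq> \<Union>(rcosets A)" using rcosets_part_G[OF assms(2)] topspace by simp
  ultimately obtain F where F: "finite F" "F \<subseteq> rcosets A" "topspace T \<subseteq> \<Union>F"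
    using assms(1) unfolding compact_space_alt by meson
  have "C \<in> F" if C: "C \<in> rcosets A" for C
  proof -
    obtain x where x: "x \<in> C" using A.rcosets_non_empty C by blast
    then have "x \<in> carrier G" using C A.rcosets_carrier[OF is_group] by blast
    then obtain C' where C': "C' \<in> F" "x \<in> C'" using F topspace by blast
    then have "C' \<in> rcosets A" "\<not> disjnt C' C" using F(2) x by (auto simp: disjnt_iff)
    then have "C' = C" using pairwiseD[OF rcos_disjoint[OF assms(2)]] C by blast
    then show ?thesis using C' by simp
  qed
  then have "rcosets A \<subseteq> F" by (rule subsetI)
  then show ?thesis using F(1) by (rule finite_subset)
qed

end

text \<open>
  A supplement that meets the kernel in as few elements as possible is minimal: a smaller supplement
  inside it meets the kernel in the same elements, and a subgroup between the two is determined by its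
  image and its intersection with the kernel.
\<close>

lemma minimal_closed_supplement:
  fixes H (structure)
  assumes prof: "profinite_group H S" and P: "group P" and q: "q \<in> epi H P"
    and fin: "finite (kernel H P q)"
  obtains A where "subgroup A H" "closedin S A" "q ` A = carrier P"
    "\<And>B. \<lbrakk>subgroup B H; closedin S B; B \<subseteq> A; q ` B = carrier P\<rbrakk> \<Longrightarrow> B = A"
proof -
  interpret topgroup H S by (rule profinite_imp_topgroup) fact
  interpret P: group P by fact
  interpret q: group_hom H P q
    using epi_hom[OF q] by (simp add: group_hom_iff is_group P.is_group)
  let ?M = "kernel H P q"
  let ?Q = "\<lambda>A. subgroup A H \<and> closedin S A \<and> q ` A = carrier P"
  have "?Q (carrier H)" using subgroup_self epi_image[OF q] topspace closedin_topspace[of S] by simp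
  from ex_has_least_nat[where P = ?Q and m = "\<lambda>A. card (A \<inter> ?M)", OF this]
  obtain A where A: "?Q A" and Amin: "\<forall>B. ?Q B \<longrightarrow> card (A \<inter> ?M) \<le> card (B \<inter> ?M)"
    by (elim exE conjE) (rule that; (intro conjI)?; assumption)
  have "B = A" if B: "subgroup B H" "closedin S B" "B \<subseteq> A" "q ` B = carrier P" for B
  proof
    interpret A: subgroup A H using A by simp
    interpret B: subgroup B H using B by simp
    have eq: "B \<inter> ?M = A \<inter> ?M"
      by (rule card_seteq) (use fin B Amin in auto)
    show "A \<subseteq> B"
    proof
      fix a assume a: "a \<in> A"
      then have "q a \<in> q ` B" using B(4) A by auto
      then obtain b where b: "b \<in> B" "q b = q a" by auto
      then have "a \<otimes> inv b \<in> A \<inter> ?M" using a B(3) by (auto simp: kernel_def)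
      then have "a \<otimes> inv b \<in> B" using eq by blast
      then have "a \<otimes> inv b \<otimes> b \<in> B" using b by blast
      then show "a \<in> B" using a b by (simp add: m_assoc)
    qed
  qed fact
  then show ?thesis using A by (intro that[of A]) auto
qed

lemma (in group) pow_index_mem:
  assumes "N \<lhd> G" "x \<in> carrier G"
  shows "x [^] order (G Mod N) \<in> N"
proof -
  interpret N: normal N G by fact
  have "N #> x [^] order (G Mod N) = N"
    using group.pow_order_eq_1[OF N.factorgroup_is_group, of "N #> x"] N.FactGroup_pow[OF assms(2)] assms(2)
    by (simp add: carrier_FactGroup)
  then show ?thesis using rcos_eq_one_iff[OF assms(1)] assms(2) by simp
qed

lemma (in group) prime_power_index_if_torsion:
  assumes "N \<lhd> G" "finite (rcosets N)" "Factorial_Ring.prime (p::nat)"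
    and tor: "\<And>x. x \<in> carrier G \<Longrightarrow> \<exists>n. x [^] (p ^ n) \<in> N"
  shows "\<exists>n. order (G Mod N) = p ^ n"
proof -
  interpret N: normal N G by fact
  show ?thesis
  proof (rule group.prime_power_order_if_torsion[OF N.factorgroup_is_group _ assms(3)])
    show "finite (carrier (G Mod N))" using assms(2) by (simp add: FactGroup_def)
    fix C assume "C \<in> carrier (G Mod N)"
    then obtain x where x: "x \<in> carrier G" "C = N #> x" by (auto simp: carrier_FactGroup)
    obtain n where "x [^] (p ^ n) \<in> N" using tor[OF x(1)] by (elim exE)
    then have "C [^]\<^bsub>G Mod N\<^esub> (p ^ n) = \<one>\<^bsub>G Mod N\<^esub>"
      using N.FactGroup_pow[OF x(1)] x rcos_eq_one_iff[OF assms(1)] by simp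
    then show "\<exists>n. C [^]\<^bsub>G Mod N\<^esub> (p ^ n) = \<one>\<^bsub>G Mod N\<^esub>" by (rule exI)
  qed
qed

lemma (in group_hom) image_normal:
  assumes U: "U \<lhd> G" and surj: "h ` carrier G = carrier H"
  shows "h ` U \<lhd> H"
proof (rule H.normal_invI)
  interpret U: normal U G by fact
  show "subgroup (h ` U) H" by (rule subgroup_img_is_subgroup) (rule U.is_subgroup)
  fix x v assume "x \<in> carrier H" "v \<in> h ` U"
  moreover from this have "x \<in> h ` carrier G" using surj by simp
  ultimately obtain y u where yu: "y \<in> carrier G" "x = h y" "u \<in> U" "v = h u" by auto
  have "h (y \<otimes> u \<otimes> inv y) \<in> h ` U" using U.inv_op_closed2 yu by (intro imageI) auto
  then show "x \<otimes>\<^bsub>H\<^esub> v \<otimes>\<^bsub>H\<^esub> inv\<^bsub>H\<^esub> x \<in> h ` U" using yu by simp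
qed

text \<open>
  Modulo an open normal subgroup \<open>U\<close>, a \<open>p\<close>-power of any element agrees with an element of the kernel of \<open>q\<close>,
  because \<open>K\<close> is pro-\<open>p\<close>; a further \<open>p\<close>-power kills the latter.
\<close>

lemma pro_p_extension:
  fixes N (structure)
  assumes p: "Factorial_Ring.prime p" and prof: "profinite_group N S" and K: "pro_p_group p K T"
    and q: "q \<in> epi N K" "continuous_map S T q"
    and tor: "\<And>m. m \<in> kernel N K q \<Longrightarrow> \<exists>n. m [^] (p ^ n) = \<one>"
  shows "pro_p_group p N S"
proof -
  have profK: "profinite_group K T" using K by (simp add: pro_p_group_def)
  interpret topgroup N S by (rule profinite_imp_topgroup) fact
  interpret K: topgroup K T by (rule profinite_imp_topgroup) (rule profK)
  interpret q: group_hom N K q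
    using epi_hom[OF q(1)] by (simp add: group_hom_iff is_group K.is_group)
  have comp: "compact_space S" and Haus: "Hausdorff_space T"
    using prof profK by (simp_all add: profinite_group_def)
  have quot: "quotient_map S T q"
    using q comp Haus epi_image[OF q(1)] topspace K.topspace
    by (intro continuous_imp_quotient_map) auto
  have "\<exists>n. order (N Mod U) = p ^ n" if U: "U \<lhd> N" "openin S U" for U
  proof (rule prime_power_index_if_torsion[OF U(1) _ p])
    interpret U: normal U N by (rule U(1))
    show "finite (rcosets U)" by (rule finite_index_if_open[OF comp U.is_subgroup U(2)])
    define V where "V = q ` U"
    have V: "V \<lhd> K" unfolding V_def by (rule q.image_normal[OF U(1) epi_image[OF q(1)]])
    interpret V: subgroup V K using V by (rule normal_imp_subgroup)
    have "subgroup {x \<in> carrier N. q x \<in> V} N"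
      by standard auto
    then have "openin S {x \<in> carrier N. q x \<in> V}"
      by (rule closed_if_contains_open(1)[OF _ U(2)]) (use U.subset V_def in auto)
    moreover have "V \<subseteq> topspace T" using V.subset K.topspace by simp
    ultimately have "openin T V" using quot by (simp add: quotient_map_def topspace)
    then have "\<exists>n. order (K Mod V) = p ^ n" using K V by (simp add: pro_p_group_def)
    then obtain n where n: "order (K Mod V) = p ^ n" by (elim exE)
    fix y assume y: "y \<in> carrier N"
    have "q (y [^] (p ^ n)) \<in> V"
      using K.pow_index_mem[OF V, of "q y"] y by (simp add: n q.hom_nat_pow)
    then obtain u where u: "u \<in> U" "q (y [^] (p ^ n)) = q u" unfolding V_def by auto
    define m where "m = y [^] (p ^ n) \<otimes> inv u"
    have mN: "m \<in> carrier N" using u y by (simp add: m_def)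
    have "m \<in> kernel N K q" using u y unfolding m_def by (simp add: kernel_def)
    then obtain a where a: "m [^] (p ^ a) = \<one>" using tor by (elim exE[OF tor])
    have "U #> y [^] (p ^ n) = U #> m"
    proof (subst rcos_eq_iff[OF U(1)])
      show "y [^] (p ^ n) \<otimes> inv m \<in> U"
        using U.inv_op_closed2[of "y [^] (p ^ n)" u] u y by (simp add: m_def inv_mult_group flip: m_assoc)
    qed (use mN y in auto)
    then have "U #> (y [^] (p ^ n)) [^] (p ^ a) = U #> m [^] (p ^ a)"
      using U.FactGroup_pow[of "y [^] (p ^ n)" "p ^ a"] U.FactGroup_pow[OF mN, of "p ^ a"] y by simp
    then have "U #> y [^] (p ^ (n + a)) = U"
      using a y U.subset by (simp add: nat_pow_pow power_add)
    then have "y [^] (p ^ (n + a)) \<in> U"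
      using rcos_eq_one_iff[OF U(1)] y by simp
    then show "\<exists>n. y [^] (p ^ n) \<in> U" by (rule exI)
  qed
  then show ?thesis
    unfolding pro_p_group_def using prof by simp
qed

section \<open>Covers of the universal cover\<close>

locale universal_cover =
  fixes p :: nat and G :: "'g monoid" and P :: "'a monoid" (structure) and T :: "'a topology"
    and \<phi> :: "'a \<Rightarrow> 'g"
  assumes prime_p: "Factorial_Ring.prime p"
    and group_G: "group G" and finite_G: "finite (carrier G)"
    and universal: "universal_p_frattini_cover p P T G \<phi>"
begin

lemma p_cover: "p_frattini_cover p P T G (discrete_topology (carrier G)) \<phi>"
  using universal by (simp add: universal_p_frattini_cover_def)

lemma cover: "frattini_cover P T G (discrete_topology (carrier G)) \<phi>"
  using p_cover by (simp add: p_frattini_cover_def)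

lemma profinite: "profinite_group P T"
  using cover by (simp add: frattini_cover_def)

sublocale topgroup P T
  by (rule profinite_imp_topgroup) (rule profinite)

sublocale G: group G by (rule group_G)

lemma phi_epi: "\<phi> \<in> epi P G" and phi_continuous: "continuous_map T (discrete_topology (carrier G)) \<phi>"
  using cover by (simp_all add: frattini_cover_def)

sublocale phi: group_hom P G \<phi>
  using epi_hom[OF phi_epi] by (simp add: group_hom_iff is_group G.is_group)

lemma compact: "compact_space T" and Hausdorff: "Hausdorff_space T"
  using profinite by (simp_all add: profinite_group_def)

lemma frattini:
  assumes "subgroup A P" "closedin T A" "\<phi> ` A = carrier G"
  shows "A = carrier P"
  using assms cover by (simp add: frattini_cover_def)

lemma open_kernel: "openin T (kernel P G \<phi>)"
proof -
  have "openin T {x \<in> topspace T. \<phi> x \<in> {\<one>\<^bsub>G\<^esub>}}"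
    by (rule openin_continuous_map_preimage[OF phi_continuous]) simp
  then show ?thesis by (simp add: topspace kernel_def)
qed

text \<open>
  If a closed subgroup of \<open>H\<close> maps onto \<open>G\<close>, its image in \<open>P\<close> is everything because \<open>P \<rightarrow> G\<close> is Frattini, and
  then minimality of \<open>H\<close> over \<open>P\<close> applies.
\<close>

lemma frattini_cover_of_cover:
  fixes H :: "'h monoid"
  assumes prof: "profinite_group H S" and q: "q \<in> epi H P" "continuous_map S T q"
    and fin: "finite (kernel H P q)"
    and tor: "\<And>m. m \<in> kernel H P q \<Longrightarrow> \<exists>n. m [^]\<^bsub>H\<^esub> (p ^ n) = \<one>\<^bsub>H\<^esub>"
    and minimal: "\<And>A. \<lbrakk>subgroup A H; closedin S A; q ` A = carrier P\<rbrakk> \<Longrightarrow> A = carrier H"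
  shows "p_frattini_cover p H S G (discrete_topology (carrier G)) (\<phi> \<circ> q)"
proof -
  interpret H: topgroup H S by (rule profinite_imp_topgroup) fact
  interpret q: group_hom H P q
    using epi_hom[OF q(1)] by (simp add: group_hom_iff is_group H.is_group)
  have compS: "compact_space S" using prof by (simp add: profinite_group_def)
  have fq: "\<phi> \<circ> q \<in> epi H G"
    by (rule epi_compose[OF q(1) phi_epi])
  have qclosed: "closed_map S T q"
    using q(2) compS Hausdorff by (rule T1_Spaces.continuous_imp_closed_map)
  have F: "frattini_cover H S G (discrete_topology (carrier G)) (\<phi> \<circ> q)"
    unfolding frattini_cover_def
  proof (intro conjI allI impI prof fq continuous_map_compose[OF q(2) phi_continuous])
    show "profinite_group G (discrete_topology (carrier G))"
      by (rule profinite_finite_discrete[OF group_G finite_G])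
    fix A assume A: "subgroup A H \<and> closedin S A \<and> (\<phi> \<circ> q) ` A = carrier G"
    then have "q ` A = carrier P"
      using qclosed by (intro frattini q.subgroup_img_is_subgroup) (auto simp: closed_map_def image_comp)
    then show "A = carrier H" using minimal A by blast
  qed
  define N where "N = kernel H G (\<phi> \<circ> q)"
  define K0 where "K0 = kernel P G \<phi>"
  let ?NH = "H\<lparr>carrier := N\<rparr>" and ?KP = "P\<lparr>carrier := K0\<rparr>"
  have N_eq: "N = {x \<in> carrier H. q x \<in> K0}" by (auto simp: N_def K0_def kernel_def)
  have sN: "subgroup N H"
    unfolding N_def using epi_hom[OF fq]
    by (intro group_hom.subgroup_kernel) (simp add: group_hom_iff G.is_group H.is_group)
  have oN: "openin S N"
    using openin_continuous_map_preimage[OF q(2) open_kernel] H.topspace by (simp add: N_eq K0_def)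
  have "pro_p_group p ?NH (subtopology S N)"
  proof (rule pro_p_extension[OF prime_p, where q = q and K = ?KP and T = "subtopology T K0"])
    show "profinite_group ?NH (subtopology S N)"
      using H.closed_if_contains_open(2)[OF sN oN] subgroup.one_closed[OF sN]
      by (intro profinite_closed_subgroup prof sN) auto
    show "pro_p_group p ?KP (subtopology T K0)"
      using p_cover by (simp add: p_frattini_cover_def K0_def)
    have "K0 \<subseteq> q ` N"
    proof
      fix x assume x: "x \<in> K0"
      then have "x \<in> q ` carrier H" using epi_image[OF q(1)] by (simp add: K0_def kernel_def)
      then show "x \<in> q ` N" using x by (auto simp: N_eq)
    qed
    moreover have "q ` N \<subseteq> K0" by (auto simp: N_eq)
    ultimately have qN: "q ` N = K0" by (rule equalityI[rotated])
    then show "q \<in> epi ?NH ?KP"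
      using subgroup.subset[OF sN] by (auto simp: epi_def hom_def subset_iff)
    show "continuous_map (subtopology S N) (subtopology T K0) q"
      using continuous_map_from_subtopology[OF q(2), of N] \<open>q ` N \<subseteq> K0\<close>
      by (auto simp: continuous_map_in_subtopology)
    fix m assume "m \<in> kernel ?NH ?KP q"
    then have "m \<in> kernel H P q" using subgroup.subset[OF sN] by (auto simp: kernel_def)
    then show "\<exists>n. m [^]\<^bsub>?NH\<^esub> (p ^ n) = \<one>\<^bsub>?NH\<^esub>"
      using tor by (simp flip: H.nat_pow_consistent)
  qed
  then show ?thesis
    unfolding p_frattini_cover_def N_def using F by simp
qed

end

section \<open>Projectivity\<close>

lemma homeomorphic_map_singletons:
  "homeomorphic_map S (pullback_topology ((\<lambda>z. {z}) ` topspace S) the_elem S) (\<lambda>z. {z})"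
proof -
  let ?S = "pullback_topology ((\<lambda>z. {z}) ` topspace S) the_elem S"
  have "homeomorphic_maps S ?S (\<lambda>z. {z}) the_elem"
    unfolding homeomorphic_maps_def
  proof (intro conjI)
    have "continuous_map S S (\<lambda>z. z)" using continuous_map_id by (simp add: id_def)
    then show "continuous_map S ?S (\<lambda>z. {z})"
      by (intro continuous_map_pullback') (auto simp: o_def)
    have "continuous_map ?S S (id \<circ> the_elem)"
      by (rule continuous_map_pullback) (rule continuous_map_id)
    then show "continuous_map ?S S the_elem" by simp
  qed (auto simp: topspace_pullback_topology)
  then show ?thesis by (auto simp: homeomorphic_map_maps)
qed

context universal_cover
begin

text \<open>
  The universal property of \<open>P\<close> applied to a minimal closed supplement in \<open>H\<close>.  It gives no control over the
  composite \<open>q \<circ> \<theta>\<close> beyond surjectivity.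
\<close>

lemma lift_to_extension_coded:
  fixes H :: "(nat \<times> 'a) set monoid"
  assumes prof: "profinite_group H S" and q: "q \<in> epi H P" "continuous_map S T q"
    and fin: "finite (kernel H P q)"
    and tor: "\<And>m. m \<in> kernel H P q \<Longrightarrow> \<exists>n. m [^]\<^bsub>H\<^esub> (p ^ n) = \<one>\<^bsub>H\<^esub>"
  shows "\<exists>\<theta>\<in>hom P H. continuous_map T S \<theta> \<and> q \<circ> \<theta> \<in> epi P P"
proof -
  interpret H: topgroup H S by (rule profinite_imp_topgroup) fact
  obtain A where A: "subgroup A H" "closedin S A" "q ` A = carrier P"
    and min: "\<And>B. \<lbrakk>subgroup B H; closedin S B; B \<subseteq> A; q ` B = carrier P\<rbrakk> \<Longrightarrow> B = A"
    by (rule minimal_closed_supplement[OF prof is_group q(1) fin]) (rule that)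
  interpret A: subgroup A H by fact
  let ?H = "H\<lparr>carrier := A\<rparr>" and ?S = "subtopology S A"
  have qA: "q \<in> hom ?H P" using epi_hom[OF q(1)] A.subset by (auto simp: hom_def)
  have kA: "kernel ?H P q \<subseteq> kernel H P q" using A.subset by (auto simp: kernel_def)
  have "p_frattini_cover p ?H ?S G (discrete_topology (carrier G)) (\<phi> \<circ> q)"
  proof (rule frattini_cover_of_cover)
    show "profinite_group ?H ?S" by (rule profinite_closed_subgroup[OF prof A(1,2)])
    show "q \<in> epi ?H P" using qA A(3) by (simp add: epi_def)
    show "continuous_map ?S T q" by (rule continuous_map_from_subtopology[OF q(2)])
    show "finite (kernel ?H P q)" by (rule finite_subset[OF kA fin])
    show "\<exists>n. m [^]\<^bsub>?H\<^esub> (p ^ n) = \<one>\<^bsub>?H\<^esub>" if "m \<in> kernel ?H P q" for m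
      using tor[OF subsetD[OF kA that]] by (simp flip: H.nat_pow_consistent)
    fix B assume B: "subgroup B ?H" "closedin ?S B" "q ` B = carrier P"
    have "subgroup B H" "B \<subseteq> A"
      using H.incl_subgroup[OF A(1) B(1)] subgroup.subset[OF B(1)] by simp_all
    moreover have "closedin S B" using B(2) A(2) by (simp add: closedin_closed_subtopology)
    ultimately show "B = carrier ?H" using min B(3) by simp
  qed
  then obtain \<theta> where \<theta>: "\<theta> \<in> epi P ?H" "continuous_map T ?S \<theta>"
    using universal unfolding universal_p_frattini_cover_def by meson
  have "\<theta> \<in> hom P H" using epi_hom[OF \<theta>(1)] A.subset by (auto simp: hom_def)
  moreover have "continuous_map T S \<theta>" using \<theta>(2) by (simp add: continuous_map_in_subtopology)
  moreover have "q \<circ> \<theta> \<in> epi P P"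
    using qA A(3) by (intro epi_compose[OF \<theta>(1)]) (simp add: epi_def)
  ultimately show ?thesis by (intro bexI conjI)
qed

text \<open>
  The map \<open>z \<mapsto> {z}\<close> carries an extension on \<open>nat \<times> 'a\<close> to the type on which \<open>P\<close> is universal.
\<close>

lemma lift_to_extension:
  fixes H :: "(nat \<times> 'a) monoid"
  assumes prof: "profinite_group H S" and q: "q \<in> epi H P" "continuous_map S T q"
    and fin: "finite (kernel H P q)"
    and tor: "\<And>m. m \<in> kernel H P q \<Longrightarrow> \<exists>n. m [^]\<^bsub>H\<^esub> (p ^ n) = \<one>\<^bsub>H\<^esub>"
  shows "\<exists>\<theta>\<in>hom P H. continuous_map T S \<theta> \<and> q \<circ> \<theta> \<in> epi P P"
proof -
  interpret H: topgroup H S by (rule profinite_imp_topgroup) fact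
  let ?h = "\<lambda>z :: nat \<times> 'a. {z}"
  define H' where "H' = image_group ?h H"
  define S' where "S' = pullback_topology (?h ` topspace S) the_elem S"
  have h: "?h \<in> iso H H'" "group H'"
    unfolding H'_def by (rule inj_imp_image_group_iso H.inj_imp_image_group_is_group; simp)+
  have homeo: "homeomorphic_map S S' ?h" unfolding S'_def by (rule homeomorphic_map_singletons)
  have cH': "carrier H' = ?h ` carrier H" by (simp add: H'_def image_group_carrier)
  have g: "the_elem \<in> iso H' H"
  proof (rule isoI)
    show "the_elem \<in> hom H' H"
      using iso_imp_homomorphism[OF h(1)] by (auto simp: hom_def cH' Pi_iff) (metis the_elem_eq)
    show "bij_betw the_elem (carrier H') (carrier H)"
      by (auto simp: bij_betw_def inj_on_def cH' image_image)
  qed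
  have cg: "continuous_map S' S the_elem"
    using continuous_map_pullback[OF continuous_map_id, of _ the_elem S] by (simp add: S'_def)
  have g1: "the_elem \<one>\<^bsub>H'\<^esub> = \<one>\<^bsub>H\<^esub>" by (simp add: H'_def image_group_one)
  interpret g: group_hom H' H the_elem
    using iso_imp_homomorphism[OF g] by (simp add: group_hom_iff h(2) H.is_group)
  have "\<exists>\<theta>\<in>hom P H'. continuous_map T S' \<theta> \<and> (q \<circ> the_elem) \<circ> \<theta> \<in> epi P P"
  proof (rule lift_to_extension_coded)
    show "profinite_group H' S'" by (rule profinite_transport[OF prof h homeo])
    show "q \<circ> the_elem \<in> epi H' P"
      using Group.hom_compose[OF iso_imp_homomorphism[OF g] epi_hom[OF q(1)]] epi_image[OF q(1)]
      by (simp add: epi_def cH' image_image)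
    show "continuous_map S' T (q \<circ> the_elem)" by (rule continuous_map_compose[OF cg q(2)])
    have k: "kernel H' P (q \<circ> the_elem) = ?h ` kernel H P q" by (auto simp: kernel_def cH')
    then show "finite (kernel H' P (q \<circ> the_elem))" using fin by simp
    fix m assume m: "m \<in> kernel H' P (q \<circ> the_elem)"
    then obtain z where z: "z \<in> kernel H P q" "m = {z}" using k by auto
    obtain n where n: "z [^]\<^bsub>H\<^esub> (p ^ n) = \<one>\<^bsub>H\<^esub>" using tor[OF z(1)] by (elim exE)
    have mH: "m \<in> carrier H'" using m by (simp add: kernel_def)
    have "the_elem (m [^]\<^bsub>H'\<^esub> (p ^ n)) = the_elem \<one>\<^bsub>H'\<^esub>"
      using g.hom_nat_pow[OF mH, of "p ^ n"] z n g1 by simp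
    then have "m [^]\<^bsub>H'\<^esub> (p ^ n) = \<one>\<^bsub>H'\<^esub>"
      using g mH by (intro inj_onD[of the_elem "carrier H'"]) (auto simp: iso_iff)
    then show "\<exists>n. m [^]\<^bsub>H'\<^esub> (p ^ n) = \<one>\<^bsub>H'\<^esub>" by (rule exI)
  qed
  then obtain \<theta> where \<theta>: "\<theta> \<in> hom P H'" "continuous_map T S' \<theta>" "(q \<circ> the_elem) \<circ> \<theta> \<in> epi P P"
    by (elim bexE conjE) (rule that)
  show ?thesis
    using Group.hom_compose[OF \<theta>(1) iso_imp_homomorphism[OF g]] continuous_map_compose[OF \<theta>(2) cg] \<theta>(3)
    by (intro bexI[of _ "the_elem \<circ> \<theta>"]) (simp_all add: comp_assoc)
qed

definition continuous_homs :: "('b, 'm) monoid_scheme \<Rightarrow> ('a \<Rightarrow> 'b) set" where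
  "continuous_homs E = {\<gamma> \<in> hom P E. \<gamma> \<in> extensional (carrier P) \<and>
     continuous_map T (discrete_topology (carrier E)) \<gamma>}"

text \<open>
  A continuous homomorphism from \<open>P\<close> is determined by its values at one lift of each element of \<open>G\<close>: the set
  where two of them agree is a closed subgroup, and if it maps onto \<open>G\<close> it is all of \<open>P\<close>.
\<close>

lemma finite_continuous_homs:
  assumes "group E" "finite (carrier E)"
  shows "finite (continuous_homs E)"
proof -
  obtain s where s: "\<And>g. g \<in> carrier G \<Longrightarrow> s g \<in> carrier P \<and> \<phi> (s g) = g"
    using epi_image[OF phi_epi] by (metis image_iff)
  define r where "r \<gamma> = restrict (\<gamma> \<circ> s) (carrier G)" for \<gamma> :: "'a \<Rightarrow> 'b"
  have "inj_on r (continuous_homs E)"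
  proof (rule inj_onI)
    fix \<gamma> \<delta> assume a: "\<gamma> \<in> continuous_homs E" "\<delta> \<in> continuous_homs E" "r \<gamma> = r \<delta>"
    interpret c: group_hom P E \<gamma>
      using a assms by (simp add: continuous_homs_def group_hom_iff is_group)
    interpret d: group_hom P E \<delta>
      using a assms by (simp add: continuous_homs_def group_hom_iff is_group)
    let ?A = "{x \<in> topspace T. \<gamma> x = \<delta> x}"
    have "?A = carrier P"
    proof (rule frattini)
      show "subgroup ?A P" by standard (auto simp: topspace)
      show "closedin T ?A"
        by (rule closedin_continuous_maps_eq[OF Hausdorff_space_discrete_topology])
          (use a in \<open>auto simp: continuous_homs_def\<close>)
      have "g \<in> \<phi> ` ?A" if g: "g \<in> carrier G" for g
      proof (rule image_eqI)
        show "g = \<phi> (s g)" using s[OF g] by simp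
        have "r \<gamma> g = r \<delta> g" using a(3) by simp
        then show "s g \<in> ?A" using s[OF g] g by (simp add: r_def topspace)
      qed
      then show "\<phi> ` ?A = carrier G" by (auto simp: topspace)
    qed
    then have "\<gamma> x = \<delta> x" if "x \<in> carrier P" for x using that by blast
    then show "\<gamma> = \<delta>" using a(1,2) by (intro extensionalityI[of _ "carrier P"]) (auto simp: continuous_homs_def)
  qed
  moreover have "r ` continuous_homs E \<subseteq> carrier G \<rightarrow>\<^sub>E carrier E"
    using s by (auto simp: r_def continuous_homs_def hom_def)
  ultimately show ?thesis
    using finite_imageD finite_subset finite_PiE[OF finite_G, of "\<lambda>_. carrier E"] assms(2) by metis
qed

text \<open>
  Composition with the surjection \<open>\<beta>\<close> is injective on the finite set of continuous homomorphisms to \<open>E\<close>, hence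
  bijective.
\<close>

lemma factor_through_endomorphism:
  assumes E: "group E" "finite (carrier E)" and \<beta>: "\<beta> \<in> epi P P" "continuous_map T T \<beta>"
    and \<gamma>: "\<gamma> \<in> hom P E" "continuous_map T (discrete_topology (carrier E)) \<gamma>"
  shows "\<exists>\<delta> \<in> hom P E. continuous_map T (discrete_topology (carrier E)) \<delta> \<and> (\<forall>x\<in>carrier P. \<delta> (\<beta> x) = \<gamma> x)"
proof -
  let ?X = "continuous_homs E"
  define f where "f \<delta> = restrict (\<delta> \<circ> \<beta>) (carrier P)" for \<delta> :: "'a \<Rightarrow> 'b"
  have restr: "restrict \<delta> (carrier P) \<in> ?X"
    if "\<delta> \<in> hom P E" "continuous_map T (discrete_topology (carrier E)) \<delta>" for \<delta>
    using that by (auto simp: continuous_homs_def hom_def topspace intro: continuous_map_eq)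
  have "f ` ?X \<subseteq> ?X"
  proof
    fix \<epsilon> assume "\<epsilon> \<in> f ` ?X"
    then obtain \<delta> where d: "\<delta> \<in> ?X" "\<epsilon> = f \<delta>" by auto
    then show "\<epsilon> \<in> ?X"
      unfolding d(2) f_def
      using Group.hom_compose[OF epi_hom[OF \<beta>(1)], of \<delta> E] continuous_map_compose[OF \<beta>(2), of _ \<delta>]
      by (intro restr) (simp_all add: continuous_homs_def)
  qed
  moreover have "inj_on f ?X"
  proof (rule inj_onI)
    fix \<delta> \<epsilon> assume a: "\<delta> \<in> ?X" "\<epsilon> \<in> ?X" "f \<delta> = f \<epsilon>"
    have "\<delta> y = \<epsilon> y" if y: "y \<in> carrier P" for y
    proof -
      obtain x where x: "x \<in> carrier P" "y = \<beta> x" using y epi_image[OF \<beta>(1)] by auto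
      have "f \<delta> x = f \<epsilon> x" using a(3) by simp
      then show ?thesis using x by (simp add: f_def)
    qed
    then show "\<delta> = \<epsilon>" using a(1,2) by (intro extensionalityI[of _ "carrier P"]) (auto simp: continuous_homs_def)
  qed
  ultimately have "f ` ?X = ?X" by (rule endo_inj_surj[OF finite_continuous_homs[OF E]])
  moreover have "restrict \<gamma> (carrier P) \<in> ?X" using restr \<gamma> by simp
  ultimately obtain \<delta> where d: "\<delta> \<in> ?X" "restrict \<gamma> (carrier P) = f \<delta>" by (metis imageE)
  have "\<delta> (\<beta> x) = \<gamma> x" if "x \<in> carrier P" for x
    using fun_cong[OF d(2), of x] that by (simp add: f_def)
  then show ?thesis using d(1) by (intro bexI[of _ \<delta>]) (auto simp: continuous_homs_def)
qed

text \<open>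
  The extension to split is the fibre product \<open>D\<close> of \<open>E\<close> and \<open>P\<close> over \<open>Q\<close>.  The resulting \<open>\<theta>\<close> lifts \<open>\<alpha> \<circ> \<beta>\<close> with
  \<open>\<beta> = snd \<circ> \<theta>\<close>, and \<open>factor_through_endomorphism\<close> removes \<open>\<beta>\<close>.
\<close>

theorem projective:
  fixes E :: "nat monoid" and Q :: "('q, 'm) monoid_scheme"
  assumes E: "group E" "finite (carrier E)" and Q: "group Q" and \<pi>: "\<pi> \<in> hom E Q"
    and tor: "\<And>m. m \<in> kernel E Q \<pi> \<Longrightarrow> \<exists>n. m [^]\<^bsub>E\<^esub> (p ^ n) = \<one>\<^bsub>E\<^esub>"
    and \<alpha>: "\<alpha> \<in> hom P Q" "continuous_map T (discrete_topology (carrier Q)) \<alpha>" "\<alpha> ` carrier P \<subseteq> \<pi> ` carrier E"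
  shows "\<exists>\<gamma> \<in> hom P E. continuous_map T (discrete_topology (carrier E)) \<gamma> \<and> (\<forall>x\<in>carrier P. \<pi> (\<gamma> x) = \<alpha> x)"
proof -
  let ?dE = "discrete_topology (carrier E)" and ?D = "E \<times>\<times> P"
  let ?X = "prod_topology ?dE T"
  interpret E: group E by fact
  interpret Q: group Q by fact
  interpret \<pi>: group_hom E Q \<pi> using \<pi> by (simp add: group_hom_iff E Q)
  interpret \<alpha>: group_hom P Q \<alpha> using \<alpha> by (simp add: group_hom_iff is_group Q)
  define D where "D = {z \<in> carrier ?D. \<pi> (fst z) = \<alpha> (snd z)}"
  let ?H = "?D\<lparr>carrier := D\<rparr>" and ?S = "subtopology ?X D"
  have profD: "profinite_group ?D ?X"
    by (rule profinite_DirProd[OF profinite_finite_discrete[OF E] profinite])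
  interpret D: topgroup ?D ?X by (rule profinite_imp_topgroup) (rule profD)
  have sD: "subgroup D ?D"
  proof
    show "D \<subseteq> carrier ?D" by (auto simp: D_def)
    show "\<one>\<^bsub>?D\<^esub> \<in> D" by (simp add: D_def)
    show "x \<otimes>\<^bsub>?D\<^esub> y \<in> D" if "x \<in> D" "y \<in> D" for x y
      using that by (cases x; cases y) (simp add: D_def)
    show "inv\<^bsub>?D\<^esub> x \<in> D" if "x \<in> D" for x
      using that by (cases x) (simp add: D_def inv_DirProd[OF E.is_group is_group])
  qed
  have "continuous_map ?X (discrete_topology (carrier Q)) (\<pi> \<circ> fst)"
    by (rule continuous_map_compose[OF continuous_map_fst]) (simp add: Pi_iff)
  moreover have "continuous_map ?X (discrete_topology (carrier Q)) (\<alpha> \<circ> snd)"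
    by (rule continuous_map_compose[OF continuous_map_snd \<alpha>(2)])
  ultimately have "closedin ?X {z \<in> topspace ?X. (\<pi> \<circ> fst) z = (\<alpha> \<circ> snd) z}"
    by (rule closedin_continuous_maps_eq[OF Hausdorff_space_discrete_topology])
  then have cD: "closedin ?X D" by (simp add: D_def topspace)
  have profH: "profinite_group ?H ?S" by (rule profinite_closed_subgroup[OF profD sD cD])
  have ker: "kernel ?H P snd = (\<lambda>e. (e, \<one>)) ` kernel E Q \<pi>"
    by (auto simp: kernel_def D_def)
  have pow: "(e, \<one>) [^]\<^bsub>?D\<^esub> n = (e [^]\<^bsub>E\<^esub> n, \<one>)" if "e \<in> carrier E" for e and n :: nat
    by (induction n) auto
  have "\<exists>\<theta>\<in>hom P ?H. continuous_map T ?S \<theta> \<and> snd \<circ> \<theta> \<in> epi P P"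
  proof (rule lift_to_extension[OF profH])
    have "x \<in> snd ` D" if x: "x \<in> carrier P" for x
    proof -
      have "\<alpha> x \<in> \<pi> ` carrier E" using x \<alpha>(3) by auto
      then obtain e where "e \<in> carrier E" "\<alpha> x = \<pi> e" by auto
      then show ?thesis using x by (intro image_eqI[of _ _ "(e, x)"]) (simp_all add: D_def)
    qed
    then show "snd \<in> epi ?H P" by (auto simp: epi_def hom_def D_def)
    show "continuous_map ?S T snd"
      by (rule continuous_map_from_subtopology[OF continuous_map_snd])
    have "kernel E Q \<pi> \<subseteq> carrier E" by (auto simp: kernel_def)
    then show "finite (kernel ?H P snd)" unfolding ker using E(2) finite_subset by blast
    fix m assume "m \<in> kernel ?H P snd"
    then obtain e where e: "e \<in> kernel E Q \<pi>" "m = (e, \<one>)" using ker by auto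
    obtain n where "e [^]\<^bsub>E\<^esub> (p ^ n) = \<one>\<^bsub>E\<^esub>" using tor[OF e(1)] by (elim exE)
    then show "\<exists>n. m [^]\<^bsub>?H\<^esub> (p ^ n) = \<one>\<^bsub>?H\<^esub>"
      using e pow by (intro exI[of _ n]) (simp add: kernel_def flip: D.nat_pow_consistent)
  qed
  then obtain \<theta> where \<theta>: "\<theta> \<in> hom P ?H" "continuous_map T ?S \<theta>" "snd \<circ> \<theta> \<in> epi P P"
    by (elim bexE conjE) (rule that)
  have \<theta>X: "continuous_map T ?X \<theta>" using \<theta>(2) by (simp add: continuous_map_in_subtopology)
  have \<theta>D: "\<theta> x \<in> D" if "x \<in> carrier P" for x using \<theta>(1) that by (auto simp: hom_def)
  have "fst \<circ> \<theta> \<in> hom P E"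
    by (rule Group.hom_compose[OF \<theta>(1)]) (auto simp: hom_def D_def)
  moreover have "continuous_map T ?dE (fst \<circ> \<theta>)"
    by (rule continuous_map_compose[OF \<theta>X continuous_map_fst])
  moreover have "continuous_map T T (snd \<circ> \<theta>)"
    by (rule continuous_map_compose[OF \<theta>X continuous_map_snd])
  ultimately obtain \<gamma> where \<gamma>: "\<gamma> \<in> hom P E" "continuous_map T ?dE \<gamma>"
      "\<And>x. x \<in> carrier P \<Longrightarrow> \<gamma> ((snd \<circ> \<theta>) x) = (fst \<circ> \<theta>) x"
    using factor_through_endomorphism[OF E \<theta>(3)] by metis
  have "\<pi> (\<gamma> y) = \<alpha> y" if y: "y \<in> carrier P" for y
  proof -
    obtain x where x: "x \<in> carrier P" "y = snd (\<theta> x)" using y epi_image[OF \<theta>(3)] by auto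
    then show ?thesis using \<gamma>(3)[OF x(1)] \<theta>D[OF x(1)] by (simp add: D_def)
  qed
  then show ?thesis using \<gamma> by (intro bexI[of _ \<gamma>]) auto
qed

end

section \<open>Lifting characters of open normal subgroups\<close>

text \<open>
  The wreath product of \<open>\<int>/n\<close> with \<open>Q\<close>, as the group of permutations of \<open>Q \<times> \<int>/n\<close> in which \<open>(F, g)\<close> sends
  \<open>(q, c)\<close> to \<open>(g q, c + F q)\<close>.
\<close>

definition wreath :: "nat \<Rightarrow> ('q, 'm) monoid_scheme \<Rightarrow> (('q \<Rightarrow> int) \<times> 'q) monoid" where
  "wreath n Q = \<lparr>carrier = (carrier Q \<rightarrow>\<^sub>E {0..<int n}) \<times> carrier Q,
     monoid.mult = (\<lambda>a b. (\<lambda>q\<in>carrier Q. (fst b q + fst a (snd b \<otimes>\<^bsub>Q\<^esub> q)) mod int n, snd a \<otimes>\<^bsub>Q\<^esub> snd b)),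
     one = (\<lambda>q\<in>carrier Q. 0, \<one>\<^bsub>Q\<^esub>)\<rparr>"

lemma wreath_carrier:
  "a \<in> carrier (wreath n Q) \<longleftrightarrow>
     (\<forall>q\<in>carrier Q. 0 \<le> fst a q \<and> fst a q < int n) \<and> fst a \<in> extensional (carrier Q) \<and> snd a \<in> carrier Q"
  by (cases a) (auto simp: wreath_def PiE_iff)

lemma wreath_mult:
  "a \<otimes>\<^bsub>wreath n Q\<^esub> b = (\<lambda>q\<in>carrier Q. (fst b q + fst a (snd b \<otimes>\<^bsub>Q\<^esub> q)) mod int n, snd a \<otimes>\<^bsub>Q\<^esub> snd b)"
  by (simp add: wreath_def)

lemma wreath_one: "\<one>\<^bsub>wreath n Q\<^esub> = (\<lambda>q\<in>carrier Q. 0, \<one>\<^bsub>Q\<^esub>)"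
  by (simp add: wreath_def)

context group
begin

lemma wreath_group:
  assumes "n > 0"
  shows "group (wreath n G)"
proof (rule groupI)
  fix a b c
  assume a: "a \<in> carrier (wreath n G)" and b: "b \<in> carrier (wreath n G)" and c: "c \<in> carrier (wreath n G)"
  show "a \<otimes>\<^bsub>wreath n G\<^esub> b \<in> carrier (wreath n G)"
    using a b assms by (simp add: wreath_carrier wreath_mult)
  show "a \<otimes>\<^bsub>wreath n G\<^esub> b \<otimes>\<^bsub>wreath n G\<^esub> c = a \<otimes>\<^bsub>wreath n G\<^esub> (b \<otimes>\<^bsub>wreath n G\<^esub> c)"
    using a b c by (auto simp: wreath_def m_assoc mod_add_left_eq mod_add_right_eq add.assoc intro!: restrict_ext)
next
  show "\<one>\<^bsub>wreath n G\<^esub> \<in> carrier (wreath n G)" using assms by (simp add: wreath_def)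
next
  fix a assume a: "a \<in> carrier (wreath n G)"
  show "\<one>\<^bsub>wreath n G\<^esub> \<otimes>\<^bsub>wreath n G\<^esub> a = a"
    using a by (auto simp: wreath_def PiE_iff prod_eq_iff intro!: extensionalityI[of _ "carrier G"])
  let ?b = "(\<lambda>q\<in>carrier G. - fst a (inv (snd a) \<otimes> q) mod int n, inv (snd a))"
  have "?b \<in> carrier (wreath n G)" using a assms by (simp add: wreath_carrier)
  moreover have "?b \<otimes>\<^bsub>wreath n G\<^esub> a = \<one>\<^bsub>wreath n G\<^esub>"
    using a by (auto simp: wreath_def mod_add_right_eq simp flip: m_assoc intro!: restrict_ext)
  ultimately show "\<exists>b\<in>carrier (wreath n G). b \<otimes>\<^bsub>wreath n G\<^esub> a = \<one>\<^bsub>wreath n G\<^esub>" by (rule bexI[rotated])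
qed

lemma wreath_finite: "finite (carrier G) \<Longrightarrow> finite (carrier (wreath n G))"
  by (auto simp: wreath_def intro: finite_PiE)

definition wreath_reduce :: "nat \<Rightarrow> ('a \<Rightarrow> int) \<times> 'a \<Rightarrow> ('a \<Rightarrow> int) \<times> 'a" where
  "wreath_reduce n a = (\<lambda>q\<in>carrier G. fst a q mod int n, snd a)"

lemma wreath_reduce_hom:
  assumes "n > 0" "n dvd m"
  shows "wreath_reduce n \<in> hom (wreath m G) (wreath n G)"
proof (rule homI)
  have nm: "int n dvd int m" using assms by simp
  fix a b assume ab: "a \<in> carrier (wreath m G)" "b \<in> carrier (wreath m G)"
  show "wreath_reduce n a \<in> carrier (wreath n G)"
    using ab assms(1) by (simp add: wreath_carrier wreath_reduce_def)
  show "wreath_reduce n (a \<otimes>\<^bsub>wreath m G\<^esub> b) = wreath_reduce n a \<otimes>\<^bsub>wreath n G\<^esub> wreath_reduce n b"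
    using ab nm by (auto simp: wreath_def wreath_reduce_def mod_mod_cancel mod_add_eq intro!: restrict_ext)
qed

lemma wreath_reduce_surj:
  assumes "n > 0" "n dvd m" "m > 0"
  shows "carrier (wreath n G) \<subseteq> wreath_reduce n ` carrier (wreath m G)"
proof
  fix a assume a: "a \<in> carrier (wreath n G)"
  have "n \<le> m" using assms by (simp add: dvd_imp_le)
  then have "a \<in> carrier (wreath m G)" using a by (force simp: wreath_def PiE_iff)
  moreover have "wreath_reduce n a = a"
    using a by (auto simp: wreath_def wreath_reduce_def PiE_iff prod_eq_iff intro!: extensionalityI[of _ "carrier G"])
  ultimately show "a \<in> wreath_reduce n ` carrier (wreath m G)" by (metis imageI)
qed

lemma wreath_pow:
  shows "(F, \<one>) [^]\<^bsub>wreath n G\<^esub> (k::nat) = (\<lambda>q\<in>carrier G. (int k * F q) mod int n, \<one>)"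
proof (induction k)
  case 0
  show ?case by (simp add: wreath_one restrict_def)
next
  case (Suc k)
  then show ?case
    by (auto simp: wreath_mult mod_add_right_eq algebra_simps intro!: restrict_ext)
qed

end

lemma (in topgroup) continuous_hom_if_open_kernel:
  assumes f: "f \<in> hom G Q" and Q: "group Q" and ker: "openin T (kernel G Q f)"
  shows "continuous_map T (discrete_topology (carrier Q)) f"
proof -
  interpret f: group_hom G Q f using f Q by (simp add: group_hom_iff is_group)
  have fib: "openin T {x \<in> carrier G. f x = c}" for c
  proof (cases "\<exists>a\<in>carrier G. f a = c")
    case True
    then obtain a where a: "a \<in> carrier G" "f a = c" by auto
    have "{x \<in> carrier G. f x = c} = kernel G Q f #> a"
    proof (intro equalityI subsetI)
      fix x assume "x \<in> {x \<in> carrier G. f x = c}"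
      then have "x = (x \<otimes> inv a) \<otimes> a" "x \<otimes> inv a \<in> kernel G Q f" 
        using a f.H.r_inv[of c] f.hom_closed[of a] by (auto simp: m_assoc kernel_def)
      then show "x \<in> kernel G Q f #> a" unfolding r_coset_def by blast
    qed (use a in \<open>auto simp: r_coset_def kernel_def\<close>)
    then show ?thesis using open_rcos[OF ker a(1)] by simp
  next
    case False
    then have "{x \<in> carrier G. f x = c} = {}" by auto
    then show ?thesis by (simp only: openin_empty)
  qed
  show ?thesis
    unfolding continuous_map_def
  proof (intro conjI allI impI)
    fix U assume "openin (discrete_topology (carrier Q)) U"
    have "{x \<in> topspace T. f x \<in> U} = (\<Union>c\<in>U. {x \<in> carrier G. f x = c})" by (auto simp: topspace)
    then show "openin T {x \<in> topspace T. f x \<in> U}" using fib by (auto intro: openin_Union)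
  qed (simp add: topspace)
qed

context universal_cover
begin

lemma projective_finite:
  fixes E :: "('e, 'l) monoid_scheme" and Q :: "('q, 'm) monoid_scheme"
  assumes E: "group E" "finite (carrier E)" and Q: "group Q" and \<pi>: "\<pi> \<in> hom E Q"
    and tor: "\<And>m. m \<in> kernel E Q \<pi> \<Longrightarrow> \<exists>n. m [^]\<^bsub>E\<^esub> (p ^ n) = \<one>\<^bsub>E\<^esub>"
    and \<alpha>: "\<alpha> \<in> hom P Q" "continuous_map T (discrete_topology (carrier Q)) \<alpha>" "\<alpha> ` carrier P \<subseteq> \<pi> ` carrier E"
  shows "\<exists>\<gamma> \<in> hom P E. continuous_map T (discrete_topology (carrier E)) \<gamma> \<and> (\<forall>x\<in>carrier P. \<pi> (\<gamma> x) = \<alpha> x)"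
proof -
  obtain E' :: "nat monoid" and h where E': "group E'" and h: "h \<in> iso E E'"
    using finite_group_nat_copy[OF E] by (elim exE conjE) (rule that)
  define g where "g = inv_into (carrier E) h"
  have g: "g \<in> iso E' E" using group.iso_set_sym[OF E(1) h] by (simp add: g_def)
  have gE: "g ` carrier E' = carrier E" and gi: "inj_on g (carrier E')" using g by (simp_all add: iso_iff)
  interpret g: group_hom E' E g
    using iso_imp_homomorphism[OF g] E E' by (simp add: group_hom_iff)
  have "\<exists>\<gamma> \<in> hom P E'. continuous_map T (discrete_topology (carrier E')) \<gamma> \<and> (\<forall>x\<in>carrier P. (\<pi> \<circ> g) (\<gamma> x) = \<alpha> x)"
  proof (rule projective[OF E' _ Q _ _ \<alpha>(1,2)])
    show "finite (carrier E')" using E(2) gE gi by (metis finite_imageD)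
    show "\<pi> \<circ> g \<in> hom E' Q" by (rule Group.hom_compose[OF g.homh \<pi>])
    show "\<alpha> ` carrier P \<subseteq> (\<pi> \<circ> g) ` carrier E'" using \<alpha>(3) by (simp only: image_comp[symmetric] gE)
    fix m assume "m \<in> kernel E' Q (\<pi> \<circ> g)"
    then have m: "m \<in> carrier E'" "g m \<in> kernel E Q \<pi>" by (simp_all add: kernel_def)
    obtain n where "g m [^]\<^bsub>E\<^esub> (p ^ n) = \<one>\<^bsub>E\<^esub>" using tor[OF m(2)] by (elim exE)
    then have "g (m [^]\<^bsub>E'\<^esub> (p ^ n)) = g \<one>\<^bsub>E'\<^esub>" using g.hom_nat_pow[OF m(1)] by simp
    then show "\<exists>n. m [^]\<^bsub>E'\<^esub> (p ^ n) = \<one>\<^bsub>E'\<^esub>"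
      using inj_onD[OF gi] m(1) by (intro exI[of _ n]) simp
  qed
  then obtain \<gamma> where \<gamma>: "\<gamma> \<in> hom P E'" "continuous_map T (discrete_topology (carrier E')) \<gamma>"
      "\<And>x. x \<in> carrier P \<Longrightarrow> \<pi> (g (\<gamma> x)) = \<alpha> x" by auto
  have "continuous_map T (discrete_topology (carrier E)) (g \<circ> \<gamma>)"
    by (rule continuous_map_compose[OF \<gamma>(2)]) (simp add: Pi_iff)
  then show ?thesis
    using Group.hom_compose[OF \<gamma>(1) g.homh] \<gamma>(3) by (intro bexI[of _ "g \<circ> \<gamma>"]) auto
qed

text \<open>
  With coset representatives \<open>t q\<close>, the character \<open>l\<close> of \<open>K\<close> induces the homomorphism \<open>\<alpha>\<close> from \<open>P\<close> to the wreath
  product that sends \<open>x\<close> to \<open>q \<mapsto> l (inv t (x q) \<otimes> x \<otimes> t q)\<close> and the coset of \<open>x\<close>, as in the embedding theorem of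
  Kaloujnine and Krasner.  Projectivity lifts it from \<open>\<int>/p\<close> to \<open>\<int>/p\<^sup>2\<close>, and on \<open>K\<close> the component of the lift
  at the trivial coset is additive.
\<close>

lemma character_lifts_mod_p_squared:
  assumes K: "K \<lhd> P" "openin T K"
    and l: "l \<in> hom (P\<lparr>carrier := K\<rparr>) (integer_mod_group p)" and ker: "openin T {x \<in> K. l x = 0}"
  shows "\<exists>L \<in> hom (P\<lparr>carrier := K\<rparr>) (integer_mod_group (p\<^sup>2)).
     openin T {x \<in> K. L x = 0} \<and> (\<forall>x\<in>K. L x mod int p = l x)"
proof -
  interpret K: normal K P by (rule K(1))
  let ?Q = "P Mod K" and ?c = "\<lambda>x. K #> x"
  interpret Q: group ?Q by (rule K.factorgroup_is_group)
  interpret c: group_hom P ?Q ?c by (rule rcos_hom) (rule K(1))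
  have p0: "0 < p" and p20: "0 < p\<^sup>2" and pd: "p dvd p\<^sup>2"
    using prime_p by (simp_all add: prime_gt_0_nat power2_eq_square)
  have finQ: "finite (carrier ?Q)"
    using finite_index_if_open[OF compact K.is_subgroup K(2)] by (simp add: FactGroup_def)
  \<comment> \<open>The representative of the trivial coset has to be \<open>\<one>\<close>, so that the component of \<open>\<alpha> x\<close> there is \<open>l x\<close> for \<open>x\<close> in \<open>K\<close>.\<close>
  define t where "t q = (if q = K then \<one> else SOME x. x \<in> carrier P \<and> ?c x = q)" for q
  have t: "t q \<in> carrier P \<and> ?c (t q) = q" if q: "q \<in> carrier ?Q" for q
  proof (cases "q = K")
    case False
    have "\<exists>x. x \<in> carrier P \<and> ?c x = q" using q by (auto simp: carrier_FactGroup)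
    from someI_ex[OF this] show ?thesis using False by (simp add: t_def)
  qed (simp add: t_def K.subset)
  have cm: "?c x \<otimes>\<^bsub>?Q\<^esub> q \<in> carrier ?Q" if "x \<in> carrier P" "q \<in> carrier ?Q" for x q
    using that c.hom_closed by (intro Q.m_closed)
  \<comment> \<open>Measures how far \<open>t\<close> is from being equivariant; it is a cocycle with values in \<open>K\<close>.\<close>
  define d where "d x q = inv t (?c x \<otimes>\<^bsub>?Q\<^esub> q) \<otimes> x \<otimes> t q" for x q
  have dK: "d x q \<in> K" if x: "x \<in> carrier P" and q: "q \<in> carrier ?Q" for x q
  proof -
    have dP: "d x q \<in> carrier P" using t[OF q] t[OF cm[OF x q]] x by (simp add: d_def del: mult_FactGroup)
    have "?c (d x q) = inv\<^bsub>?Q\<^esub> (?c x \<otimes>\<^bsub>?Q\<^esub> q) \<otimes>\<^bsub>?Q\<^esub> (?c x \<otimes>\<^bsub>?Q\<^esub> q)"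
      using t[OF q] t[OF cm[OF x q]] x q c.hom_closed
      by (simp add: d_def c.hom_mult c.hom_inv Q.m_assoc del: mult_FactGroup)
    then have "?c (d x q) = K" using Q.l_inv[OF cm[OF x q]] by simp
    then show ?thesis using rcos_eq_one_iff[OF K(1) dP] by simp
  qed
  have d_mult: "d (x \<otimes> y) q = d x (?c y \<otimes>\<^bsub>?Q\<^esub> q) \<otimes> d y q"
    if x: "x \<in> carrier P" and y: "y \<in> carrier P" and q: "q \<in> carrier ?Q" for x y q
  proof -
    have "?c (x \<otimes> y) \<otimes>\<^bsub>?Q\<^esub> q = ?c x \<otimes>\<^bsub>?Q\<^esub> (?c y \<otimes>\<^bsub>?Q\<^esub> q)"
      using x y q c.hom_closed by (simp add: c.hom_mult Q.m_assoc del: mult_FactGroup)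
    moreover have "t (?c y \<otimes>\<^bsub>?Q\<^esub> q) \<otimes> (inv t (?c y \<otimes>\<^bsub>?Q\<^esub> q) \<otimes> (y \<otimes> t q)) = y \<otimes> t q"
      using t[OF q] t[OF cm[OF y q]] y by (simp flip: m_assoc)
    ultimately show ?thesis
      using x y t[OF q] t[OF cm[OF y q]] t[OF cm[OF x cm[OF y q]]] by (simp add: d_def m_assoc)
  qed
  have l_mult: "l (x \<otimes> y) = (l x + l y) mod int p" if "x \<in> K" "y \<in> K" for x y
    using hom_mult[OF l] that by simp
  have l_range: "l x \<in> {0..<int p}" if "x \<in> K" for x
    using hom_in_carrier[OF l, of x] that p0 by (simp add: carrier_integer_mod_group)
  define \<alpha> where "\<alpha> x = (\<lambda>q\<in>carrier ?Q. l (d x q), ?c x)" for x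
  have \<alpha>_hom: "\<alpha> \<in> hom P (wreath p ?Q)"
  proof (rule homI)
    fix x assume x: "x \<in> carrier P"
    show "\<alpha> x \<in> carrier (wreath p ?Q)"
      using l_range[OF dK[OF x]] c.hom_closed[OF x] by (auto simp: wreath_def \<alpha>_def)
    fix y assume y: "y \<in> carrier P"
    show "\<alpha> (x \<otimes> y) = \<alpha> x \<otimes>\<^bsub>wreath p ?Q\<^esub> \<alpha> y"
      unfolding \<alpha>_def wreath_def
      using x y cm[OF y] c.hom_mult[OF x y] dK
      by (auto simp: d_mult l_mult add.commute simp del: mult_FactGroup intro!: restrict_ext)
  qed
  have "openin T (kernel P (wreath p ?Q) \<alpha>)"
  proof -
    have "openin T {x \<in> topspace T. inv t q \<otimes> x \<otimes> t q \<in> {x \<in> K. l x = 0}}" if "q \<in> carrier ?Q" for q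
      by (rule openin_continuous_map_preimage[OF _ ker]) (intro continuous_group, use t[OF that] in auto)
    moreover have "finite (carrier ?Q)" "carrier ?Q \<noteq> {}" using finQ Q.one_closed by auto
    ultimately have "openin T (\<Inter>q\<in>carrier ?Q. {x \<in> topspace T. inv t q \<otimes> x \<otimes> t q \<in> {x \<in> K. l x = 0}})"
      by (intro openin_INT2) auto
    moreover have "kernel P (wreath p ?Q) \<alpha> =
        K \<inter> (\<Inter>q\<in>carrier ?Q. {x \<in> topspace T. inv t q \<otimes> x \<otimes> t q \<in> {x \<in> K. l x = 0}})"
    proof -
      have "\<alpha> x = \<one>\<^bsub>wreath p ?Q\<^esub> \<longleftrightarrow> x \<in> K \<and> (\<forall>q\<in>carrier ?Q. inv t q \<otimes> x \<otimes> t q \<in> {x \<in> K. l x = 0})"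
        if x: "x \<in> carrier P" for x
      proof -
        have "d x q = inv t q \<otimes> x \<otimes> t q" if "x \<in> K" "q \<in> carrier ?Q" for q
          using that x rcos_eq_one_iff[OF K(1) x] Q.l_one[of q] by (simp add: d_def)
        moreover have "\<alpha> x = \<one>\<^bsub>wreath p ?Q\<^esub> \<longleftrightarrow> x \<in> K \<and> (\<forall>q\<in>carrier ?Q. l (d x q) = 0)"
          using rcos_eq_one_iff[OF K(1) x] by (auto simp: \<alpha>_def wreath_def restrict_def fun_eq_iff)
        ultimately show ?thesis using dK[OF x] by force
      qed
      then show ?thesis using Q.one_closed by (auto simp: kernel_def topspace)
    qed
    ultimately show ?thesis using K(2) by (simp add: openin_Int)
  qed
  then have \<alpha>_cont: "continuous_map T (discrete_topology (carrier (wreath p ?Q))) \<alpha>"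
    by (rule continuous_hom_if_open_kernel[OF \<alpha>_hom Q.wreath_group[OF p0]])
  let ?W = "wreath (p\<^sup>2) ?Q" and ?r = "group.wreath_reduce ?Q p"
  have W: "group ?W" by (rule Q.wreath_group[OF p20])
  have "\<exists>\<gamma> \<in> hom P ?W. continuous_map T (discrete_topology (carrier ?W)) \<gamma> \<and> (\<forall>x\<in>carrier P. ?r (\<gamma> x) = \<alpha> x)"
  proof (rule projective_finite[OF W Q.wreath_finite[OF finQ] Q.wreath_group[OF p0]
        Q.wreath_reduce_hom[OF p0 pd] _ \<alpha>_hom \<alpha>_cont])
    show "\<alpha> ` carrier P \<subseteq> ?r ` carrier ?W"
      using Q.wreath_reduce_surj[OF p0 pd p20] hom_in_carrier[OF \<alpha>_hom] by blast
    fix m assume m: "m \<in> kernel ?W (wreath p ?Q) ?r"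
    then have mW: "m \<in> carrier ?W" and m1: "?r m = \<one>\<^bsub>wreath p ?Q\<^esub>" by (simp_all add: kernel_def)
    have s: "snd m = \<one>\<^bsub>?Q\<^esub>" using m1 by (simp add: Q.wreath_reduce_def wreath_def)
    have f: "fst m q mod int p = 0" if "q \<in> carrier ?Q" for q
      using m1 that by (auto simp: Q.wreath_reduce_def wreath_def fun_eq_iff restrict_def split: if_splits)
    have "(fst m, \<one>\<^bsub>?Q\<^esub>) [^]\<^bsub>?W\<^esub> p = (\<lambda>q\<in>carrier ?Q. (int p * fst m q) mod int (p\<^sup>2), \<one>\<^bsub>?Q\<^esub>)"
      by (rule Q.wreath_pow)
    also have "\<dots> = \<one>\<^bsub>?W\<^esub>"
      using f by (auto simp: wreath_def power2_eq_square mod_mult_mult1 intro!: restrict_ext)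
    finally show "\<exists>n. m [^]\<^bsub>?W\<^esub> (p ^ n) = \<one>\<^bsub>?W\<^esub>"
      using s by (intro exI[of _ 1]) (metis power_one_right prod.collapse)
  qed
  then obtain \<gamma> where \<gamma>: "\<gamma> \<in> hom P ?W" "continuous_map T (discrete_topology (carrier ?W)) \<gamma>"
      and r\<gamma>: "\<And>x. x \<in> carrier P \<Longrightarrow> ?r (\<gamma> x) = \<alpha> x" by auto
  interpret \<gamma>: group_hom P ?W \<gamma> using \<gamma>(1) W by (simp add: group_hom_iff is_group)
  define L where "L x = fst (\<gamma> x) K" for x
  have KQ: "K \<in> carrier ?Q" using Q.one_closed by simp
  have snd\<gamma>: "snd (\<gamma> x) = ?c x" if "x \<in> carrier P" for x
    using arg_cong[OF r\<gamma>[OF that], of snd] by (simp add: Q.wreath_reduce_def \<alpha>_def)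
  have L_mult: "L (x \<otimes> y) = (L x + L y) mod int (p\<^sup>2)" if x: "x \<in> K" and y: "y \<in> K" for x y
  proof -
    have xy: "x \<in> carrier P" "y \<in> carrier P" using x y by auto
    have "snd (\<gamma> y) \<otimes>\<^bsub>?Q\<^esub> K = K"
      using snd\<gamma>[OF xy(2)] rcos_eq_one_iff[OF K(1) xy(2)] y Q.l_one[OF KQ] by simp
    moreover have "L (x \<otimes> y) = (fst (\<gamma> y) K + fst (\<gamma> x) (snd (\<gamma> y) \<otimes>\<^bsub>?Q\<^esub> K)) mod int (p\<^sup>2)"
      unfolding L_def \<gamma>.hom_mult[OF xy] using KQ by (simp add: wreath_def del: mult_FactGroup)
    ultimately show ?thesis by (simp only: L_def add.commute)
  qed
  have L_range: "L x \<in> {0..<int (p\<^sup>2)}" if "x \<in> K" for x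
    using \<gamma>.hom_closed[of x] that KQ by (auto simp: L_def wreath_def PiE_iff mem_Times_iff)
  have L_hom: "L \<in> hom (P\<lparr>carrier := K\<rparr>) (integer_mod_group (p\<^sup>2))"
    by (rule homI) (use L_mult L_range p0 in \<open>auto simp: carrier_integer_mod_group\<close>)
  moreover have "openin T {x \<in> K. L x = 0}"
  proof -
    have "openin T {x \<in> topspace T. \<gamma> x \<in> {\<one>\<^bsub>?W\<^esub>}}"
      using W by (intro openin_continuous_map_preimage[OF \<gamma>(2)]) (simp add: group.is_monoid)
    then have o: "openin T (K \<inter> {x \<in> topspace T. \<gamma> x \<in> {\<one>\<^bsub>?W\<^esub>}})"
      using K(2) by (simp add: openin_Int)
    have L1: "L \<one> = 0" using KQ unfolding L_def \<gamma>.hom_one by (simp add: wreath_def)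
    have sub: "subgroup {x \<in> K. L x = 0} P"
    proof
      fix x assume x: "x \<in> {x \<in> K. L x = 0}"
      then have "L (x \<otimes> inv x) = L (inv x) mod int (p\<^sup>2)" using L_mult[of x "inv x"] by simp
      moreover have "L (inv x) \<in> {0..<int (p\<^sup>2)}" using x L_range by simp
      ultimately show "inv x \<in> {x \<in> K. L x = 0}" using x L1 by simp
    qed (use L1 L_mult K.subset in auto)
    have "L x = 0" if "\<gamma> x = \<one>\<^bsub>?W\<^esub>" for x using that KQ by (simp add: L_def wreath_one)
    then have sup: "K \<inter> {x \<in> topspace T. \<gamma> x \<in> {\<one>\<^bsub>?W\<^esub>}} \<subseteq> {x \<in> K. L x = 0}" by auto
    have "\<one> \<in> K \<inter> {x \<in> topspace T. \<gamma> x \<in> {\<one>\<^bsub>?W\<^esub>}}" by (simp add: topspace)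
    then show ?thesis by (rule closed_if_contains_open(1)[OF sub o sup])
  qed
  moreover have "L x mod int p = l x" if x: "x \<in> K" for x
  proof -
    have xP: "x \<in> carrier P" using x by simp
    have "fst (?r (\<gamma> x)) K = fst (\<alpha> x) K" using r\<gamma>[OF xP] by simp
    then have "L x mod int p = l (d x K)" using KQ by (simp add: Q.wreath_reduce_def \<alpha>_def L_def)
    moreover have "?c x \<otimes>\<^bsub>?Q\<^esub> K = K" using rcos_eq_one_iff[OF K(1) xP] x Q.l_one[OF KQ] by simp
    then have "d x K = x" using xP by (simp add: d_def t_def)
    ultimately show ?thesis by simp
  qed
  ultimately show ?thesis by blast
qed

end

section \<open>Commutators and powers\<close>

context group
begin

abbreviation comm :: "'a \<Rightarrow> 'a \<Rightarrow> 'a" where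
  "comm a b \<equiv> a \<otimes> b \<otimes> inv a \<otimes> inv b"

lemma comm_eq_one_iff:
  assumes "a \<in> carrier G" "b \<in> carrier G"
  shows "comm a b = \<one> \<longleftrightarrow> a \<otimes> b = b \<otimes> a"
proof -
  have "comm a b = (a \<otimes> b) \<otimes> inv (b \<otimes> a)" using assms by (simp add: inv_mult_group m_assoc)
  then show ?thesis using assms by (simp add: inv_solve_right')
qed

lemma comm_mult_left_commuting:
  assumes "x \<in> carrier G" "y \<in> carrier G" "s \<in> carrier G" "s \<otimes> y = y \<otimes> s"
  shows "comm (x \<otimes> s) y = comm x y"
proof -
  have "x \<otimes> s \<otimes> y \<otimes> inv (x \<otimes> s) \<otimes> inv y = x \<otimes> (s \<otimes> y) \<otimes> inv s \<otimes> inv x \<otimes> inv y"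
    using assms(1-3) by (simp add: inv_mult_group m_assoc)
  also have "\<dots> = comm x y" unfolding assms(4) using assms(1-3) by (simp add: m_assoc)
  finally show ?thesis .
qed

lemma commutes_with_inv:
  assumes "x \<in> carrier G" "u \<in> carrier G" "x \<otimes> u = u \<otimes> x"
  shows "x \<otimes> inv u = inv u \<otimes> x"
proof -
  have "x \<otimes> inv u = inv u \<otimes> (u \<otimes> x) \<otimes> inv u" using assms(1,2) by (simp flip: m_assoc)
  also have "\<dots> = inv u \<otimes> x" unfolding assms(3)[symmetric] using assms(1,2) by (simp add: m_assoc)
  finally show ?thesis .
qed

lemma comm_mult_right_commuting:
  assumes "x \<in> carrier G" "y \<in> carrier G" "t \<in> carrier G" "t \<otimes> x = x \<otimes> t"
  shows "comm x (y \<otimes> t) = comm x y"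
proof -
  have "t \<otimes> inv x = inv x \<otimes> t" by (rule commutes_with_inv) (use assms in simp_all)
  moreover have "t \<otimes> (inv t \<otimes> inv y) = inv y" using assms(1-3) by (simp flip: m_assoc)
  moreover have "x \<otimes> (y \<otimes> t) \<otimes> inv x \<otimes> inv (y \<otimes> t) = x \<otimes> y \<otimes> (t \<otimes> inv x) \<otimes> (inv t \<otimes> inv y)"
    using assms(1-3) by (simp add: inv_mult_group m_assoc)
  ultimately show ?thesis using assms(1-3) by (simp add: m_assoc)
qed

lemma conj_comm:
  assumes "g \<in> carrier G" "x \<in> carrier G" "y \<in> carrier G"
  shows "g \<otimes> comm x y \<otimes> inv g = comm (g \<otimes> x \<otimes> inv g) (g \<otimes> y \<otimes> inv g)"
proof -
  have c: "inv g \<otimes> (g \<otimes> z) = z" if "z \<in> carrier G" for z using assms that by (simp flip: m_assoc)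
  show ?thesis using assms by (simp add: inv_mult_group m_assoc c)
qed

lemma conj_pow:
  assumes "g \<in> carrier G" "x \<in> carrier G"
  shows "g \<otimes> x [^] (n::nat) \<otimes> inv g = (g \<otimes> x \<otimes> inv g) [^] n"
proof (induction n)
  case (Suc n)
  have "g \<otimes> x [^] Suc n \<otimes> inv g = (g \<otimes> x [^] n \<otimes> inv g) \<otimes> (g \<otimes> x \<otimes> inv g)"
  proof -
    have "inv g \<otimes> (g \<otimes> z) = z" if "z \<in> carrier G" for z using assms that by (simp flip: m_assoc)
    then show ?thesis using assms by (simp add: m_assoc)
  qed
  then show ?case using Suc by simp
qed (use assms in simp)

text \<open>
  Each time a \<open>y\<close> moves to the right past an \<open>x\<close>, a factor \<open>z\<close> appears, and there are \<open>n (n - 1) / 2\<close> such moves.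
\<close>

lemma pow_mult_class_two:
  assumes x: "x \<in> carrier G" and y: "y \<in> carrier G" and z: "z \<in> carrier G"
    and yx: "y \<otimes> x = x \<otimes> y \<otimes> z" and zx: "z \<otimes> x = x \<otimes> z" and zy: "z \<otimes> y = y \<otimes> z"
  shows "(x \<otimes> y) [^] (n::nat) = x [^] n \<otimes> y [^] n \<otimes> z [^] (n * (n - 1) div 2)"
proof -
  have zkx: "z [^] (k::nat) \<otimes> x = x \<otimes> z [^] k" "z [^] (k::nat) \<otimes> y = y \<otimes> z [^] k" for k
    using group_commutes_pow[OF zx z x] group_commutes_pow[OF zy z y] by auto
  have ynx: "y [^] n \<otimes> x = x \<otimes> y [^] n \<otimes> z [^] n" for n :: nat
  proof (induction n)
    case (Suc n)
    have "y [^] Suc n \<otimes> x = y [^] n \<otimes> (y \<otimes> x)" using x y by (simp add: m_assoc)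
    also have "\<dots> = (y [^] n \<otimes> x) \<otimes> (y \<otimes> z)" unfolding yx using x y z by (simp add: m_assoc)
    also have "\<dots> = x \<otimes> y [^] n \<otimes> (z [^] n \<otimes> y) \<otimes> z" unfolding Suc using x y z by (simp add: m_assoc)
    also have "\<dots> = x \<otimes> y [^] Suc n \<otimes> z [^] Suc n" unfolding zkx using x y z by (simp add: m_assoc)
    finally show ?case .
  qed (use x in simp)
  show ?thesis
  proof (induction n)
    case (Suc n)
    define k where "k = n * (n - 1) div 2"
    have k: "n + k = Suc n * (Suc n - 1) div 2"
      unfolding k_def by (cases n) (simp_all add: algebra_simps)
    have "(x \<otimes> y) [^] Suc n = x [^] n \<otimes> y [^] n \<otimes> (z [^] k \<otimes> x) \<otimes> y"
      using x y z Suc by (simp add: m_assoc k_def)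
    also have "\<dots> = x [^] n \<otimes> (y [^] n \<otimes> x) \<otimes> (z [^] k \<otimes> y)"
      unfolding zkx(1) using x y z by (simp add: m_assoc)
    also have "\<dots> = x [^] n \<otimes> (x \<otimes> y [^] n \<otimes> z [^] n) \<otimes> (y \<otimes> z [^] k)"
      by (simp only: ynx zkx(2))
    also have "\<dots> = x [^] Suc n \<otimes> y [^] n \<otimes> (z [^] n \<otimes> y) \<otimes> z [^] k"
      using x y z by (simp add: m_assoc)
    also have "\<dots> = x [^] Suc n \<otimes> y [^] Suc n \<otimes> z [^] (n + k)"
      unfolding zkx(2) using x y z by (simp add: m_assoc nat_pow_mult)
    finally show ?case unfolding k .
  qed simp
qed

lemma comm_mem_iff:
  assumes "N \<lhd> G" "a \<in> carrier G" "b \<in> carrier G"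
  shows "comm a b \<in> N \<longleftrightarrow> (N #> a) \<otimes>\<^bsub>G Mod N\<^esub> (N #> b) = (N #> b) \<otimes>\<^bsub>G Mod N\<^esub> (N #> a)"
proof -
  interpret c: group_hom G "G Mod N" "\<lambda>x. N #> x" by (rule rcos_hom) fact
  have "comm a b \<in> N \<longleftrightarrow> N #> comm a b = \<one>\<^bsub>G Mod N\<^esub>"
    using rcos_eq_one_iff[OF assms(1), of "comm a b"] assms by simp
  also have "N #> comm a b = c.H.comm (N #> a) (N #> b)"
    using assms by (simp add: c.hom_mult c.hom_inv del: mult_FactGroup)
  finally show ?thesis using c.H.comm_eq_one_iff assms c.hom_closed by auto
qed

lemma normal_comm_subgroup:
  assumes "A \<lhd> G" "B \<lhd> G"
  shows "comm_subgroup G A B \<lhd> G"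
proof -
  interpret A: normal A G by fact
  interpret B: normal B G by fact
  show ?thesis
    unfolding comm_subgroup_def
  proof (rule normal_generateI)
    fix h g assume "h \<in> {comm a b |a b. a \<in> A \<and> b \<in> B}" and g: "g \<in> carrier G"
    then obtain a b where ab: "a \<in> A" "b \<in> B" "h = comm a b" by auto
    then have "g \<otimes> h \<otimes> inv g = comm (g \<otimes> a \<otimes> inv g) (g \<otimes> b \<otimes> inv g)" using g conj_comm by simp
    then show "g \<otimes> h \<otimes> inv g \<in> {comm a b |a b. a \<in> A \<and> b \<in> B}"
      using A.inv_op_closed2[OF g ab(1)] B.inv_op_closed2[OF g ab(2)] by blast
  qed auto
qed

lemma normal_pow_subgroup:
  assumes "A \<lhd> G"
  shows "pow_subgroup n G A \<lhd> G"
proof -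
  interpret A: normal A G by fact
  show ?thesis
    unfolding pow_subgroup_def
  proof (rule normal_generateI)
    fix h g assume "h \<in> {a [^] n |a. a \<in> A}" and g: "g \<in> carrier G"
    then obtain a where a: "a \<in> A" "h = a [^] n" by auto
    then have "g \<otimes> h \<otimes> inv g = (g \<otimes> a \<otimes> inv g) [^] n" using g conj_pow by simp
    then show "g \<otimes> h \<otimes> inv g \<in> {a [^] n |a. a \<in> A}"
      using A.inv_op_closed2[OF g a(1)] by blast
  qed auto
qed

lemma comm_subgroup_mem: "a \<in> A \<Longrightarrow> b \<in> B \<Longrightarrow> comm a b \<in> comm_subgroup G A B"
  unfolding comm_subgroup_def by (intro generate.incl) blast

lemma pow_subgroup_mem: "a \<in> A \<Longrightarrow> a [^] n \<in> pow_subgroup n G A"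
  unfolding pow_subgroup_def by (intro generate.incl) blast

lemma comm_subgroup_least:
  "\<lbrakk>subgroup N G; \<And>a b. a \<in> A \<Longrightarrow> b \<in> B \<Longrightarrow> comm a b \<in> N\<rbrakk> \<Longrightarrow> comm_subgroup G A B \<subseteq> N"
  unfolding comm_subgroup_def by (intro generate_subgroup_incl) auto

lemma pow_subgroup_least:
  "\<lbrakk>subgroup N G; \<And>a. a \<in> A \<Longrightarrow> a [^] n \<in> N\<rbrakk> \<Longrightarrow> pow_subgroup n G A \<subseteq> N"
  unfolding pow_subgroup_def by (intro generate_subgroup_incl) auto

lemma generate_Un_normal:
  assumes "M \<lhd> G" "N \<lhd> G"
  shows "generate G (M \<union> N) = M <#> N"
proof (rule generateI[symmetric])
  interpret M: normal M G by fact
  interpret N: normal N G by fact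
  show "subgroup (M <#> N) G"
    by (rule normal_imp_subgroup[OF normal_subgroup_set_mult_closed[OF assms]])
  show "M \<union> N \<subseteq> M <#> N"
  proof
    fix x assume "x \<in> M \<union> N"
    then show "x \<in> M <#> N"
    proof
      assume "x \<in> M"
      then show ?thesis
        using N.one_closed M.subset unfolding set_mult_def by (force intro: bexI[of _ x])
    next
      assume "x \<in> N"
      then show ?thesis
        using M.one_closed N.subset unfolding set_mult_def by (force intro: bexI[of _ \<one>])
    qed
  qed
  fix H assume "subgroup H G" "M \<union> N \<subseteq> H"
  then show "M <#> N \<subseteq> H" unfolding set_mult_def by (auto intro: subgroup.m_closed)
qed

lemma comm_mem_commute:
  assumes "N \<lhd> G" "a \<in> carrier G" "b \<in> carrier G"
  shows "comm a b \<in> N \<longleftrightarrow> comm b a \<in> N"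
  using comm_mem_iff[OF assms] comm_mem_iff[OF assms(1,3,2)] by auto

lemma subgroup_commuting_mod:
  assumes N: "N \<lhd> G" and A: "A \<subseteq> carrier G"
  shows "subgroup {u \<in> carrier G. \<forall>a\<in>A. comm u a \<in> N} G"
proof -
  interpret N: normal N G by (rule N)
  let ?Q = "G Mod N"
  interpret c: group_hom G ?Q "\<lambda>x. N #> x" by (rule rcos_hom[OF N])
  have iff: "comm u a \<in> N \<longleftrightarrow> (N #> a) \<otimes>\<^bsub>?Q\<^esub> (N #> u) = (N #> u) \<otimes>\<^bsub>?Q\<^esub> (N #> a)"
    if "u \<in> carrier G" "a \<in> A" for u a
    using comm_mem_iff[OF N that(1), of a] that(2) A by auto
  have cl: "N #> x \<in> carrier ?Q" if "x \<in> carrier G" for x by (rule c.hom_closed[OF that])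
  show ?thesis
  proof
    show "\<one> \<in> {u \<in> carrier G. \<forall>a\<in>A. comm u a \<in> N}" using A by auto
    fix u assume u: "u \<in> {u \<in> carrier G. \<forall>a\<in>A. comm u a \<in> N}"
    have "comm (inv u) a \<in> N" if a: "a \<in> A" for a
    proof -
      have uG: "u \<in> carrier G" "a \<in> carrier G" using u a A by auto
      show ?thesis
        using c.H.commutes_with_inv[OF cl[OF uG(2)] cl[OF uG(1)]] iff[OF uG(1) a]
          iff[OF inv_closed[OF uG(1)] a] c.hom_inv[OF uG(1)] u a by simp
    qed
    then show "inv u \<in> {u \<in> carrier G. \<forall>a\<in>A. comm u a \<in> N}" using u by simp
    fix v assume v: "v \<in> {u \<in> carrier G. \<forall>a\<in>A. comm u a \<in> N}"
    have "comm (u \<otimes> v) a \<in> N" if a: "a \<in> A" for a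
    proof -
      have G: "u \<in> carrier G" "v \<in> carrier G" "a \<in> carrier G" using u v a A by auto
      have "(N #> a) \<otimes>\<^bsub>?Q\<^esub> (N #> u) = (N #> u) \<otimes>\<^bsub>?Q\<^esub> (N #> a)"
        "(N #> a) \<otimes>\<^bsub>?Q\<^esub> (N #> v) = (N #> v) \<otimes>\<^bsub>?Q\<^esub> (N #> a)"
        using iff[OF G(1) a] iff[OF G(2) a] u v a by auto
      then have "(N #> a) \<otimes>\<^bsub>?Q\<^esub> (N #> (u \<otimes> v)) = (N #> (u \<otimes> v)) \<otimes>\<^bsub>?Q\<^esub> (N #> a)"
        unfolding c.hom_mult[OF G(1,2)] using G cl by (metis c.H.m_assoc)
      then show ?thesis using iff[of "u \<otimes> v" a] G a by simp
    qed
    then show "u \<otimes> v \<in> {u \<in> carrier G. \<forall>a\<in>A. comm u a \<in> N}" using u v by simp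
  qed auto
qed

lemma subquotient_mult:
  assumes "L \<lhd> G" "x \<in> carrier G" "y \<in> carrier G"
  shows "(L #> x) \<otimes>\<^bsub>(G\<lparr>carrier := A\<rparr>) Mod L\<^esub> (L #> y) = L #> (x \<otimes> y)"
  using assms by (simp add: normal.rcos_sum)

lemma finite_transversal:
  assumes "subgroup A G" "finite (rcosets A)"
  shows "\<exists>R. finite R \<and> R \<subseteq> carrier G \<and> (\<forall>x\<in>carrier G. \<exists>t\<in>R. x \<otimes> inv t \<in> A)"
proof -
  interpret A: subgroup A G by fact
  define t where "t C = (SOME x. x \<in> carrier G \<and> C = A #> x)" for C
  have t: "t (A #> x) \<in> carrier G \<and> A #> x = A #> t (A #> x)" if "x \<in> carrier G" for x
    unfolding t_def by (rule someI[of _ x]) (use that in simp)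
  show ?thesis
  proof (intro exI[of _ "t ` (rcosets A)"] conjI ballI)
    show "t ` (rcosets A) \<subseteq> carrier G" using t by (auto simp: RCOSETS_def)
    fix x assume x: "x \<in> carrier G"
    have "x \<in> A #> t (A #> x)" using t[OF x] rcos_self[OF x A.is_subgroup] by simp
    then obtain h where h: "h \<in> A" "x = h \<otimes> t (A #> x)" by (auto simp: r_coset_def)
    then have "x \<otimes> inv t (A #> x) = h" using t[OF x] x by (metis A.mem_carrier inv_solve_right')
    then show "\<exists>u\<in>t ` (rcosets A). x \<otimes> inv u \<in> A"
      using h x rcosetsI[OF A.subset x] by (intro bexI[of _ "t (A #> x)"]) auto
  qed (use assms in simp)
qed

lemma zp_module_subquotient:
  fixes p :: nat
  assumes "subgroup A G" "L \<lhd> G" "L \<subseteq> A"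
    and ab: "\<And>x y. x \<in> A \<Longrightarrow> y \<in> A \<Longrightarrow> comm x y \<in> L" and pw: "\<And>x. x \<in> A \<Longrightarrow> x [^] p \<in> L"
  shows "zp_module p ((G\<lparr>carrier := A\<rparr>) Mod L)"
proof -
  interpret A: subgroup A G by fact
  interpret AG: group "G\<lparr>carrier := A\<rparr>" by (rule A.subgroup_is_group[OF is_group])
  interpret L: normal L "G\<lparr>carrier := A\<rparr>" by (rule normal_restrict_supergroup) fact+
  have "comm_group ((G\<lparr>carrier := A\<rparr>) Mod L)"
  proof (rule group.group_comm_groupI[OF L.factorgroup_is_group])
    fix a b assume "a \<in> carrier ((G\<lparr>carrier := A\<rparr>) Mod L)" "b \<in> carrier ((G\<lparr>carrier := A\<rparr>) Mod L)"
    then obtain x y where "x \<in> A" "y \<in> A" "a = L #> x" "b = L #> y" by (auto simp: carrier_FactGroup)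
    then show "a \<otimes>\<^bsub>(G\<lparr>carrier := A\<rparr>) Mod L\<^esub> b = b \<otimes>\<^bsub>(G\<lparr>carrier := A\<rparr>) Mod L\<^esub> a"
      using comm_mem_iff[OF assms(2), of x y] ab[of x y] by simp
  qed
  moreover have "v [^]\<^bsub>(G\<lparr>carrier := A\<rparr>) Mod L\<^esub> p = \<one>\<^bsub>(G\<lparr>carrier := A\<rparr>) Mod L\<^esub>"
    if v: "v \<in> carrier ((G\<lparr>carrier := A\<rparr>) Mod L)" for v
  proof -
    obtain x where x: "x \<in> A" "v = L #> x" using v by (auto simp: carrier_FactGroup)
    have "v [^]\<^bsub>(G\<lparr>carrier := A\<rparr>) Mod L\<^esub> p = L #> (x [^] p)"
      using L.FactGroup_pow[of x p] x by (simp flip: nat_pow_consistent)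
    then show ?thesis using pw[OF x(1)] rcos_eq_one_iff[OF assms(2), of "x [^] p"] x(1) by simp
  qed
  ultimately show ?thesis by (simp add: zp_module_def)
qed

lemma ord_eq_prime_square_iff:
  assumes p: "Factorial_Ring.prime (p::nat)" and a: "a \<in> carrier G" "a [^] (p\<^sup>2) = \<one>"
  shows "ord a = p\<^sup>2 \<longleftrightarrow> a [^] p \<noteq> \<one>"
proof -
  have "ord a dvd p\<^sup>2" using pow_eq_id[OF a(1)] a(2) by simp
  then obtain i where i: "i \<le> 2" "ord a = p ^ i" using divides_primepow_nat[OF p] by blast
  have "a [^] p = \<one> \<longleftrightarrow> p ^ i dvd p" using pow_eq_id[OF a(1), of p] i(2) by simp
  also have "\<dots> \<longleftrightarrow> i \<le> 1"
    using power_dvd_imp_le[of p i 1] prime_gt_1_nat[OF p] le_imp_power_dvd[of i 1 p] by auto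
  finally show ?thesis
    using i prime_gt_1_nat[OF p] power_inject_exp[of p i 2] by auto
qed

end

lemma (in comm_group) finite_subgroup_containing:
  assumes "finite F" "F \<subseteq> carrier G" and n: "n > (0::nat)" and ex: "\<And>a. a \<in> F \<Longrightarrow> a [^] n = \<one>"
  shows "\<exists>A. subgroup A G \<and> finite A \<and> F \<subseteq> A"
  using assms(1,2) ex
proof (induction F)
  case empty
  then show ?case using triv_subgroup by blast
next
  case (insert a F)
  then obtain A where A: "subgroup A G" "finite A" "F \<subseteq> A" by auto
  interpret A: subgroup A G by (rule A(1))
  have a: "a \<in> carrier G" "a [^] n = \<one>" using insert.prems by auto
  let ?B = "generate G {a}"
  interpret B: subgroup ?B G by (rule generate_is_subgroup) (use a in simp)
  have "ord a \<noteq> 0" using a(2) n pow_eq_id[OF a(1), of n] by auto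
  then have "finite ?B" using generate_pow_card[OF a(1)] by (intro card_ge_0_finite) simp
  moreover have "A <#> ?B = (\<lambda>(x, y). x \<otimes> y) ` (A \<times> ?B)" by (auto simp: set_mult_def)
  ultimately have "finite (A <#> ?B)" using A(2) by simp
  moreover have "subgroup (A <#> ?B) G" by (rule mult_subgroups[OF A(1) B.subgroup_axioms])
  moreover have "x \<in> A <#> ?B" if "x \<in> F" for x
    using that A(3) B.one_closed insert.prems(1) unfolding set_mult_def by (force intro: bexI[of _ x])
  moreover have "a \<in> A <#> ?B"
    using A.one_closed a(1) generate.incl[of a "{a}" G] unfolding set_mult_def by (force intro: bexI[of _ \<one>])
  ultimately show ?case by blast
qed

section \<open>Closed verbal subgroups\<close>

text \<open>
  For \<open>K = ker\<^sub>k\<close> and \<open>Ks = ker\<^sub>k\<^sup>*\<close> the arguments \<open>(K, K, K)\<close> give \<open>ker\<^sub>k\<^sub>+\<^sub>1\<close>, \<open>(K, Ks, Ks)\<close> give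
  \<open>ker'\<^sub>k\<^sub>+\<^sub>1\<close>, and \<open>(K, K, Ks)\<close> give the variant that kills all commutators of \<open>K\<close>.
\<close>

definition closed_verbal :: "nat \<Rightarrow> ('a, 'm) monoid_scheme \<Rightarrow> 'a topology \<Rightarrow> 'a set \<Rightarrow> 'a set \<Rightarrow> 'a set \<Rightarrow> 'a set" where
  "closed_verbal n P T A B C = T closure_of (comm_subgroup P A B <#>\<^bsub>P\<^esub> pow_subgroup n P C)"

context topgroup
begin

lemma
  assumes "A \<lhd> G" "B \<lhd> G" "C \<lhd> G"
  shows closed_verbal_normal: "closed_verbal n G T A B C \<lhd> G"
    and closed_verbal_closed: "closedin T (closed_verbal n G T A B C)"
    and closed_verbal_comm: "\<And>a b. a \<in> A \<Longrightarrow> b \<in> B \<Longrightarrow> comm a b \<in> closed_verbal n G T A B C"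
    and closed_verbal_pow: "\<And>c. c \<in> C \<Longrightarrow> c [^] n \<in> closed_verbal n G T A B C"
proof -
  let ?M = "comm_subgroup G A B" and ?N = "pow_subgroup n G C"
  interpret M: normal ?M G using normal_comm_subgroup assms by simp
  interpret N: normal ?N G using normal_pow_subgroup assms by simp
  have MN: "?M <#> ?N \<lhd> G" by (rule normal_subgroup_set_mult_closed) unfold_locales
  then show "closed_verbal n G T A B C \<lhd> G" unfolding closed_verbal_def by (rule closure_normal)
  show "closedin T (closed_verbal n G T A B C)" unfolding closed_verbal_def by simp
  have sub: "?M <#> ?N \<subseteq> closed_verbal n G T A B C"
    unfolding closed_verbal_def
    using closure_of_subset[of "?M <#> ?N" T] subgroup.subset[OF normal_imp_subgroup[OF MN]] topspace by simp
  have M: "m \<in> ?M <#> ?N" if "m \<in> ?M" for m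
    using that N.one_closed M.subset unfolding set_mult_def by (force intro: bexI[of _ m])
  have N: "m \<in> ?M <#> ?N" if "m \<in> ?N" for m
    using that M.one_closed N.subset unfolding set_mult_def by (force intro: bexI[of _ \<one>])
  show "comm a b \<in> closed_verbal n G T A B C" if "a \<in> A" "b \<in> B" for a b
    using sub M comm_subgroup_mem[OF that] by auto
  show "c [^] n \<in> closed_verbal n G T A B C" if "c \<in> C" for c
    using sub N pow_subgroup_mem[OF that] by auto
qed

lemma closed_verbal_least:
  assumes N: "subgroup N G" "closedin T N"
    and gen: "\<And>a b. a \<in> A \<Longrightarrow> b \<in> B \<Longrightarrow> comm a b \<in> N" "\<And>c. c \<in> C \<Longrightarrow> c [^] n \<in> N"
  shows "closed_verbal n G T A B C \<subseteq> N"
  unfolding closed_verbal_def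
proof (rule closure_of_minimal[OF _ N(2)])
  have "comm_subgroup G A B \<subseteq> N" "pow_subgroup n G C \<subseteq> N"
    using comm_subgroup_least[OF N(1)] pow_subgroup_least[OF N(1)] gen by simp_all
  then show "comm_subgroup G A B <#> pow_subgroup n G C \<subseteq> N"
    using subgroup.m_closed[OF N(1)] unfolding set_mult_def by auto
qed

lemma closed_verbal_mono:
  assumes "A' \<lhd> G" "B' \<lhd> G" "C' \<lhd> G" "A \<subseteq> A'" "B \<subseteq> B'" "C \<subseteq> C'"
  shows "closed_verbal n G T A B C \<subseteq> closed_verbal n G T A' B' C'"
  using assms(4-6) closed_verbal_comm[OF assms(1-3), of _ _ n] closed_verbal_pow[OF assms(1-3), of _ n]
  by (intro closed_verbal_least normal_imp_subgroup[OF closed_verbal_normal[OF assms(1-3)]]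
      closed_verbal_closed[OF assms(1-3)]) (simp_all add: subset_iff)

end

context universal_cover
begin

text \<open>
  Otherwise a character \<open>l\<close> of \<open>K\<close> modulo \<open>Ks\<close> has \<open>l x = 1\<close>.  A lift \<open>L\<close> of \<open>l\<close> modulo \<open>p\<^sup>2\<close> takes multiples of \<open>p\<close>
  on \<open>Ks\<close>, so it kills the \<open>p\<close>th powers of \<open>Ks\<close> along with the commutators of \<open>K\<close>, but \<open>L (x [^] p) = p L x\<close> is
  nonzero.
\<close>

theorem pth_power_in_verbal:
  assumes K: "K \<lhd> P" "openin T K" and Ks: "Ks \<lhd> P" "openin T Ks" "Ks \<subseteq> K"
    and ab: "\<And>x y. x \<in> K \<Longrightarrow> y \<in> K \<Longrightarrow> comm x y \<in> Ks" and pw: "\<And>x. x \<in> K \<Longrightarrow> x [^] p \<in> Ks"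
    and x: "x \<in> K" "x [^] p \<in> closed_verbal p P T K K Ks"
  shows "x \<in> Ks"
proof (rule ccontr)
  assume xs: "x \<notin> Ks"
  interpret K: normal K P by (rule K(1))
  interpret Ks: normal Ks P by (rule Ks(1))
  let ?K = "P\<lparr>carrier := K\<rparr>"
  let ?V = "?K Mod Ks"
  interpret KG: group ?K by (rule K.subgroup_is_group[OF is_group])
  have n: "Ks \<lhd> ?K" by (rule normal_restrict_supergroup[OF K.is_subgroup Ks(1,3)])
  interpret c: group_hom ?K ?V "\<lambda>x. Ks #> x" using KG.rcos_hom[OF n] by simp
  have c_one: "Ks #> x = Ks \<longleftrightarrow> x \<in> Ks" if "x \<in> K" for x
    using rcos_eq_one_iff[OF Ks(1)] that by simp
  have zp: "zp_module p ?V" by (rule zp_module_subquotient[OF K.is_subgroup Ks(1,3) ab pw])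
  then interpret V: comm_group ?V by (simp add: zp_module_def)
  have "finite (carrier ?V)"
    using finite_index_if_open[OF compact Ks.is_subgroup Ks(2)] K.subset
    by (auto simp: carrier_FactGroup RCOSETS_def intro: rev_finite_subset)
  moreover have "v [^]\<^bsub>?V\<^esub> p = \<one>\<^bsub>?V\<^esub>" if "v \<in> carrier ?V" for v
    using zp that by (simp add: zp_module_def)
  moreover have "Ks #> x \<in> carrier ?V" "Ks #> x \<noteq> \<one>\<^bsub>?V\<^esub>" using x(1) xs c_one c.hom_closed by auto
  ultimately obtain m where m: "m \<in> hom ?V (integer_mod_group p)" "m (Ks #> x) = 1"
    using V.separating_character[OF _ prime_p] by blast
  define l where "l y = m (Ks #> y)" for y
  have l: "l \<in> hom ?K (integer_mod_group p)"
    using Group.hom_compose[OF c.homh m(1)] by (simp add: l_def[abs_def] o_def)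
  interpret l: group_hom ?K "integer_mod_group p" l
    using l KG.is_group by (simp add: group_hom_iff)
  interpret m: group_hom ?V "integer_mod_group p" m
    using m(1) by (simp add: group_hom_iff c.H.is_group)
  have l_Ks: "l s = 0" if "s \<in> Ks" for s
    using m.hom_one that c_one[of s] Ks(3) by (auto simp: l_def)
  have "subgroup {y \<in> K. l y = 0} P"
    using incl_subgroup[OF K.is_subgroup l.subgroup_kernel] by (simp add: kernel_def)
  then have "openin T {y \<in> K. l y = 0}"
    by (rule closed_if_contains_open(1)[OF _ Ks(2)]) (use l_Ks Ks(3) in auto)
  then obtain L where L: "L \<in> hom ?K (integer_mod_group (p\<^sup>2))" "openin T {y \<in> K. L y = 0}"
     and Ll: "\<And>y. y \<in> K \<Longrightarrow> L y mod int p = l y"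
    using character_lifts_mod_p_squared[OF K l] by blast
  interpret L: group_hom ?K "integer_mod_group (p\<^sup>2)" L
    using L(1) KG.is_group by (simp add: group_hom_iff)
  have L_pow: "L (y [^] p) = (int p * L y) mod int (p\<^sup>2)" if y: "y \<in> K" for y
    using L.hom_nat_pow[of y p] L.hom_closed[of y] y by (simp flip: nat_pow_consistent)
  have sub: "subgroup {y \<in> K. L y = 0} P"
    using incl_subgroup[OF K.is_subgroup L.subgroup_kernel] by (simp add: kernel_def)
  have "closed_verbal p P T K K Ks \<subseteq> {y \<in> K. L y = 0}"
  proof (rule closed_verbal_least[OF sub])
    show "closedin T {y \<in> K. L y = 0}"
      by (rule closed_if_contains_open(2)[OF sub L(2)]) (use subgroup.one_closed[OF sub] in auto)
    fix a b assume ab: "a \<in> K" "b \<in> K"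
    then have "L (comm a b) = L.H.comm (L a) (L b)"
      using L.hom_mult L.hom_inv m_inv_consistent[OF K.is_subgroup] by simp
    also have "\<dots> = \<one>\<^bsub>integer_mod_group (p\<^sup>2)\<^esub>"
      by (rule iffD2[OF L.H.comm_eq_one_iff]) (use ab L.hom_closed in \<open>simp_all add: add.commute\<close>)
    finally show "comm a b \<in> {y \<in> K. L y = 0}" using ab by simp
  next
    fix s assume s: "s \<in> Ks"
    then have sK: "s \<in> K" using Ks(3) by blast
    have "int p dvd L s" using Ll[OF sK] l_Ks[OF s] by (simp add: dvd_eq_mod_eq_0)
    then have "L (s [^] p) = 0" unfolding L_pow[OF sK] by (auto simp: power2_eq_square dvd_def)
    moreover have "s [^] p \<in> K" using sK KG.nat_pow_closed[of s p] by (simp flip: nat_pow_consistent)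
    ultimately show "s [^] p \<in> {y \<in> K. L y = 0}" by simp
  qed
  then have "L (x [^] p) = 0" using x(2) by blast
  then have "int p * int p dvd int p * L x" using L_pow[OF x(1)] by (simp add: dvd_eq_mod_eq_0 power2_eq_square)
  then have "int p dvd L x" using prime_p by (simp add: prime_gt_0_nat)
  then have "l x = 0" using Ll[OF x(1)] by (simp add: dvd_eq_mod_eq_0)
  then show False using m(2) by (simp add: l_def)
qed

end

section \<open>The universal exponent \<open>p\<close> central extension\<close>

context universal_cover
begin

lemma star_normal: "is_ker_star p P T K Ks \<Longrightarrow> Ks \<lhd> P"
  and star_subset: "is_ker_star p P T K Ks \<Longrightarrow> Ks \<subseteq> K"
  and star_closed: "is_ker_star p P T K Ks \<Longrightarrow> closedin T Ks"
  by (simp_all add: is_ker_star_def)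

lemma star_ext:
  "is_ker_star p P T K Ks \<Longrightarrow> exp_p_central_ext p (P Mod Ks) (P Mod K) (quot_map P K)"
  by (simp add: is_ker_star_def universal_exp_p_central_ext_def)

lemma star_open:
  assumes "is_ker_star p P T K Ks"
  shows "openin T Ks"
proof (rule open_if_closed_finite_index)
  show "subgroup Ks P" using star_normal[OF assms] by (rule normal_imp_subgroup)
  show "closedin T Ks" by (rule star_closed[OF assms])
  show "finite (rcosets Ks)"
    using star_ext[OF assms] by (simp add: exp_p_central_ext_def FactGroup_def)
qed

lemma star_comm:
  assumes K: "K \<lhd> P" and star: "is_ker_star p P T K Ks" and x: "x \<in> K" and g: "g \<in> carrier P"
  shows "comm x g \<in> Ks" "comm g x \<in> Ks"
proof -
  note Ks = star_normal[OF star]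
  have xG: "x \<in> carrier P" using K x by (metis normal_imp_subgroup subgroup.mem_carrier)
  have "Ks #> x \<in> kernel (P Mod Ks) (P Mod K) (quot_map P K)"
    using kernel_quot_map[OF Ks K star_subset[OF star]] x by simp
  then have "Ks #> x \<in> group_center (P Mod Ks)"
    using star_ext[OF star] by (auto simp: exp_p_central_ext_def)
  then have "(Ks #> x) \<otimes>\<^bsub>P Mod Ks\<^esub> (Ks #> g) = (Ks #> g) \<otimes>\<^bsub>P Mod Ks\<^esub> (Ks #> x)"
    using g by (auto simp: group_center_def carrier_FactGroup)
  then show "comm x g \<in> Ks" "comm g x \<in> Ks"
    using comm_mem_iff[OF Ks xG g] comm_mem_iff[OF Ks g xG] by simp_all
qed

lemma star_pow:
  assumes K: "K \<lhd> P" and star: "is_ker_star p P T K Ks" and x: "x \<in> K"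
  shows "x [^] p \<in> Ks"
proof -
  note Ks = star_normal[OF star]
  have xG: "x \<in> carrier P" using K x by (metis normal_imp_subgroup subgroup.mem_carrier)
  have "Ks #> x \<in> kernel (P Mod Ks) (P Mod K) (quot_map P K)"
    using kernel_quot_map[OF Ks K star_subset[OF star]] x by simp
  then have "(Ks #> x) [^]\<^bsub>P Mod Ks\<^esub> p = Ks"
    using star_ext[OF star] by (simp add: exp_p_central_ext_def)
  then show ?thesis
    using normal.FactGroup_pow[OF Ks xG] rcos_eq_one_iff[OF Ks, of "x [^] p"] xG by simp
qed

end

locale perfect_cover = universal_cover +
  assumes perfect: "p_perfect p G"
begin

text \<open>
  The image of \<open>M\<close> in \<open>G\<close> is all of \<open>G\<close>, since otherwise a character of the quotient would make \<open>\<int>/p\<close> a quotient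
  of \<open>G\<close>.  As \<open>P \<rightarrow> G\<close> is Frattini, \<open>M\<close> is all of \<open>P\<close>.
\<close>

lemma normal_eq_carrier_if_elementary_abelian_quotient:
  assumes M: "M \<lhd> P" "openin T M"
    and pw: "\<And>x. x \<in> carrier P \<Longrightarrow> x [^] p \<in> M"
    and ab: "\<And>x y. x \<in> carrier P \<Longrightarrow> y \<in> carrier P \<Longrightarrow> comm x y \<in> M"
  shows "M = carrier P"
proof (rule frattini)
  interpret M: normal M P by (rule M(1))
  show "subgroup M P" by (rule M.is_subgroup)
  show "closedin T M"
    by (rule closed_if_contains_open(2)[OF M.is_subgroup M(2)]) simp_all
  let ?N = "\<phi> ` M"
  show "?N = carrier G"
  proof (rule ccontr)
    assume ne: "?N \<noteq> carrier G"
    have N: "?N \<lhd> G" by (rule phi.image_normal[OF M(1) epi_image[OF phi_epi]])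
    interpret N: normal ?N G by (rule N)
    let ?V = "G Mod ?N"
    interpret c: group_hom G ?V "\<lambda>x. ?N #>\<^bsub>G\<^esub> x" by (rule G.rcos_hom[OF N])
    obtain g where g: "g \<in> carrier G" "g \<notin> ?N" using ne N.subset by blast
    have lift: "\<exists>x\<in>carrier P. \<phi> x = a" if "a \<in> carrier G" for a
      using that epi_image[OF phi_epi] by (metis imageE)
    have "zp_module p (G\<lparr>carrier := carrier G\<rparr> Mod ?N)"
    proof (rule G.zp_module_subquotient[OF G.subgroup_self N N.subset])
      fix u v assume uv: "u \<in> carrier G" "v \<in> carrier G"
      obtain x y where xy: "x \<in> carrier P" "y \<in> carrier P" "\<phi> x = u" "\<phi> y = v"
        using lift uv by metis
      have "\<phi> (comm x y) \<in> ?N" using ab xy by blast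
      then show "G.comm u v \<in> ?N" using xy by simp
      have "\<phi> (x [^] p) \<in> ?N" using pw xy by blast
      then show "u [^]\<^bsub>G\<^esub> p \<in> ?N" using xy phi.hom_nat_pow by simp
    qed
    then have zp: "zp_module p ?V" by simp
    then interpret V: comm_group ?V by (simp add: zp_module_def)
    have finV: "finite (carrier ?V)" using finite_G by (simp add: carrier_FactGroup)
    have expV: "w [^]\<^bsub>?V\<^esub> p = \<one>\<^bsub>?V\<^esub>" if "w \<in> carrier ?V" for w
      using zp that by (simp add: zp_module_def)
    have "?N #>\<^bsub>G\<^esub> g \<in> carrier ?V" "?N #>\<^bsub>G\<^esub> g \<noteq> \<one>\<^bsub>?V\<^esub>"
      using g G.rcos_eq_one_iff[OF N g(1)] c.hom_closed by auto
    from V.separating_character[OF finV prime_p expV this]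
    obtain m where m: "m \<in> hom ?V (integer_mod_group p)" "m (?N #>\<^bsub>G\<^esub> g) = 1" by blast
    define l where "l = m \<circ> (\<lambda>x. ?N #>\<^bsub>G\<^esub> x)"
    have l: "l \<in> hom G (integer_mod_group p)"
      unfolding l_def by (rule Group.hom_compose[OF c.homh m(1)])
    interpret l: group_hom G "integer_mod_group p" l
      using l by (simp add: group_hom_iff G.is_group)
    have "l ` carrier G = carrier (integer_mod_group p)"
    proof
      show "carrier (integer_mod_group p) \<subseteq> l ` carrier G"
      proof
        fix i assume i: "i \<in> carrier (integer_mod_group p)"
        then have ib: "0 \<le> i" "i < int p"
          using prime_gt_0_nat[OF prime_p] by (simp_all add: carrier_integer_mod_group)
        have "l (g [^]\<^bsub>G\<^esub> nat i) = (int (nat i) * 1) mod int p"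
          using l.hom_nat_pow[OF g(1), of "nat i"] m(2) l.hom_closed[OF g(1)] by (simp add: l_def)
        then have "i = l (g [^]\<^bsub>G\<^esub> nat i)" using ib by simp
        then show "i \<in> l ` carrier G" by (rule image_eqI) (simp add: g(1))
      qed
    qed (use l.hom_closed in blast)
    then have "G Mod (kernel G (integer_mod_group p) l) \<cong> integer_mod_group p"
      by (rule l.FactGroup_iso)
    then show False using perfect l.normal_kernel unfolding p_perfect_def by blast
  qed
qed

text \<open>
  The universal property gives a homomorphism \<open>\<gamma>\<close> from \<open>P\<close> to \<open>P/S\<close> over \<open>P/K\<close> that kills \<open>Ks\<close>.  It differs from
  the projection by a homomorphism \<open>d\<close> to the central elementary abelian subgroup \<open>K/S\<close>.  The kernel of \<open>d\<close> is
  all of \<open>P\<close> by the previous lemma, so the projection kills \<open>Ks\<close> as well.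
\<close>

theorem star_least:
  assumes K: "K \<lhd> P" and star: "is_ker_star p P T K Ks"
    and S: "S \<lhd> P" "openin T S" "S \<subseteq> K"
    and cent: "\<And>x g. x \<in> K \<Longrightarrow> g \<in> carrier P \<Longrightarrow> comm x g \<in> S"
    and pw: "\<And>x. x \<in> K \<Longrightarrow> x [^] p \<in> S"
  shows "Ks \<subseteq> S"
proof -
  interpret K: normal K P by (rule K)
  interpret S: normal S P by (rule S(1))
  let ?R = "P Mod Ks" and ?Q = "P Mod K" and ?U = "P Mod S"
  note Ks = star_normal[OF star]
  interpret Ks: normal Ks P by (rule Ks)
  interpret r: group_hom P ?R "\<lambda>x. Ks #> x" by (rule rcos_hom[OF Ks])
  interpret s: group_hom P ?U "\<lambda>x. S #> x" by (rule rcos_hom[OF S(1)])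
  have finU: "finite (carrier ?U)"
    using finite_index_if_open[OF compact S.is_subgroup S(2)] by (simp add: FactGroup_def)
  obtain E :: "nat monoid" and h where E: "group E" and h: "h \<in> iso ?U E"
    using finite_group_nat_copy[OF s.H.is_group finU] by (elim exE conjE) (rule that)
  interpret E: group E by (rule E)
  define g where "g = inv_into (carrier ?U) h"
  have g: "g \<in> iso E ?U" using s.H.iso_set_sym[OF h] by (simp add: g_def)
  have gi: "inj_on g (carrier E)" and gE: "g ` carrier E = carrier ?U" using g by (simp_all add: iso_iff)
  interpret g: group_hom E ?U g
    using iso_imp_homomorphism[OF g] E s.H.is_group by (simp add: group_hom_iff)
  let ?\<pi> = "quot_map P K \<circ> g"
  have kerE: "\<exists>x\<in>K. g z = S #> x" if "z \<in> kernel E ?Q ?\<pi>" for z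
  proof -
    have "g z \<in> kernel ?U ?Q (quot_map P K)" using that g.hom_closed by (simp add: kernel_def)
    then show ?thesis using kernel_quot_map[OF S(1) K S(3)] by auto
  qed
  have central: "(S #> x) \<otimes>\<^bsub>?U\<^esub> w = w \<otimes>\<^bsub>?U\<^esub> (S #> x)" if x: "x \<in> K" and w: "w \<in> carrier ?U" for x w
  proof -
    obtain a where a: "a \<in> carrier P" "w = S #> a" using w by (auto simp: carrier_FactGroup)
    show ?thesis using comm_mem_iff[OF S(1), of x a] cent[OF x a(1)] x a by simp
  qed
  have expo: "(S #> x) [^]\<^bsub>?U\<^esub> p = \<one>\<^bsub>?U\<^esub>" if x: "x \<in> K" for x
    using S.FactGroup_pow[of x p] pw[OF x] rcos_eq_one_iff[OF S(1), of "x [^] p"] x by simp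
  have "exp_p_central_ext p E ?Q ?\<pi>"
    unfolding exp_p_central_ext_def
  proof (intro conjI ballI subsetI E)
    show "finite (carrier E)" using finU gE gi by (metis finite_imageD)
    show "group ?Q" by (rule K.factorgroup_is_group)
    have "g \<in> epi E ?U" using g gE iso_imp_homomorphism by (auto simp: epi_def)
    then show "?\<pi> \<in> epi E ?Q" by (rule epi_compose[OF _ quot_map_epi[OF S(1) K S(3)]])
    fix z assume z: "z \<in> kernel E ?Q ?\<pi>"
    then have zE: "z \<in> carrier E" by (simp add: kernel_def)
    obtain x where x: "x \<in> K" "g z = S #> x" using kerE[OF z] by auto
    show "z [^]\<^bsub>E\<^esub> p = \<one>\<^bsub>E\<^esub>"
      using g.hom_nat_pow[OF zE, of p] expo[OF x(1)] x zE by (intro inj_onD[OF gi]) simp_all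
    show "z \<in> group_center E"
      unfolding group_center_def
    proof (intro CollectI conjI ballI zE)
      fix w assume w: "w \<in> carrier E"
      show "z \<otimes>\<^bsub>E\<^esub> w = w \<otimes>\<^bsub>E\<^esub> z"
        using central[OF x(1) g.hom_closed[OF w]] x(2) zE w
        by (intro inj_onD[OF gi]) (simp_all del: mult_FactGroup)
    qed
  qed
  then have "\<exists>!\<theta>. \<theta> \<in> hom ?R E \<and> \<theta> \<in> extensional (carrier ?R) \<and> (\<forall>x\<in>carrier ?R. ?\<pi> (\<theta> x) = quot_map P K x)"
    using star by (simp only: is_ker_star_def universal_exp_p_central_ext_def)
  then obtain \<theta> where \<theta>: "\<theta> \<in> hom ?R E" "\<And>x. x \<in> carrier ?R \<Longrightarrow> ?\<pi> (\<theta> x) = quot_map P K x"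
    by (elim ex1E conjE) (rule that, assumption, rule bspec)
  define \<gamma> where "\<gamma> = g \<circ> \<theta> \<circ> (\<lambda>x. Ks #> x)"
  have \<gamma>_hom: "\<gamma> \<in> hom P ?U"
    unfolding \<gamma>_def by (rule Group.hom_compose[OF r.homh Group.hom_compose[OF \<theta>(1) g.homh]])
  interpret \<gamma>: group_hom P ?U \<gamma>
    using \<gamma>_hom by (simp add: group_hom_iff is_group s.H.is_group)
  define d where "d x = \<gamma> x \<otimes>\<^bsub>?U\<^esub> inv\<^bsub>?U\<^esub> (S #> x)" for x
  have d_ker: "\<exists>z\<in>K. d x = S #> z" if x: "x \<in> carrier P" for x
  proof -
    have "quot_map P K (\<gamma> x) = quot_map P K (S #> x)"
      using \<theta>(2)[OF r.hom_closed[OF x]] quot_map_rcos[OF Ks K star_subset[OF star] x]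
        quot_map_rcos[OF S(1) K S(3) x] by (simp add: \<gamma>_def)
    moreover obtain a where a: "a \<in> carrier P" "\<gamma> x = S #> a"
      using \<gamma>.hom_closed[OF x] by (auto simp: carrier_FactGroup)
    ultimately have "a \<otimes> inv x \<in> K"
      using quot_map_rcos[OF S(1) K S(3)] x rcos_eq_iff[OF K] by simp
    moreover have "d x = S #> (a \<otimes> inv x)"
      unfolding d_def a(2) using a x by (simp add: s.hom_mult s.hom_inv del: mult_FactGroup)
    ultimately show ?thesis by blast
  qed
  have dU: "d x \<in> carrier ?U" if "x \<in> carrier P" for x
    using that s.hom_closed \<gamma>.hom_closed unfolding d_def by (intro s.H.m_closed s.H.inv_closed)
  have d_central: "d x \<otimes>\<^bsub>?U\<^esub> w = w \<otimes>\<^bsub>?U\<^esub> d x" if "x \<in> carrier P" "w \<in> carrier ?U" for x w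
    using d_ker[OF that(1)] central that(2) by metis
  have "d \<in> hom P ?U"
  proof (rule homI)
    fix x y assume x: "x \<in> carrier P" and y: "y \<in> carrier P"
    have "d (x \<otimes> y) = \<gamma> x \<otimes>\<^bsub>?U\<^esub> d y \<otimes>\<^bsub>?U\<^esub> inv\<^bsub>?U\<^esub> (S #> x)"
      using x y \<gamma>.hom_closed s.hom_closed
      by (simp add: d_def \<gamma>.hom_mult s.hom_mult s.H.inv_mult_group s.H.m_assoc del: mult_FactGroup)
    also have "\<dots> = d x \<otimes>\<^bsub>?U\<^esub> d y"
      unfolding d_central[OF y \<gamma>.hom_closed[OF x], symmetric]
      using d_central[OF y dU[OF x]] x y dU[OF y] \<gamma>.hom_closed s.hom_closed
      by (simp add: d_def[of x] s.H.m_assoc del: mult_FactGroup)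
    finally show "d (x \<otimes> y) = d x \<otimes>\<^bsub>?U\<^esub> d y" .
  qed (rule dU)
  then interpret d: group_hom P ?U d
    by (simp add: group_hom_iff is_group s.H.is_group)
  let ?M = "kernel P ?U d"
  have "?M = carrier P"
  proof (rule normal_eq_carrier_if_elementary_abelian_quotient)
    show "?M \<lhd> P" by (rule d.normal_kernel)
    have sub: "Ks \<inter> S \<subseteq> ?M"
    proof
      fix x assume x: "x \<in> Ks \<inter> S"
      then have xP: "x \<in> carrier P" by simp
      have "Ks #> x = \<one>\<^bsub>?R\<^esub>" "S #> x = \<one>\<^bsub>?U\<^esub>"
        using x rcos_eq_one_iff[OF Ks xP] rcos_eq_one_iff[OF S(1) xP] by simp_all
      then have "d x = \<one>\<^bsub>?U\<^esub>"
        using hom_one[OF Group.hom_compose[OF \<theta>(1) g.homh] r.H.is_group s.H.is_group]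
        by (simp add: d_def \<gamma>_def del: one_FactGroup mult_FactGroup)
      then show "x \<in> ?M" using xP by (simp add: kernel_def)
    qed
    show "openin T ?M"
      using star_open[OF star] S(2) Ks.one_closed S.one_closed
      by (intro closed_if_contains_open(1)[OF d.subgroup_kernel _ sub]) (simp_all add: openin_Int)
    fix x assume x: "x \<in> carrier P"
    obtain z where "z \<in> K" "d x = S #> z" using d_ker[OF x] by auto
    then have "d (x [^] p) = \<one>\<^bsub>?U\<^esub>" using d.hom_nat_pow[OF x] expo by simp
    then show "x [^] p \<in> ?M" using x by (simp add: kernel_def)
    fix y assume y: "y \<in> carrier P"
    have "d (comm x y) = s.H.comm (d x) (d y)"
      using x y by (simp add: d.hom_mult d.hom_inv del: mult_FactGroup)
    also have "\<dots> = \<one>\<^bsub>?U\<^esub>"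
      using s.H.comm_eq_one_iff[OF dU[OF x] dU[OF y]] d_central[OF x dU[OF y]] by simp
    finally show "comm x y \<in> ?M" using x y by (simp add: kernel_def)
  qed
  then have \<gamma>_eq: "\<gamma> x = S #> x" if x: "x \<in> carrier P" for x
  proof -
    have "d x = \<one>\<^bsub>?U\<^esub>" using \<open>?M = carrier P\<close> x by (auto simp: kernel_def)
    then have "\<gamma> x = \<one>\<^bsub>?U\<^esub> \<otimes>\<^bsub>?U\<^esub> (S #> x)"
      unfolding d_def using s.H.inv_solve_right'[OF s.H.one_closed \<gamma>.hom_closed[OF x] s.hom_closed[OF x]] by simp
    then show ?thesis using s.H.l_one[OF s.hom_closed[OF x]] by simp
  qed
  show "Ks \<subseteq> S"
  proof
    fix x assume x: "x \<in> Ks"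
    then have xP: "x \<in> carrier P" by simp
    have "Ks #> x = \<one>\<^bsub>?R\<^esub>" using x rcos_eq_one_iff[OF Ks xP] by simp
    then have "\<gamma> x = \<one>\<^bsub>?U\<^esub>"
      using hom_one[OF Group.hom_compose[OF \<theta>(1) g.homh] r.H.is_group s.H.is_group]
      by (simp add: \<gamma>_def del: one_FactGroup mult_FactGroup)
    then show "x \<in> S" using \<gamma>_eq[OF xP] rcos_eq_one_iff[OF S(1) xP] by simp
  qed
qed

end

section \<open>Squaring as a quadratic form\<close>

context group
begin

lemma inv_of_comm: "\<lbrakk>a \<in> carrier G; b \<in> carrier G\<rbrakk> \<Longrightarrow> inv (comm a b) = comm b a"
  by (simp add: inv_mult_group m_assoc)

lemma comm_mult_left_central:
  assumes "x \<in> carrier G" "x' \<in> carrier G" "y \<in> carrier G"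
    and central: "\<And>g. g \<in> carrier G \<Longrightarrow> comm x' y \<otimes> g = g \<otimes> comm x' y"
  shows "comm (x \<otimes> x') y = comm x y \<otimes> comm x' y"
proof -
  have c: "inv y \<otimes> (y \<otimes> z) = z" if "z \<in> carrier G" for z using assms that by (simp flip: m_assoc)
  have "comm (x \<otimes> x') y = x \<otimes> comm x' y \<otimes> (y \<otimes> inv x \<otimes> inv y)"
    using assms(1-3) by (simp add: inv_mult_group m_assoc c)
  also have "x \<otimes> comm x' y = comm x' y \<otimes> x" using central assms(1) by simp
  also have "comm x' y \<otimes> x \<otimes> (y \<otimes> inv x \<otimes> inv y) = comm x' y \<otimes> comm x y"
    using assms(1-3) by (simp add: m_assoc)
  also have "\<dots> = comm x y \<otimes> comm x' y" using central assms(1-3) by simp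
  finally show ?thesis .
qed

text \<open>
  In additive language, \<open>q x = x \<otimes> x\<close> is a quadratic form on \<open>C\<close>, its polar form \<open>B x y = comm x y\<close> takes values
  of order at most \<open>2\<close>, and both are invariant under conjugation.  By \<open>diff\<close>, \<open>q\<close> vanishes at \<open>g x - x\<close>, so
  expanding \<open>q (x + (g x - x)) = q x\<close> gives \<open>B (g x) x = 0\<close>.  Polarizing, \<open>B (g x) y = B x (g y)\<close>, which is
  \<open>B (inv g x) y\<close> by invariance.  With \<open>g x\<close> in place of \<open>x\<close> this is \<open>B (g g x) y = B x y\<close>.
\<close>

lemma comm_conj_square:
  assumes C: "C \<lhd> G"
    and central: "\<And>x y g. \<lbrakk>x \<in> C; y \<in> C; g \<in> carrier G\<rbrakk> \<Longrightarrow> comm x y \<otimes> g = g \<otimes> comm x y"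
    and comm2: "\<And>x y. \<lbrakk>x \<in> C; y \<in> C\<rbrakk> \<Longrightarrow> comm x y \<otimes> comm x y = \<one>"
    and sq: "\<And>x g. \<lbrakk>x \<in> C; g \<in> carrier G\<rbrakk> \<Longrightarrow> g \<otimes> (x \<otimes> x) \<otimes> inv g = x \<otimes> x"
    and diff: "\<And>x g. \<lbrakk>x \<in> C; g \<in> carrier G\<rbrakk>
       \<Longrightarrow> (inv x \<otimes> (g \<otimes> x \<otimes> inv g)) \<otimes> (inv x \<otimes> (g \<otimes> x \<otimes> inv g)) = \<one>"
    and x: "x \<in> C" and y: "y \<in> C" and g: "g \<in> carrier G"
  shows "comm ((g \<otimes> g) \<otimes> x \<otimes> inv (g \<otimes> g)) y = comm x y"
proof -
  interpret C: normal C G by (rule C)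
  define cj where "cj g x = g \<otimes> x \<otimes> inv g" for g x
  have cjC: "cj g x \<in> C" if "x \<in> C" "g \<in> carrier G" for x g
    using that C.inv_op_closed2 by (simp add: cj_def)
  have cj_mult: "cj g (x \<otimes> y) = cj g x \<otimes> cj g y" if "x \<in> C" "y \<in> C" "g \<in> carrier G" for x y g
  proof -
    have "inv g \<otimes> (g \<otimes> z) = z" if "z \<in> carrier G" for z using that \<open>g \<in> carrier G\<close> by (simp flip: m_assoc)
    then show ?thesis using that by (simp add: cj_def m_assoc)
  qed
  have cj_cj: "cj g (cj h x) = cj (g \<otimes> h) x" if "x \<in> C" "g \<in> carrier G" "h \<in> carrier G" for x g h
    using that by (simp add: cj_def inv_mult_group m_assoc)
  have cj_one: "cj \<one> x = x" if "x \<in> C" for x using that by (simp add: cj_def)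
  have left: "comm (x \<otimes> x') y = comm x y \<otimes> comm x' y" if "x \<in> C" "x' \<in> C" "y \<in> C" for x x' y
    using that central by (intro comm_mult_left_central) auto
  have sym: "comm y x = comm x y" if "x \<in> C" "y \<in> C" for x y
    using that comm2[of x y] inv_of_comm[of x y] inv_equality[of "comm x y" "comm x y"] by simp
  have inv: "comm (cj g x) (cj g y) = comm x y" if "x \<in> C" "y \<in> C" "g \<in> carrier G" for x y g
  proof -
    have "comm (cj g x) (cj g y) = g \<otimes> comm x y \<otimes> inv g" using that conj_comm by (simp add: cj_def)
    also have "\<dots> = comm x y \<otimes> g \<otimes> inv g" using central that by simp
    finally show ?thesis using that by (simp add: m_assoc)
  qed
  have self: "comm x x = \<one>" if "x \<in> C" for x using that comm_eq_one_iff by simp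
  have alt: "comm (cj g x) x = \<one>" if x: "x \<in> C" and g: "g \<in> carrier G" for x g
  proof -
    define s where "s = inv x \<otimes> cj g x"
    have s: "s \<in> C" "x \<otimes> s = cj g x" using x cjC[OF x g] by (simp_all add: s_def flip: m_assoc)
    have ss: "s \<otimes> s = \<one>" using diff[OF x g] by (simp add: s_def cj_def)
    have G: "x \<in> carrier G" "s \<in> carrier G" using x s by auto
    have "inv s \<otimes> (s \<otimes> z) = z" "inv x \<otimes> (x \<otimes> z) = z" if "z \<in> carrier G" for z
      using that G by (simp_all flip: m_assoc)
    then have "(x \<otimes> s) \<otimes> (x \<otimes> s) = (x \<otimes> comm s x) \<otimes> (x \<otimes> (s \<otimes> s))"
      using G by (simp add: m_assoc)
    also have "\<dots> = (comm s x \<otimes> x) \<otimes> (x \<otimes> \<one>)"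
      by (simp only: ss central[OF s(1) x G(1)])
    also have "\<dots> = comm s x \<otimes> (x \<otimes> x)"
      using G m_assoc[of "comm s x" x x] by (simp only: r_one m_closed inv_closed)
    finally have "comm s x \<otimes> (x \<otimes> x) = x \<otimes> x"
      using cj_mult[OF x x g] sq[OF x g] by (simp add: s(2) cj_def)
    then have "comm s x = \<one>" using r_cancel_one[of "x \<otimes> x" "comm s x"] G by simp
    then have "comm (x \<otimes> s) x = \<one>" using left[OF x s(1) x] self[OF x] by simp
    then show ?thesis unfolding s(2) .
  qed
  \<comment> \<open>Expand \<open>alt\<close> at \<open>x \<otimes> y\<close>; signs do not matter because commutators have order at most \<open>2\<close>.\<close>
  have polar: "comm (cj g x) y = comm (cj (inv g) x) y" if x: "x \<in> C" and y: "y \<in> C" and g: "g \<in> carrier G" for x y g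
  proof -
    have xy: "x \<otimes> y \<in> C" using x y by simp
    have right: "comm a (b \<otimes> b') = comm a b \<otimes> comm a b'" if "a \<in> C" "b \<in> C" "b' \<in> C" for a b b'
      using left[OF that(2,3,1)] sym that by simp
    have "\<one> = comm (cj g x \<otimes> cj g y) (x \<otimes> y)" using alt[OF xy g] cj_mult[OF x y g] by simp
    also have "\<dots> = comm (cj g x) (x \<otimes> y) \<otimes> comm (cj g y) (x \<otimes> y)"
      using cjC x y g by (intro left) auto
    also have "\<dots> = comm (cj g x) y \<otimes> comm (cj g y) x"
      using right[OF cjC[OF x g] x y] right[OF cjC[OF y g] x y] alt[OF x g] alt[OF y g] cjC x y g C.mem_carrier by simp
    finally have "comm (cj g x) y = inv (comm (cj g y) x)"
      using cjC[OF x g] cjC[OF y g] x y C.mem_carrier by (intro inv_equality[symmetric]) simp_all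
    also have "\<dots> = comm (cj g y) x"
      using inv_of_comm[of "cj g y" x] sym[OF cjC[OF y g] x] cjC[OF y g] x by simp
    also have "\<dots> = comm (cj (inv g) (cj g y)) (cj (inv g) x)"
      using inv[OF cjC[OF y g] x inv_closed[OF g]] by simp
    also have "\<dots> = comm y (cj (inv g) x)" using cj_cj[OF y inv_closed[OF g] g] cj_one[OF y] g by simp
    finally show ?thesis using sym[OF cjC[OF x inv_closed[OF g]] y] by simp
  qed
  have "comm (cj g (cj g x)) y = comm (cj (inv g) (cj g x)) y"
    by (rule polar[OF cjC[OF x g] y g])
  also have "cj (inv g) (cj g x) = x" using cj_cj[OF x inv_closed[OF g] g] cj_one[OF x] g by simp
  finally show ?thesis using cj_cj[OF x g g] by (simp add: cj_def)
qed

end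

section \<open>One step of the characteristic series\<close>

text \<open>
  Here \<open>K = ker\<^sub>k\<close>, \<open>K1 = ker\<^sub>k\<^sub>+\<^sub>1\<close>, \<open>Ks = ker\<^sub>k\<^sup>*\<close> and \<open>Ks1 = ker\<^sub>k\<^sub>+\<^sub>1\<^sup>*\<close>.
\<close>

locale frattini_step = perfect_cover p G P T \<phi>
  for p :: nat and G :: "'g monoid" and P :: "'a monoid" (structure) and T :: "'a topology"
    and \<phi> :: "'a \<Rightarrow> 'g" +
  fixes K K1 Ks Ks1 :: "'a set"
  assumes K_normal: "K \<lhd> P" and star: "is_ker_star p P T K Ks"
    and K1_eq: "K1 = closed_verbal p P T K K K" and star1: "is_ker_star p P T K1 Ks1"
begin

abbreviation "K' \<equiv> closed_verbal p P T K Ks Ks"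
abbreviation "K'' \<equiv> closed_verbal p P T K K Ks"

sublocale K: normal K P by (rule K_normal)

lemmas Ks_normal = star_normal[OF star] and Ks_sub = star_subset[OF star]

sublocale Ks: normal Ks P by (rule Ks_normal)

lemma K1_normal: "K1 \<lhd> P" unfolding K1_eq by (intro closed_verbal_normal K_normal)

sublocale K1: normal K1 P by (rule K1_normal)

lemma K_open: "openin T K"
  by (rule closed_if_contains_open(1)[OF K.is_subgroup star_open[OF star] Ks_sub Ks.one_closed])

lemma K1_open: "openin T K1"
  by (rule closed_if_contains_open(1)[OF K1.is_subgroup star_open[OF star1] star_subset[OF star1]
      subgroup.one_closed[OF normal_imp_subgroup[OF star_normal[OF star1]]]])

lemma K1_sub_Ks: "K1 \<subseteq> Ks"
  unfolding K1_eq
  by (rule closed_verbal_least[OF Ks.is_subgroup star_closed[OF star]])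
    (simp_all add: star_comm[OF K_normal star] star_pow[OF K_normal star])

lemma K1_sub: "K1 \<subseteq> K" using K1_sub_Ks Ks_sub by blast

lemma K'_normal: "K' \<lhd> P" by (intro closed_verbal_normal K_normal Ks_normal)
lemma K''_normal: "K'' \<lhd> P" by (intro closed_verbal_normal K_normal Ks_normal)
lemma K'_closed: "closedin T K'" by (intro closed_verbal_closed K_normal Ks_normal)

sublocale K': normal K' P by (rule K'_normal)
sublocale K'': normal K'' P by (rule K''_normal)

lemma K'_comm: "x \<in> K \<Longrightarrow> s \<in> Ks \<Longrightarrow> comm x s \<in> K'"
  by (rule closed_verbal_comm[OF K_normal Ks_normal Ks_normal])
lemma K'_pow: "s \<in> Ks \<Longrightarrow> s [^] p \<in> K'"
  by (rule closed_verbal_pow[OF K_normal Ks_normal Ks_normal])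
lemma K''_comm: "x \<in> K \<Longrightarrow> y \<in> K \<Longrightarrow> comm x y \<in> K''"
  by (rule closed_verbal_comm[OF K_normal K_normal Ks_normal])
lemma K1_comm: "x \<in> K \<Longrightarrow> y \<in> K \<Longrightarrow> comm x y \<in> K1"
  unfolding K1_eq by (rule closed_verbal_comm[OF K_normal K_normal K_normal])
lemma K1_powI: "x \<in> K \<Longrightarrow> x [^] p \<in> K1"
  unfolding K1_eq by (rule closed_verbal_pow[OF K_normal K_normal K_normal])

lemma K'_sub_K'': "K' \<subseteq> K''"
  by (rule closed_verbal_mono) (simp_all add: K_normal Ks_normal Ks_sub)
lemma K''_sub_K1: "K'' \<subseteq> K1"
  unfolding K1_eq by (rule closed_verbal_mono) (simp_all add: K_normal Ks_sub)
lemma K'_sub_K1: "K' \<subseteq> K1" using K'_sub_K'' K''_sub_K1 by blast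

sublocale c: group_hom P "P Mod K'" "\<lambda>x. K' #> x" by (rule rcos_hom[OF K'_normal])

lemma central_mod:
  assumes "x \<in> K" "s \<in> Ks"
  shows "(K' #> s) \<otimes>\<^bsub>P Mod K'\<^esub> (K' #> x) = (K' #> x) \<otimes>\<^bsub>P Mod K'\<^esub> (K' #> s)"
  using comm_mem_iff[OF K'_normal, of x s] K'_comm[OF assms] assms by simp

lemma pow_mod_star:
  assumes x: "x \<in> K" and s: "s \<in> Ks"
  shows "K' #> (x \<otimes> s) [^] p = K' #> x [^] p"
proof -
  have "(K' #> s) [^]\<^bsub>P Mod K'\<^esub> p = \<one>\<^bsub>P Mod K'\<^esub>"
    using K'.FactGroup_pow[of s p] K'_pow[OF s] rcos_eq_one_iff[OF K'_normal, of "s [^] p"] s by simp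
  then have "((K' #> x) \<otimes>\<^bsub>P Mod K'\<^esub> (K' #> s)) [^]\<^bsub>P Mod K'\<^esub> p = (K' #> x) [^]\<^bsub>P Mod K'\<^esub> p"
    using central_mod[OF x s] x s c.hom_closed by (intro c.H.pow_mult_commuting) auto
  then show ?thesis
    using x s K'.FactGroup_pow[of x p] K'.FactGroup_pow[of "x \<otimes> s" p] c.hom_mult[of x s] by simp
qed

lemma comm_mod_star:
  assumes x: "x \<in> K" "y \<in> K" and s: "s \<in> Ks" "t \<in> Ks"
  shows "K' #> comm (x \<otimes> s) (y \<otimes> t) = K' #> comm x y"
proof -
  have hom_comm: "K' #> comm a b = c.H.comm (K' #> a) (K' #> b)" if "a \<in> carrier P" "b \<in> carrier P" for a b
    using that by (simp add: c.hom_mult c.hom_inv del: mult_FactGroup)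
  have yt: "y \<otimes> t \<in> K" using x s Ks_sub by blast
  have "c.H.comm ((K' #> x) \<otimes>\<^bsub>P Mod K'\<^esub> (K' #> s)) (K' #> (y \<otimes> t)) = c.H.comm (K' #> x) (K' #> (y \<otimes> t))"
    using central_mod[OF yt s(1)] c.hom_closed K.mem_carrier[OF x(1)] K.mem_carrier[OF yt] Ks.mem_carrier[OF s(1)]
    by (intro c.H.comm_mult_left_commuting)
  also have "\<dots> = c.H.comm (K' #> x) ((K' #> y) \<otimes>\<^bsub>P Mod K'\<^esub> (K' #> t))"
    using c.hom_mult[of y t] x s by simp
  also have "\<dots> = c.H.comm (K' #> x) (K' #> y)"
    using central_mod[OF x(1) s(2)] x s c.hom_closed by (intro c.H.comm_mult_right_commuting) auto
  finally show ?thesis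
    using hom_comm[of "x \<otimes> s" "y \<otimes> t"] hom_comm[of x y] c.hom_mult[of x s] x s by simp
qed

lemma conj_star:
  assumes "x \<in> K" "g \<in> carrier P"
  shows "\<exists>s\<in>Ks. g \<otimes> x \<otimes> inv g = x \<otimes> s"
proof (rule bexI)
  show "comm (inv x) g \<in> Ks" using star_comm(1)[OF K_normal star, of "inv x" g] assms by simp
  have "x \<otimes> (inv x \<otimes> z) = z" if "z \<in> carrier P" for z using assms that by (simp flip: m_assoc)
  then show "g \<otimes> x \<otimes> inv g = x \<otimes> comm (inv x) g" using assms by (simp add: m_assoc)
qed

text \<open>
  The elements fixed by conjugation modulo \<open>K'\<close> form a closed subgroup.  It contains \<open>x [^] p\<close> and \<open>comm x y\<close> for
  \<open>x, y\<close> in \<open>K\<close>, because conjugation changes \<open>x\<close> and \<open>y\<close> by factors in \<open>Ks\<close>.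
\<close>

theorem trivial_action:
  assumes u: "u \<in> K1" and g: "g \<in> carrier P"
  shows "comm u g \<in> K'"
proof -
  let ?Z = "{u \<in> carrier P. \<forall>g\<in>carrier P. comm u g \<in> K'}"
  have sZ: "subgroup ?Z P" by (rule subgroup_commuting_mod[OF K'_normal subset_refl])
  have "closedin T {u \<in> topspace T. comm u g \<in> K'}" if "g \<in> carrier P" for g
    by (rule closedin_continuous_map_preimage[OF _ K'_closed]) (intro continuous_group that)
  then have "closedin T (\<Inter>g\<in>carrier P. {u \<in> topspace T. comm u g \<in> K'})"
    using one_closed by (intro closedin_INT) auto
  moreover have "(\<Inter>g\<in>carrier P. {u \<in> topspace T. comm u g \<in> K'}) = ?Z"
    using one_closed by (auto simp: topspace)
  ultimately have cZ: "closedin T ?Z" by simp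
  have conj_fix: "comm w g \<in> K'" if "g \<in> carrier P" "w \<in> carrier P" "K' #> (g \<otimes> w \<otimes> inv g) = K' #> w" for g w
    using rcos_eq_iff[OF K'_normal, of "g \<otimes> w \<otimes> inv g" w] comm_mem_commute[OF K'_normal that(2,1)] that by simp
  have "K1 \<subseteq> ?Z"
    unfolding K1_eq
  proof (rule closed_verbal_least[OF sZ cZ])
    fix x y assume x: "x \<in> K" and y: "y \<in> K"
    have "comm (comm x y) g \<in> K'" if g: "g \<in> carrier P" for g
    proof (rule conj_fix[OF g])
      obtain s t where st: "s \<in> Ks" "g \<otimes> x \<otimes> inv g = x \<otimes> s" "t \<in> Ks" "g \<otimes> y \<otimes> inv g = y \<otimes> t"
        using conj_star[OF x g] conj_star[OF y g] by blast
      show "K' #> (g \<otimes> comm x y \<otimes> inv g) = K' #> comm x y"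
        using conj_comm[OF g, of x y] x y comm_mod_star[OF x y st(1,3)] st(2,4) by simp
    qed (use x y in simp)
    then show "comm x y \<in> ?Z" using x y by simp
  next
    fix x assume x: "x \<in> K"
    have "comm (x [^] p) g \<in> K'" if g: "g \<in> carrier P" for g
    proof (rule conj_fix[OF g])
      obtain s where s: "s \<in> Ks" "g \<otimes> x \<otimes> inv g = x \<otimes> s" using conj_star[OF x g] by blast
      show "K' #> (g \<otimes> x [^] p \<otimes> inv g) = K' #> x [^] p"
        using conj_pow[OF g, of x p] x pow_mod_star[OF x s(1)] s(2) by simp
    qed (use x in simp)
    then show "x [^] p \<in> ?Z" using x by simp
  qed
  then show ?thesis using u g by auto
qed

lemma K1_pow: "u \<in> K1 \<Longrightarrow> u [^] p \<in> K'"
  using K'_pow K1_sub_Ks by blast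

lemma zp_V: "zp_module p (subquotient P K Ks)"
  by (rule zp_module_subquotient[OF K.is_subgroup Ks_normal Ks_sub])
    (simp_all add: star_comm[OF K_normal star] star_pow[OF K_normal star])

lemma zp_W: "zp_module p (subquotient P K1 K')"
  by (rule zp_module_subquotient[OF K1.is_subgroup K'_normal K'_sub_K1])
    (simp_all add: trivial_action K1_pow)

lemma zp_W'': "zp_module p (subquotient P K1 K'')"
  using trivial_action K1_pow K'_sub_K''
  by (intro zp_module_subquotient[OF K1.is_subgroup K''_normal K''_sub_K1]) (auto simp: subset_iff)

lemma finite_index_Ks: "finite (rcosets Ks)" and finite_index_K1: "finite (rcosets K1)"
  using finite_index_if_open[OF compact] Ks.is_subgroup K1.is_subgroup star_open[OF star] K1_open by simp_all

text \<open>
  Modulo \<open>K'\<close>, the topological generators of \<open>K1\<close> are the finitely many \<open>p\<close>th powers and commutators of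
  representatives of \<open>K/Ks\<close>.  They lie in a finite subgroup of the elementary abelian group \<open>K1/K'\<close>; its
  preimage is closed, being a finite union of cosets, and so is all of \<open>K1\<close>.
\<close>

theorem K'_open: "openin T K'"
proof -
  let ?W = "subquotient P K1 K'"
  interpret W: comm_group ?W using zp_W by (simp add: zp_module_def)
  have expW: "v [^]\<^bsub>?W\<^esub> p = \<one>\<^bsub>?W\<^esub>" if "v \<in> carrier ?W" for v
    using zp_W that by (simp add: zp_module_def)
  obtain R where R: "finite R" "R \<subseteq> carrier P" "\<And>x. x \<in> carrier P \<Longrightarrow> \<exists>t\<in>R. x \<otimes> inv t \<in> Ks"
    using finite_transversal[OF Ks.is_subgroup finite_index_Ks] by blast
  have rep: "\<exists>t\<in>R \<inter> K. \<exists>s\<in>Ks. x = t \<otimes> s" if x: "x \<in> K" for x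
  proof -
    obtain t where t: "t \<in> R" "x \<otimes> inv t \<in> Ks" using R(3) x K.mem_carrier by blast
    have tP: "t \<in> carrier P" and xP: "x \<in> carrier P" using t R x by auto
    have "inv (x \<otimes> inv t) \<otimes> x = t" using tP xP by (simp add: inv_mult_group m_assoc)
    then have "t \<in> K" using x t(2) Ks_sub by (metis K.m_closed K.m_inv_closed subsetD)
    moreover have "inv t \<otimes> (x \<otimes> inv t) \<otimes> t \<in> Ks" using Ks.inv_op_closed1[OF tP t(2)] .
    then have "inv t \<otimes> x \<in> Ks" using tP xP by (simp add: m_assoc)
    moreover have "x = t \<otimes> (inv t \<otimes> x)" using tP xP by (simp flip: m_assoc)
    ultimately show ?thesis using t(1) by blast
  qed
  define F where "F = (\<lambda>x. K' #> x [^] p) ` (R \<inter> K) \<union> (\<lambda>(x, y). K' #> comm x y) ` ((R \<inter> K) \<times> (R \<inter> K))"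
  have "finite F" using R(1) by (simp add: F_def)
  moreover have FW: "F \<subseteq> carrier ?W" using K1_comm K1_powI by (auto simp: F_def carrier_FactGroup)
  ultimately obtain A where A: "subgroup A ?W" "finite A" "F \<subseteq> A"
    using W.finite_subgroup_containing[of F p] prime_gt_0_nat[OF prime_p] expW by blast
  interpret A: subgroup A ?W by (rule A(1))
  have A_rcos: "\<exists>u\<in>K1. C = K' #> u" if "C \<in> A" for C
    using A.mem_carrier[OF that] by (auto simp: carrier_FactGroup)
  define D where "D = {u \<in> K1. K' #> u \<in> A}"
  interpret cW: group_hom "P\<lparr>carrier := K1\<rparr>" ?W "\<lambda>x. K' #> x"
    using group.rcos_hom[OF K1.subgroup_is_group[OF is_group]
        normal_restrict_supergroup[OF K1.is_subgroup K'_normal K'_sub_K1]] by simp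
  have sD: "subgroup D P"
  proof
    show "D \<subseteq> carrier P" using K1.subset by (auto simp: D_def)
    show "\<one> \<in> D" using A.one_closed K'.subset by (simp add: D_def)
    fix u assume u: "u \<in> D"
    then show "inv u \<in> D"
      using A.m_inv_closed[of "K' #> u"] cW.hom_inv[of u] m_inv_consistent[OF K1.is_subgroup, of u]
      by (simp add: D_def)
    fix v assume v: "v \<in> D"
    have uv: "u \<in> K1" "v \<in> K1" "K' #> u \<in> A" "K' #> v \<in> A" using u v by (auto simp: D_def)
    have "K' #> (u \<otimes> v) \<in> A"
      using A.m_closed[OF uv(3,4)]
      unfolding subquotient_mult[OF K'_normal K1.mem_carrier[OF uv(1)] K1.mem_carrier[OF uv(2)]] .
    then show "u \<otimes> v \<in> D" using uv by (simp only: D_def mem_Collect_eq K1.m_closed simp_thms)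
  qed
  have "D = \<Union>A"
  proof (intro equalityI subsetI)
    fix u assume "u \<in> D"
    then show "u \<in> \<Union>A" using rcos_self[of u K'] K'.is_subgroup by (auto simp: D_def)
  next
    fix u assume "u \<in> \<Union>A"
    then obtain C where C: "C \<in> A" "u \<in> C" by auto
    obtain v where v: "v \<in> K1" "C = K' #> v" using A_rcos[OF C(1)] by auto
    have "K' #> u = C" using repr_independence[of u K' v] C v K'.is_subgroup by simp
    moreover have "u \<in> K1" using C(2) v K'_sub_K1 by (auto simp: r_coset_def)
    ultimately show "u \<in> D" using C by (simp add: D_def)
  qed
  moreover have "closedin T (\<Union>A)"
    using A(2) closed_rcos[OF K'_closed] A_rcos K1.mem_carrier by (intro closedin_Union) blast+
  ultimately have cD: "closedin T D" by simp
  have "K1 \<subseteq> D"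
    unfolding K1_eq
  proof (rule closed_verbal_least[OF sD cD])
    fix x y assume x: "x \<in> K" and y: "y \<in> K"
    obtain x0 s where xs: "x0 \<in> R \<inter> K" "s \<in> Ks" "x = x0 \<otimes> s" using rep[OF x] by blast
    obtain y0 t where yt: "y0 \<in> R \<inter> K" "t \<in> Ks" "y = y0 \<otimes> t" using rep[OF y] by blast
    have "K' #> comm x y = K' #> comm x0 y0"
      unfolding xs(3) yt(3) using xs yt by (intro comm_mod_star) auto
    moreover have "K' #> comm x0 y0 \<in> F" unfolding F_def using xs(1) yt(1) by force
    ultimately show "comm x y \<in> D" using A(3) K1_comm[OF x y] by (auto simp: D_def)
  next
    fix x assume x: "x \<in> K"
    obtain x0 s where xs: "x0 \<in> R \<inter> K" "s \<in> Ks" "x = x0 \<otimes> s" using rep[OF x] by blast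
    have "K' #> x [^] p = K' #> x0 [^] p"
      unfolding xs(3) using xs by (intro pow_mod_star) auto
    moreover have "K' #> x0 [^] p \<in> F" unfolding F_def using xs(1) by blast
    ultimately show "x [^] p \<in> D" using A(3) K1_powI[OF x] by (auto simp: D_def)
  qed
  then have K1A: "K' #> u \<in> A" if "u \<in> K1" for u using that by (auto simp: D_def)
  obtain Y where Y: "finite Y" "Y \<subseteq> carrier P" "\<And>x. x \<in> carrier P \<Longrightarrow> \<exists>t\<in>Y. x \<otimes> inv t \<in> K1"
    using finite_transversal[OF K1.is_subgroup finite_index_K1] by blast
  have "rcosets K' \<subseteq> (\<lambda>(C, t). C #> t) ` (A \<times> Y)"
  proof
    fix B assume "B \<in> rcosets K'"
    then obtain x where x: "x \<in> carrier P" "B = K' #> x" by (auto simp: RCOSETS_def)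
    obtain t where t: "t \<in> Y" "x \<otimes> inv t \<in> K1" using Y(3)[OF x(1)] by auto
    have tP: "t \<in> carrier P" using t Y by auto
    have "(K' #> (x \<otimes> inv t)) #> t = B"
      using coset_mult_assoc[of K' "x \<otimes> inv t" t] K'.subset x tP by (simp add: m_assoc)
    then show "B \<in> (\<lambda>(C, t). C #> t) ` (A \<times> Y)"
      using K1A[OF t(2)] t(1) by force
  qed
  then have "finite (rcosets K')" using A(2) Y(1) finite_subset by blast
  then show ?thesis by (rule open_if_closed_finite_index[OF K'.is_subgroup K'_closed])
qed

theorem Ks1_sub_K': "Ks1 \<subseteq> K'"
  by (rule star_least[OF K1_normal star1 K'_normal K'_open K'_sub_K1])
    (simp_all add: trivial_action K1_pow)

theorem pth_power_mem_iff:
  assumes x: "x \<in> K"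
  shows "x [^] p \<in> K' \<longleftrightarrow> x \<in> Ks" and "x [^] p \<in> K'' \<longleftrightarrow> x \<in> Ks"
proof -
  have "x \<in> Ks" if "x [^] p \<in> K''"
    by (rule pth_power_in_verbal[OF K_normal K_open Ks_normal star_open[OF star] Ks_sub _ _ x that])
      (simp_all add: star_comm[OF K_normal star] star_pow[OF K_normal star])
  then show "x [^] p \<in> K' \<longleftrightarrow> x \<in> Ks" "x [^] p \<in> K'' \<longleftrightarrow> x \<in> Ks"
    using K'_pow K'_sub_K'' by blast+
qed

lemma pow_mult_mod_K'':
  assumes x: "x \<in> K" and y: "y \<in> K"
  shows "K'' #> (x \<otimes> y) [^] p = K'' #> (x [^] p \<otimes> y [^] p)"
proof -
  have xP: "x \<in> carrier P" and yP: "y \<in> carrier P" using x y by auto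
  interpret d: group_hom P "P Mod K''" "\<lambda>x. K'' #> x" by (rule rcos_hom[OF K''_normal])
  have "(K'' #> x) \<otimes>\<^bsub>P Mod K''\<^esub> (K'' #> y) = (K'' #> y) \<otimes>\<^bsub>P Mod K''\<^esub> (K'' #> x)"
    using comm_mem_iff[OF K''_normal, of x y] K''_comm[OF x y] x y by simp
  then have "((K'' #> x) \<otimes>\<^bsub>P Mod K''\<^esub> (K'' #> y)) [^]\<^bsub>P Mod K''\<^esub> p
      = (K'' #> x) [^]\<^bsub>P Mod K''\<^esub> p \<otimes>\<^bsub>P Mod K''\<^esub> (K'' #> y) [^]\<^bsub>P Mod K''\<^esub> p"
    using x y d.hom_closed by (intro d.H.pow_mult_distrib) auto
  then show ?thesis
    unfolding d.hom_mult[OF xP yP, symmetric] K''.FactGroup_pow[OF xP] K''.FactGroup_pow[OF yP]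
      K''.FactGroup_pow[OF m_closed[OF xP yP]]
      d.hom_mult[OF nat_pow_closed[OF xP] nat_pow_closed[OF yP], symmetric] .
qed

text \<open>
  For odd \<open>p\<close> the correction term is the power of a commutator with exponent divisible by \<open>p\<close>.  For \<open>p = 2\<close> and
  \<open>K/Ks\<close> of order at most two, \<open>K/K'\<close> is generated by one element and a central subgroup, hence abelian.
\<close>

lemma pow_mult_mod_K':
  assumes x: "x \<in> K" and y: "y \<in> K" and "p \<noteq> 2 \<or> card (carrier (subquotient P K Ks)) \<le> 2"
  shows "K' #> (x \<otimes> y) [^] p = K' #> (x [^] p \<otimes> y [^] p)"
proof -
  let ?Q = "P Mod K'"
  have xP: "x \<in> carrier P" and yP: "y \<in> carrier P" using x y by auto
  have cl: "K' #> x \<in> carrier ?Q" "K' #> y \<in> carrier ?Q" using xP yP c.hom_closed by auto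
  have "((K' #> x) \<otimes>\<^bsub>?Q\<^esub> (K' #> y)) [^]\<^bsub>?Q\<^esub> p
      = (K' #> x) [^]\<^bsub>?Q\<^esub> p \<otimes>\<^bsub>?Q\<^esub> (K' #> y) [^]\<^bsub>?Q\<^esub> p"
  proof (cases "p = 2")
    case False
    define z where "z = comm (inv y) (inv x)"
    have zs: "z \<in> Ks" using star_comm(1)[OF K_normal star, of "inv y" "inv x"] x y by (simp add: z_def)
    have zP: "z \<in> carrier P" using zs by simp
    have zc: "K' #> z \<in> carrier ?Q" using zP c.hom_closed by simp
    have "y \<otimes> x = x \<otimes> y \<otimes> z"
    proof -
      have "y \<otimes> (inv y \<otimes> w) = w" "x \<otimes> (inv x \<otimes> w) = w" if "w \<in> carrier P" for w
        using xP yP that by (simp_all flip: m_assoc)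
      then show ?thesis using xP yP by (simp add: z_def m_assoc)
    qed
    then have yx: "(K' #> y) \<otimes>\<^bsub>?Q\<^esub> (K' #> x) = (K' #> x) \<otimes>\<^bsub>?Q\<^esub> (K' #> y) \<otimes>\<^bsub>?Q\<^esub> (K' #> z)"
      using c.hom_mult[OF yP xP] c.hom_mult[OF xP yP] c.hom_mult[of "x \<otimes> y" z] xP yP zP by simp
    have zp: "(K' #> z) [^]\<^bsub>?Q\<^esub> p = \<one>\<^bsub>?Q\<^esub>"
      using K'.FactGroup_pow[OF zP, of p] K'_pow[OF zs] rcos_eq_one_iff[OF K'_normal, of "z [^] p"] zP by simp
    have "odd p" using False prime_p primes_dvd_imp_eq two_is_prime_nat by blast
    then have "p * (p - 1) div 2 = p * ((p - 1) div 2)" by (simp add: div_mult_swap)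
    then have "(K' #> z) [^]\<^bsub>?Q\<^esub> (p * (p - 1) div 2) = \<one>\<^bsub>?Q\<^esub>"
      using c.H.nat_pow_pow[OF zc, of p "(p - 1) div 2"] zp c.H.nat_pow_one by metis
    then show ?thesis
      using c.H.pow_mult_class_two[OF cl zc yx central_mod[OF x zs] central_mod[OF y zs], of p] cl
        c.H.r_one[of "(K' #> x) [^]\<^bsub>?Q\<^esub> p \<otimes>\<^bsub>?Q\<^esub> (K' #> y) [^]\<^bsub>?Q\<^esub> p"] by (metis c.H.m_closed c.H.nat_pow_closed)
  next
    case True
    have "(K' #> x) \<otimes>\<^bsub>?Q\<^esub> (K' #> y) = (K' #> y) \<otimes>\<^bsub>?Q\<^esub> (K' #> x)"
    proof (cases "x \<in> Ks \<or> y \<in> Ks")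
      case True
      then show ?thesis using central_mod[OF x] central_mod[OF y] by metis
    next
      case False
      let ?V = "subquotient P K Ks"
      have V: "Ks \<in> carrier ?V" "Ks #> x \<in> carrier ?V" "Ks #> y \<in> carrier ?V"
        using x y coset_mult_one[OF Ks.subset] K.one_closed unfolding carrier_subquotient by force+
      have fin: "finite (carrier ?V)"
        using finite_index_Ks K.subset by (auto simp: carrier_FactGroup RCOSETS_def intro: rev_finite_subset)
      have ne: "Ks #> x \<noteq> Ks" "Ks #> y \<noteq> Ks" using False rcos_eq_one_iff[OF Ks_normal] xP yP by auto
      have "Ks #> x = Ks #> y"
      proof (rule ccontr)
        assume "Ks #> x \<noteq> Ks #> y"
        then have "card {Ks, Ks #> x, Ks #> y} = 3" using ne by auto
        moreover have "card {Ks, Ks #> x, Ks #> y} \<le> card (carrier ?V)"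
          using V by (intro card_mono[OF fin]) auto
        ultimately show False using assms(3) \<open>p = 2\<close> by simp
      qed
      then have s: "y \<otimes> inv x \<in> Ks" using rcos_eq_iff[OF Ks_normal yP xP] by simp
      have y_eq: "K' #> y = (K' #> (y \<otimes> inv x)) \<otimes>\<^bsub>?Q\<^esub> (K' #> x)"
        using c.hom_mult[of "y \<otimes> inv x" x] xP yP by (simp add: m_assoc)
      have sc: "K' #> (y \<otimes> inv x) \<in> carrier ?Q" using xP yP by (intro c.hom_closed) simp
      show ?thesis
        unfolding y_eq using central_mod[OF x s] c.H.m_assoc[OF cl(1) sc cl(1)] by metis
    qed
    then show ?thesis using cl by (intro c.H.pow_mult_distrib)
  qed
  then show ?thesis
    unfolding c.hom_mult[OF xP yP, symmetric] K'.FactGroup_pow[OF xP] K'.FactGroup_pow[OF yP]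
      K'.FactGroup_pow[OF m_closed[OF xP yP]]
      c.hom_mult[OF nat_pow_closed[OF xP] nat_pow_closed[OF yP], symmetric] .
qed

end

context frattini_step
begin

text \<open>
  Both injectivity claims reduce to the one modulo \<open>K''\<close>, where \<open>x [^] p\<close> is multiplicative in \<open>x\<close>, so that
  \<open>pth_power_mem_iff\<close> applies to \<open>x \<otimes> inv y\<close>.
\<close>

lemma pth_power_map:
  "\<exists>f. (\<forall>x\<in>K. f (Ks #> x) = K' #> (x [^] p)) \<and>
     f \<in> carrier (subquotient P K Ks) \<rightarrow> carrier (subquotient P K1 K') \<and>
     inj_on f (carrier (subquotient P K Ks)) \<and>
     (p \<noteq> 2 \<or> card (carrier (subquotient P K Ks)) \<le> 2 \<longrightarrow>
        f \<in> hom (subquotient P K Ks) (subquotient P K1 K')) \<and>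
     zp_module p (subquotient P K1 K'') \<and>
     quot_map P K'' \<circ> f \<in> hom (subquotient P K Ks) (subquotient P K1 K'') \<and>
     inj_on (quot_map P K'' \<circ> f) (carrier (subquotient P K Ks))"
proof -
  let ?V = "subquotient P K Ks" and ?W = "subquotient P K1 K'" and ?W'' = "subquotient P K1 K''"
  define f where "f C = K' #> ((SOME x. x \<in> K \<and> C = Ks #> x) [^] p)" for C
  have f: "f (Ks #> x) = K' #> (x [^] p)" if x: "x \<in> K" for x
  proof -
    define y where "y = (SOME y. y \<in> K \<and> Ks #> x = Ks #> y)"
    have "y \<in> K \<and> Ks #> x = Ks #> y" unfolding y_def by (rule someI[of _ x]) (use x in simp)
    then have y: "y \<in> K" "Ks #> y = Ks #> x" by simp_all
    have xP: "x \<in> carrier P" and yP: "y \<in> carrier P" using x y by auto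
    have "y \<otimes> inv x \<in> Ks" using rcos_eq_iff[OF Ks_normal yP xP] y(2) by simp
    then have "inv x \<otimes> (y \<otimes> inv x) \<otimes> x \<in> Ks" by (rule Ks.inv_op_closed1[OF xP])
    then have s: "inv x \<otimes> y \<in> Ks" using xP yP by (simp add: m_assoc)
    have "x \<otimes> (inv x \<otimes> y) = y" using xP yP by (simp flip: m_assoc)
    then have "K' #> y [^] p = K' #> x [^] p" using pow_mod_star[OF x s] by simp
    then show ?thesis by (simp add: f_def y_def)
  qed
  have powP: "x [^] p \<in> carrier P" if "x \<in> K" for x using that by simp
  have V: "\<exists>x\<in>K. C = Ks #> x" if "C \<in> carrier ?V" for C using that by (auto simp: carrier_FactGroup)
  have g: "(quot_map P K'' \<circ> f) (Ks #> x) = K'' #> (x [^] p)" if x: "x \<in> K" for x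
    using f[OF x] quot_map_rcos[OF K'_normal K''_normal K'_sub_K'' powP[OF x]] by simp
  have V_mult: "(Ks #> x) \<otimes>\<^bsub>?V\<^esub> (Ks #> y) = Ks #> (x \<otimes> y)" if "x \<in> K" "y \<in> K" for x y
    by (rule subquotient_mult[OF Ks_normal K.mem_carrier[OF that(1)] K.mem_carrier[OF that(2)]])
  have inj'': "inj_on (quot_map P K'' \<circ> f) (carrier ?V)"
  proof (rule inj_onI)
    fix C D assume CD: "C \<in> carrier ?V" "D \<in> carrier ?V" "(quot_map P K'' \<circ> f) C = (quot_map P K'' \<circ> f) D"
    obtain x y where x: "x \<in> K" "C = Ks #> x" and y: "y \<in> K" "D = Ks #> y" using V CD(1,2) by metis
    have xP: "x \<in> carrier P" and yP: "y \<in> carrier P" using x y by auto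
    have eq: "K'' #> x [^] p = K'' #> y [^] p" using CD(3) g[OF x(1)] g[OF y(1)] x(2) y(2) by simp
    have xy: "x \<otimes> inv y \<in> K" using x y by simp
    have "x [^] p \<otimes> inv (y [^] p) \<in> K''"
      using eq rcos_eq_iff[OF K''_normal powP[OF x(1)] powP[OF y(1)]] by simp
    moreover have "K'' #> (x \<otimes> inv y) [^] p = K'' #> (x [^] p \<otimes> inv (y [^] p))"
      using pow_mult_mod_K''[of x "inv y"] x y nat_pow_inv[OF yP] by simp
    ultimately have "(x \<otimes> inv y) [^] p \<in> K''"
      using rcos_eq_one_iff[OF K''_normal, of "(x \<otimes> inv y) [^] p"]
        rcos_eq_one_iff[OF K''_normal, of "x [^] p \<otimes> inv (y [^] p)"] xP yP by simp
    then have "x \<otimes> inv y \<in> Ks" using pth_power_mem_iff(2)[OF xy] by simp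
    then show "C = D" using rcos_eq_iff[OF Ks_normal xP yP] x(2) y(2) by simp
  qed
  have inj: "inj_on f (carrier ?V)" by (rule inj_on_imageI2[OF inj''])
  have fW: "f \<in> carrier ?V \<rightarrow> carrier ?W"
  proof
    fix C assume "C \<in> carrier ?V"
    then obtain x where x: "x \<in> K" "C = Ks #> x" using V by auto
    then show "f C \<in> carrier ?W" using f[OF x(1)] K1_powI[OF x(1)] by (simp add: carrier_FactGroup)
  qed
  have hom: "f \<in> hom ?V ?W" if c: "p \<noteq> 2 \<or> card (carrier ?V) \<le> 2"
  proof (rule homI)
    fix C D assume CD: "C \<in> carrier ?V" "D \<in> carrier ?V"
    obtain x y where x: "x \<in> K" "C = Ks #> x" and y: "y \<in> K" "D = Ks #> y" using V CD by metis
    have "f (C \<otimes>\<^bsub>?V\<^esub> D) = K' #> (x \<otimes> y) [^] p"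
      unfolding x(2) y(2) V_mult[OF x(1) y(1)] using f x y by simp
    also have "\<dots> = K' #> (x [^] p \<otimes> y [^] p)" by (rule pow_mult_mod_K'[OF x(1) y(1) c])
    also have "\<dots> = f C \<otimes>\<^bsub>?W\<^esub> f D"
      unfolding x(2) y(2) f[OF x(1)] f[OF y(1)]
      by (rule subquotient_mult[OF K'_normal powP[OF x(1)] powP[OF y(1)], symmetric])
    finally show "f (C \<otimes>\<^bsub>?V\<^esub> D) = f C \<otimes>\<^bsub>?W\<^esub> f D" .
  qed (use fW in blast)
  have hom'': "quot_map P K'' \<circ> f \<in> hom ?V ?W''"
  proof (rule homI)
    fix C D assume CD: "C \<in> carrier ?V" "D \<in> carrier ?V"
    obtain x y where x: "x \<in> K" "C = Ks #> x" and y: "y \<in> K" "D = Ks #> y" using V CD by metis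
    show "(quot_map P K'' \<circ> f) C \<in> carrier ?W''"
      unfolding x(2) g[OF x(1)] using K1_powI[OF x(1)] by (simp add: carrier_FactGroup)
    have xy: "x \<otimes> y \<in> K" using x y by simp
    show "(quot_map P K'' \<circ> f) (C \<otimes>\<^bsub>?V\<^esub> D) = (quot_map P K'' \<circ> f) C \<otimes>\<^bsub>?W''\<^esub> (quot_map P K'' \<circ> f) D"
      unfolding x(2) y(2) V_mult[OF x(1) y(1)] g[OF x(1)] g[OF y(1)] g[OF xy]
        subquotient_mult[OF K''_normal powP[OF x(1)] powP[OF y(1)]]
      by (rule pow_mult_mod_K''[OF x(1) y(1)])
  qed
  show ?thesis
    by (intro exI[of _ f] conjI ballI impI f inj inj'' fW hom hom'' zp_W'')
qed

text \<open>
  Since \<open>y [^] (p * p)\<close> is in \<open>L\<close>, the coset of \<open>y\<close> has order \<open>p\<^sup>2\<close> exactly when \<open>y [^] p\<close> is not in \<open>L\<close>.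
\<close>

lemma lift_order_property_iff:
  assumes L: "L \<lhd> P" "L \<subseteq> K1" and pp: "\<And>y. y \<in> K \<Longrightarrow> (y [^] p) [^] p \<in> L"
  shows "lift_order_property p P K K1 Ks L \<longleftrightarrow> (\<forall>y\<in>K. y [^] p \<in> L \<longleftrightarrow> y \<in> Ks)"
proof -
  interpret L: normal L P by (rule L(1))
  have LK: "L \<subseteq> K" using L(2) K1_sub by blast
  have ord: "group.ord (P Mod L) (L #> y) = p\<^sup>2 \<longleftrightarrow> y [^] p \<notin> L" if y: "y \<in> K" for y
  proof -
    have yP: "y \<in> carrier P" using y by simp
    have yc: "L #> y \<in> carrier (P Mod L)" using yP by (simp add: carrier_FactGroup)
    have "y [^] (p\<^sup>2) \<in> L" using pp[OF y] yP by (simp add: nat_pow_pow power2_eq_square)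
    then have "(L #> y) [^]\<^bsub>P Mod L\<^esub> (p\<^sup>2) = \<one>\<^bsub>P Mod L\<^esub>"
      using L.FactGroup_pow[OF yP] rcos_eq_one_iff[OF L(1), of "y [^] (p\<^sup>2)"] yP by simp
    from group.ord_eq_prime_square_iff[OF L.factorgroup_is_group prime_p yc this]
    show ?thesis
      using L.FactGroup_pow[OF yP, of p] rcos_eq_one_iff[OF L(1), of "y [^] p"] yP by simp
  qed
  have q1: "quot_map P K1 (L #> y) = K1 #> y" if "y \<in> K" for y
    using quot_map_rcos[OF L(1) K1_normal L(2)] that by simp
  have q2: "quot_map P Ks (K1 #> y) = \<one>\<^bsub>P Mod Ks\<^esub> \<longleftrightarrow> y \<in> Ks" if "y \<in> K" for y
    using quot_map_rcos[OF K1_normal Ks_normal K1_sub_Ks] rcos_eq_one_iff[OF Ks_normal] that by simp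
  have "lift_order_property p P K K1 Ks L \<longleftrightarrow>
      (\<forall>y\<in>K. group.ord (P Mod L) (L #> y) = p\<^sup>2 \<longleftrightarrow> quot_map P Ks (K1 #> y) \<noteq> \<one>\<^bsub>P Mod Ks\<^esub>)"
    unfolding lift_order_property_def kernel_quot_map[OF K1_normal K_normal K1_sub]
      kernel_quot_map[OF L(1) K_normal LK] by (auto simp: q1 simp del: one_FactGroup)
  then show ?thesis using ord q2 by auto
qed

lemma star_central_iff:
  assumes L: "L \<lhd> P" "L \<subseteq> Ks"
  shows "star_central P K Ks L \<longleftrightarrow> (\<forall>s\<in>Ks. \<forall>x\<in>K. comm x s \<in> L)"
proof -
  have LK: "L \<subseteq> K" using L(2) Ks_sub by blast
  have "star_central P K Ks L \<longleftrightarrow> (\<forall>s\<in>Ks. \<forall>x\<in>K. (L #> s) \<otimes>\<^bsub>P Mod L\<^esub> (L #> x) = (L #> x) \<otimes>\<^bsub>P Mod L\<^esub> (L #> s))"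
    unfolding star_central_def kernel_quot_map[OF L(1) Ks_normal L(2)] kernel_quot_map[OF L(1) K_normal LK]
    by simp
  also have "\<dots> \<longleftrightarrow> (\<forall>s\<in>Ks. \<forall>x\<in>K. comm x s \<in> L)"
    using comm_mem_iff[OF L(1)] by (metis K.mem_carrier Ks.mem_carrier)
  finally show ?thesis .
qed

text \<open>
  By \<open>comm_conj_square\<close> in \<open>P/L\<close>, conjugating \<open>a\<close> by a square does not change \<open>comm a b\<close> modulo \<open>L\<close>, for \<open>a, b\<close>
  in \<open>K\<close>.  The squares and \<open>K1\<close> generate an open normal subgroup whose quotient has exponent \<open>2\<close>, hence all of
  \<open>P\<close>, so the same holds for conjugation of \<open>a\<close> by any element of \<open>P\<close>.  Therefore the subgroup \<open>S\<close> of those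
  elements of \<open>K\<close> that commute with \<open>K\<close> modulo \<open>L\<close> contains \<open>[K, P]\<close>.  It also contains the squares of \<open>K\<close>, and
  \<open>star_least\<close> gives \<open>Ks \<subseteq> S\<close>.
\<close>

lemma squares_determine_star_central:
  assumes p2: "p = 2" and L: "L \<lhd> P" "Ks1 \<subseteq> L" "L \<subseteq> K1"
    and sq: "\<And>s. s \<in> Ks \<Longrightarrow> s \<otimes> s \<in> L"
    and x: "x \<in> K" and s: "s \<in> Ks"
  shows "comm x s \<in> L"
proof -
  interpret L: normal L P by (rule L(1))
  let ?Q = "P Mod L"
  interpret q: group_hom P ?Q "\<lambda>x. L #> x" by (rule rcos_hom[OF L(1)])
  have two: "z [^] p = z \<otimes> z" if "z \<in> carrier P" for z
    using that by (simp add: p2 numeral_2_eq_2)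
  have q_one: "L #> z = \<one>\<^bsub>?Q\<^esub> \<longleftrightarrow> z \<in> L" if "z \<in> carrier P" for z
    using rcos_eq_one_iff[OF L(1) that] by simp
  have q_eq: "L #> z = L #> w \<longleftrightarrow> z \<otimes> inv w \<in> L" if "z \<in> carrier P" "w \<in> carrier P" for z w
    using rcos_eq_iff[OF L(1)] that by simp
  have q_comm: "L #> comm a b = q.H.comm (L #> a) (L #> b)" if "a \<in> carrier P" "b \<in> carrier P" for a b
    using that by (simp add: q.hom_mult q.hom_inv del: mult_FactGroup)
  have central: "comm g u \<in> L" "comm u g \<in> L" if "u \<in> K1" "g \<in> carrier P" for u g
    using star_comm[OF K1_normal star1 that] L(2) by auto
  have qcentral: "(L #> u) \<otimes>\<^bsub>?Q\<^esub> w = w \<otimes>\<^bsub>?Q\<^esub> (L #> u)" if "u \<in> K1" "w \<in> carrier ?Q" for u w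
    using comm_mem_iff[OF L(1)] central[OF that(1)] that by (auto simp: carrier_FactGroup)
  have sq1: "u \<otimes> u \<in> L" if "u \<in> K1" for u
    using sq K1_sub_Ks that by blast
  define C where "C = (\<lambda>x. L #> x) ` K"
  have C: "C \<lhd> ?Q"
    unfolding C_def by (rule q.image_normal[OF K_normal]) (simp add: carrier_FactGroup)
  have form: "comm (h \<otimes> h \<otimes> a \<otimes> inv (h \<otimes> h)) b \<otimes> inv (comm a b) \<in> L"
    if h: "h \<in> carrier P" and a: "a \<in> K" and b: "b \<in> K" for h a b
  proof -
    have hP: "h \<in> carrier P" "a \<in> carrier P" "b \<in> carrier P" using h a b by auto
    have "q.H.comm (((L #> h) \<otimes>\<^bsub>?Q\<^esub> (L #> h)) \<otimes>\<^bsub>?Q\<^esub> (L #> a) \<otimes>\<^bsub>?Q\<^esub> inv\<^bsub>?Q\<^esub> ((L #> h) \<otimes>\<^bsub>?Q\<^esub> (L #> h))) (L #> b)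
        = q.H.comm (L #> a) (L #> b)"
    proof (rule q.H.comm_conj_square[OF C])
      fix A B assume AB: "A \<in> C" "B \<in> C"
      obtain a b where ab: "a \<in> K" "b \<in> K" "A = L #> a" "B = L #> b" using AB by (auto simp: C_def)
      have abP: "a \<in> carrier P" "b \<in> carrier P" using ab by auto
      show "q.H.comm A B \<otimes>\<^bsub>?Q\<^esub> D = D \<otimes>\<^bsub>?Q\<^esub> q.H.comm A B" if "D \<in> carrier ?Q" for D
        unfolding ab(3,4) q_comm[OF abP, symmetric] by (rule qcentral[OF K1_comm[OF ab(1,2)] that])
      have "L #> (comm a b \<otimes> comm a b) = \<one>\<^bsub>?Q\<^esub>"
        using q_one[of "comm a b \<otimes> comm a b"] sq1[OF K1_comm[OF ab(1,2)]] abP by simp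
      then show "q.H.comm A B \<otimes>\<^bsub>?Q\<^esub> q.H.comm A B = \<one>\<^bsub>?Q\<^esub>"
        unfolding ab(3,4) q_comm[OF abP, symmetric] using q.hom_mult[of "comm a b" "comm a b"] abP by simp
    next
      fix A D assume AD: "A \<in> C" "D \<in> carrier ?Q"
      obtain a where a: "a \<in> K" "A = L #> a" using AD(1) by (auto simp: C_def)
      obtain d where d: "d \<in> carrier P" "D = L #> d" using AD(2) by (auto simp: carrier_FactGroup)
      have aP: "a \<in> carrier P" using a by auto
      have "a \<otimes> a \<in> K1" using K1_powI[OF a(1)] two[OF aP] by simp
      then have "comm d (a \<otimes> a) \<in> L" using central d by blast
      then have "L #> (d \<otimes> (a \<otimes> a) \<otimes> inv d) = L #> (a \<otimes> a)"
        using q_eq[of "d \<otimes> (a \<otimes> a) \<otimes> inv d" "a \<otimes> a"] d aP by simp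
      then show "D \<otimes>\<^bsub>?Q\<^esub> (A \<otimes>\<^bsub>?Q\<^esub> A) \<otimes>\<^bsub>?Q\<^esub> inv\<^bsub>?Q\<^esub> D = A \<otimes>\<^bsub>?Q\<^esub> A"
        unfolding a(2) d(2) using d aP by (simp add: q.hom_mult q.hom_inv del: mult_FactGroup)
      let ?s = "inv a \<otimes> (d \<otimes> a \<otimes> inv d)"
      obtain s where s: "s \<in> Ks" "d \<otimes> a \<otimes> inv d = a \<otimes> s" using conj_star[OF a(1) d(1)] by blast
      have "?s = s" unfolding s(2) using aP Ks.mem_carrier[OF s(1)] by (simp flip: m_assoc)
      then have "?s \<otimes> ?s \<in> L" using sq[OF s(1)] by simp
      then have "L #> (?s \<otimes> ?s) = \<one>\<^bsub>?Q\<^esub>" using q_one[of "?s \<otimes> ?s"] aP d by simp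
      then show "inv\<^bsub>?Q\<^esub> A \<otimes>\<^bsub>?Q\<^esub> (D \<otimes>\<^bsub>?Q\<^esub> A \<otimes>\<^bsub>?Q\<^esub> inv\<^bsub>?Q\<^esub> D) \<otimes>\<^bsub>?Q\<^esub> (inv\<^bsub>?Q\<^esub> A \<otimes>\<^bsub>?Q\<^esub> (D \<otimes>\<^bsub>?Q\<^esub> A \<otimes>\<^bsub>?Q\<^esub> inv\<^bsub>?Q\<^esub> D)) = \<one>\<^bsub>?Q\<^esub>"
        unfolding a(2) d(2) using d aP by (simp add: q.hom_mult q.hom_inv del: mult_FactGroup)
    next
      show "L #> a \<in> C" "L #> b \<in> C" using a b by (auto simp: C_def)
      show "L #> h \<in> carrier ?Q" by (rule q.hom_closed[OF h])
    qed
    moreover have "L #> (h \<otimes> h \<otimes> a \<otimes> inv (h \<otimes> h))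
        = ((L #> h) \<otimes>\<^bsub>?Q\<^esub> (L #> h)) \<otimes>\<^bsub>?Q\<^esub> (L #> a) \<otimes>\<^bsub>?Q\<^esub> inv\<^bsub>?Q\<^esub> ((L #> h) \<otimes>\<^bsub>?Q\<^esub> (L #> h))"
      using hP by (simp only: q.hom_mult q.hom_inv m_closed inv_closed)
    moreover have "L #> comm (h \<otimes> h \<otimes> a \<otimes> inv (h \<otimes> h)) b
        = q.H.comm (L #> (h \<otimes> h \<otimes> a \<otimes> inv (h \<otimes> h))) (L #> b)"
      using hP by (intro q_comm) simp_all
    ultimately have "L #> comm (h \<otimes> h \<otimes> a \<otimes> inv (h \<otimes> h)) b = L #> comm a b"
      using q_comm[OF hP(2,3)] by simp
    then show ?thesis using q_eq[of "comm (h \<otimes> h \<otimes> a \<otimes> inv (h \<otimes> h)) b" "comm a b"] hP by simp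
  qed
  have cjK: "g \<otimes> a \<otimes> inv g \<in> K" if "g \<in> carrier P" "a \<in> K" for g a
    using K.inv_op_closed2[OF that] .
  have act_sq: "L #> comm (g \<otimes> g \<otimes> a \<otimes> inv (g \<otimes> g)) b = L #> comm a b"
    if g: "g \<in> carrier P" and "a \<in> K" "b \<in> K" for g a b
    using form[OF that] q_eq[of "comm (g \<otimes> g \<otimes> a \<otimes> inv (g \<otimes> g)) b" "comm a b"] that by simp
  have act_K1: "L #> comm (u \<otimes> a \<otimes> inv u) b = L #> comm a b" if u: "u \<in> K1" and a: "a \<in> K" and b: "b \<in> K" for u a b
  proof -
    have P: "u \<in> carrier P" "a \<in> carrier P" "b \<in> carrier P" using u a b by auto
    have "L #> (u \<otimes> a \<otimes> inv u) = L #> a"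
      using q_eq[of "u \<otimes> a \<otimes> inv u" a] central(2)[OF u P(2)] P by simp
    then show ?thesis using q_comm[of "u \<otimes> a \<otimes> inv u" b] q_comm[of a b] P by simp
  qed
  let ?M = "(\<lambda>g. g \<otimes> g) ` carrier P \<union> K1"
  have MP: "?M \<subseteq> carrier P" using K1.subset by auto
  have sq_mem: "g \<otimes> g \<in> generate P ?M" if "g \<in> carrier P" for g
    using that by (intro generate.incl) auto
  have sM: "subgroup (generate P ?M) P" by (rule generate_is_subgroup[OF MP])
  have gen: "generate P ?M = carrier P"
  proof (rule normal_eq_carrier_if_elementary_abelian_quotient)
    show "generate P ?M \<lhd> P"
    proof (rule normal_generateI[OF MP])
      fix h x assume h: "h \<in> ?M" and x: "x \<in> carrier P"
      show "x \<otimes> h \<otimes> inv x \<in> ?M"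
        using h
      proof
        assume "h \<in> (\<lambda>g. g \<otimes> g) ` carrier P"
        then obtain g where g: "g \<in> carrier P" "h = g \<otimes> g" by auto
        have "inv x \<otimes> (x \<otimes> w) = w" if "w \<in> carrier P" for w using x that by (simp flip: m_assoc)
        then have "x \<otimes> h \<otimes> inv x = (x \<otimes> g \<otimes> inv x) \<otimes> (x \<otimes> g \<otimes> inv x)"
          using g x by (simp add: m_assoc)
        then show ?thesis using g x by (intro UnI1 image_eqI[of _ _ "x \<otimes> g \<otimes> inv x"]) simp_all
      next
        assume "h \<in> K1"
        then show ?thesis using K1.inv_op_closed2[OF x] by blast
      qed
    qed
    show "openin T (generate P ?M)"
      by (rule closed_if_contains_open(1)[OF sM K1_open _ K1.one_closed]) (auto intro: generate.incl)
    show "g [^] p \<in> generate P ?M" if "g \<in> carrier P" for g using sq_mem two that by simp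
    fix a b assume a: "a \<in> carrier P" and b: "b \<in> carrier P"
    let ?c = "inv b \<otimes> inv a \<otimes> b"
    have "comm a b = ((a \<otimes> b) \<otimes> (a \<otimes> b)) \<otimes> (?c \<otimes> ?c) \<otimes> (inv b \<otimes> inv b)"
    proof -
      have "inv a \<otimes> (a \<otimes> w) = w" "inv b \<otimes> (b \<otimes> w) = w" "a \<otimes> (inv a \<otimes> w) = w" "b \<otimes> (inv b \<otimes> w) = w"
        if "w \<in> carrier P" for w using a b that by (simp_all flip: m_assoc)
      then show ?thesis using a b by (simp add: m_assoc)
    qed
    moreover have "(a \<otimes> b) \<otimes> (a \<otimes> b) \<in> generate P ?M" "?c \<otimes> ?c \<in> generate P ?M" "inv b \<otimes> inv b \<in> generate P ?M"
      using a b by (simp_all only: sq_mem m_closed inv_closed)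
    ultimately show "comm a b \<in> generate P ?M" using subgroup.m_closed[OF sM] by simp
  qed
  have act: "L #> comm (g \<otimes> a \<otimes> inv g) b = L #> comm a b"
    if "g \<in> carrier P" "a \<in> K" "b \<in> K" for g a b
  proof -
    have "g \<in> generate P ?M" using gen that(1) by simp
    then show ?thesis
      using that(2,3)
    proof (induction g arbitrary: a b)
      case one
      then show ?case by simp
    next
      case (incl h)
      then show ?case using act_sq act_K1 by auto
    next
      case (inv h)
      then consider g where "g \<in> carrier P" "h = g \<otimes> g" | "h \<in> K1" by auto
      then show ?case
      proof cases
        case 1
        then show ?thesis using act_sq[of "inv g"] inv.prems by (simp add: inv_mult_group)
      next
        case 2
        then show ?thesis using act_K1[of "inv h"] inv.prems by simp
      qed
    next
      case (eng h1 h2)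
      have h: "h1 \<in> carrier P" "h2 \<in> carrier P" using eng.hyps gen by auto
      have "(h1 \<otimes> h2) \<otimes> a \<otimes> inv (h1 \<otimes> h2) = h1 \<otimes> (h2 \<otimes> a \<otimes> inv h2) \<otimes> inv h1"
        using h eng.prems(1) by (simp add: inv_mult_group m_assoc)
      then show ?case
        using eng.IH(1)[OF cjK[OF h(2) eng.prems(1)] eng.prems(2)] eng.IH(2)[OF eng.prems] by simp
    qed
  qed
  define S where "S = {u \<in> carrier P. \<forall>x\<in>K. comm u x \<in> L} \<inter> K"
  have "L #> comm s x = \<one>\<^bsub>?Q\<^esub> \<longleftrightarrow> comm s x \<in> L" if "s \<in> K" "x \<in> K" for s x
    by (rule q_one) (use that in simp)
  then have S_iff: "s \<in> S \<longleftrightarrow> s \<in> K \<and> (\<forall>x\<in>K. L #> comm s x = \<one>\<^bsub>?Q\<^esub>)" for s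
    unfolding S_def using K.mem_carrier by blast
  have bil: "L #> comm (a \<otimes> a') b = (L #> comm a b) \<otimes>\<^bsub>?Q\<^esub> (L #> comm a' b)"
    if "a \<in> K" "a' \<in> K" "b \<in> K" for a a' b
  proof -
    have P: "a \<in> carrier P" "a' \<in> carrier P" "b \<in> carrier P" using that by auto
    have "q.H.comm ((L #> a) \<otimes>\<^bsub>?Q\<^esub> (L #> a')) (L #> b) = q.H.comm (L #> a) (L #> b) \<otimes>\<^bsub>?Q\<^esub> q.H.comm (L #> a') (L #> b)"
    proof (rule q.H.comm_mult_left_central)
      show "q.H.comm (L #> a') (L #> b) \<otimes>\<^bsub>?Q\<^esub> w = w \<otimes>\<^bsub>?Q\<^esub> q.H.comm (L #> a') (L #> b)"
        if "w \<in> carrier ?Q" for w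
        unfolding q_comm[OF P(2,3), symmetric] by (rule qcentral[OF K1_comm that]) fact+
    qed (use P q.hom_closed in auto)
    then show ?thesis using q_comm[of "a \<otimes> a'" b] q_comm[of a b] q_comm[of a' b] q.hom_mult[of a a'] P by simp
  qed
  have sS: "subgroup S P"
    unfolding S_def by (rule subgroups_Inter_pair[OF subgroup_commuting_mod[OF L(1) K.subset] K.is_subgroup])
  have nS: "S \<lhd> P"
  proof (rule normal_invI[OF sS])
    fix g a assume g: "g \<in> carrier P" and a: "a \<in> S"
    then have aK: "a \<in> K" by (simp add: S_def)
    have "L #> comm (g \<otimes> a \<otimes> inv g) x = \<one>\<^bsub>?Q\<^esub>" if x: "x \<in> K" for x
      using act[OF g aK x] a x S_iff by metis
    then show "g \<otimes> a \<otimes> inv g \<in> S" using cjK[OF g aK] S_iff by blast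
  qed
  have K1S: "K1 \<subseteq> S"
  proof
    fix u assume u: "u \<in> K1"
    then show "u \<in> S" using K1_sub central(2)[OF u] K.mem_carrier by (auto simp: S_def)
  qed
  have "Ks \<subseteq> S"
  proof (rule star_least[OF K_normal star nS])
    show "openin T S" by (rule closed_if_contains_open(1)[OF sS K1_open K1S K1.one_closed])
    show "S \<subseteq> K" by (auto simp: S_def)
    fix a assume a: "a \<in> K"
    have aP: "a \<in> carrier P" using a by simp
    have a2: "a \<otimes> a \<in> K1" using K1_powI[OF a] two[OF aP] by simp
    then show "a [^] p \<in> S" using two[OF aP] K1S by auto
    fix g assume g: "g \<in> carrier P"
    have eq: "comm a g = a \<otimes> (g \<otimes> inv a \<otimes> inv g)" using aP g by (simp add: m_assoc)
    have gaK: "g \<otimes> inv a \<otimes> inv g \<in> K" using cjK[OF g, of "inv a"] a by simp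
    show "comm a g \<in> S"
      unfolding S_iff eq
    proof (intro conjI ballI)
      show "a \<otimes> (g \<otimes> inv a \<otimes> inv g) \<in> K" using a gaK by simp
      fix x assume x: "x \<in> K"
      have "L #> comm (a \<otimes> (g \<otimes> inv a \<otimes> inv g)) x = (L #> comm a x) \<otimes>\<^bsub>?Q\<^esub> (L #> comm (g \<otimes> inv a \<otimes> inv g) x)"
        by (rule bil[OF a gaK x])
      also have "L #> comm (g \<otimes> inv a \<otimes> inv g) x = L #> comm (inv a) x"
        by (rule act[OF g _ x]) (use a in simp)
      also have "(L #> comm a x) \<otimes>\<^bsub>?Q\<^esub> (L #> comm (inv a) x) = L #> comm (a \<otimes> inv a) x"
        by (rule bil[symmetric]) (use a x in simp_all)
      also have "\<dots> = \<one>\<^bsub>?Q\<^esub>" using aP K.mem_carrier[OF x] L.subset by simp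
      finally show "L #> comm (a \<otimes> (g \<otimes> inv a \<otimes> inv g)) x = \<one>\<^bsub>?Q\<^esub>" .
    qed
  qed
  then have "comm s x \<in> L" using s x by (auto simp: S_def)
  then show ?thesis using comm_mem_commute[OF L(1), of s x] s x by simp
qed

theorem K'_minimal:
  assumes L: "L \<lhd> P" "closedin T L" "Ks1 \<subseteq> L" "L \<subseteq> K1"
    and lift: "lift_order_property p P K K1 Ks L" and cent: "p \<noteq> 2 \<Longrightarrow> star_central P K Ks L"
  shows "K' \<subseteq> L"
proof (rule closed_verbal_least[OF normal_imp_subgroup[OF L(1)] L(2)])
  have "(y [^] p) [^] p \<in> L" if "y \<in> K" for y
    using star_pow[OF K1_normal star1 K1_powI[OF that]] L(3) by blast
  then have pw: "\<forall>y\<in>K. y [^] p \<in> L \<longleftrightarrow> y \<in> Ks"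
    using lift lift_order_property_iff[OF L(1,4)] by simp
  show sp: "s [^] p \<in> L" if "s \<in> Ks" for s using pw that Ks_sub by blast
  fix x s assume x: "x \<in> K" and s: "s \<in> Ks"
  show "comm x s \<in> L"
  proof (cases "p = 2")
    case True
    have "s \<otimes> s \<in> L" if "s \<in> Ks" for s
      using sp[OF that] that by (simp add: True numeral_2_eq_2)
    from squares_determine_star_central[OF True L(1,3,4) this x s] show ?thesis .
  next
    case False
    have "L \<subseteq> Ks" using L(4) K1_sub_Ks by blast
    then show ?thesis using cent[OF False] star_central_iff[OF L(1)] x s by blast
  qed
qed

lemma lift_order_K': "lift_order_property p P K K1 Ks K'"
  using lift_order_property_iff[OF K'_normal K'_sub_K1] K'_pow star_pow[OF K_normal star] pth_power_mem_iff(1)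
  by blast

lemma star_central_K': "star_central P K Ks K'"
  using star_central_iff[OF K'_normal] K'_comm K'_sub_K1 K1_sub_Ks by blast

lemma action_trivial_on_quotient:
  assumes "g \<in> carrier (P Mod K1)" "r \<in> carrier (P Mod K')"
    and u: "u \<in> kernel (P Mod K') (P Mod K1) (quot_map P K1)"
  shows "r \<otimes>\<^bsub>P Mod K'\<^esub> u \<otimes>\<^bsub>P Mod K'\<^esub> inv\<^bsub>P Mod K'\<^esub> r = u"
proof -
  obtain x where x: "x \<in> carrier P" "r = K' #> x" using assms(2) by (auto simp: carrier_FactGroup)
  obtain y where y: "y \<in> K1" "u = K' #> y"
    using u kernel_quot_map[OF K'_normal K1_normal K'_sub_K1] by auto
  have yP: "y \<in> carrier P" using y by simp
  have "K' #> (x \<otimes> y \<otimes> inv x) = K' #> y"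
    using rcos_eq_iff[OF K'_normal, of "x \<otimes> y \<otimes> inv x" y] trivial_action[OF y(1) x(1)]
      comm_mem_commute[OF K'_normal yP x(1)] x yP by simp
  then show ?thesis
    unfolding x(2) y(2) using x yP by (simp add: c.hom_mult c.hom_inv del: mult_FactGroup)
qed

end

section \<open>The theorem\<close>

context universal_cover
begin

lemma pker_Suc:
  assumes "pker p P T G \<phi> k \<lhd> P"
  shows "pker p P T G \<phi> (Suc k) =
     closed_verbal p P T (pker p P T G \<phi> k) (pker p P T G \<phi> k) (pker p P T G \<phi> k)"
  by (simp add: closed_verbal_def generate_Un_normal normal_comm_subgroup normal_pow_subgroup assms)

lemma pker_normal: "pker p P T G \<phi> k \<lhd> P"
proof (induction k)
  case 0
  show ?case using phi.normal_kernel by simp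
next
  case (Suc k)
  show ?case unfolding pker_Suc[OF Suc] by (rule closed_verbal_normal[OF Suc Suc Suc])
qed

end

theorem proposition9p6:
  fixes p :: nat and G :: "'g monoid" and P :: "'a monoid" and T :: "'a topology"
    and \<phi> :: "'a \<Rightarrow> 'g" and ks :: "nat \<Rightarrow> 'a set" and k :: nat
  assumes "Factorial_Ring.prime p"
    and "group G" and "finite (carrier G)" and "p dvd order G"
    and "p_perfect p G"
    and "group_center G = {\<one>\<^bsub>G\<^esub>}"
    and "universal_p_frattini_cover p P T G \<phi>"
    and "\<And>j. is_ker_star p P T (pker p P T G \<phi> j) (ks j)"
  shows
    "let K = pker p P T G \<phi> k; K1 = pker p P T G \<phi> (Suc k);
         Ks = ks k; Ks1 = ks (Suc k);
         K' = ker_prime p P T K Ks; K'' = ker_prime_ab p P T K Ks;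
         G1 = P Mod K1; R1 = P Mod Ks1; R' = P Mod K';
         V = subquotient P K Ks; W = subquotient P K1 K'; W'' = subquotient P K1 K''
     in
       K' \<lhd> P \<and> K' \<subseteq> K1 \<and>
       (\<forall>g \<in> carrier G1. \<forall>r \<in> carrier R'. quot_map P K1 r = g \<longrightarrow>
          (\<forall>u \<in> kernel R' G1 (quot_map P K1). r \<otimes>\<^bsub>R'\<^esub> u \<otimes>\<^bsub>R'\<^esub> inv\<^bsub>R'\<^esub> r = u)) \<and>
       zp_module p V \<and> zp_module p W \<and>
       (\<exists>f. (\<forall>x\<in>K. f (Ks #>\<^bsub>P\<^esub> x) = K' #>\<^bsub>P\<^esub> (x [^]\<^bsub>P\<^esub> p)) \<and>
            f \<in> carrier V \<rightarrow> carrier W \<and> inj_on f (carrier V) \<and>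
            (p \<noteq> 2 \<or> card (carrier V) \<le> 2 \<longrightarrow> f \<in> hom V W) \<and>
            zp_module p W'' \<and>
            quot_map P K'' \<circ> f \<in> hom V W'' \<and> inj_on (quot_map P K'' \<circ> f) (carrier V)) \<and>
       lift_order_property p P K K1 Ks K' \<and>
       Ks1 \<subseteq> K' \<and> quot_map P K' \<in> epi R1 R' \<and>
       star_central P K Ks K' \<and>
       (\<forall>L. L \<lhd> P \<and> closedin T L \<and> Ks1 \<subseteq> L \<and> L \<subseteq> K1 \<and>
            lift_order_property p P K K1 Ks L \<and> (p \<noteq> 2 \<longrightarrow> star_central P K Ks L) \<longrightarrow>
            K' \<subseteq> L)"
proof -
  interpret universal_cover p G P T \<phi>
    by (rule universal_cover.intro) (fact assms)+
  interpret frattini_step p G P T \<phi> "pker p P T G \<phi> k" "pker p P T G \<phi> (Suc k)" "ks k" "ks (Suc k)"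
    by (intro frattini_step.intro perfect_cover.intro universal_cover_axioms perfect_cover_axioms.intro
        frattini_step_axioms.intro pker_normal assms(5,8) pker_Suc[OF pker_normal])
  have K': "ker_prime p P T (pker p P T G \<phi> k) (ks k) = closed_verbal p P T (pker p P T G \<phi> k) (ks k) (ks k)"
    and K'': "ker_prime_ab p P T (pker p P T G \<phi> k) (ks k)
      = closed_verbal p P T (pker p P T G \<phi> k) (pker p P T G \<phi> k) (ks k)"
    by (simp_all only: ker_prime_def ker_prime_ab_def closed_verbal_def)
  show ?thesis
    unfolding Let_def K' K''
    by (intro conjI ballI impI allI K'_normal K'_sub_K1 action_trivial_on_quotient zp_V zp_W pth_power_map
        lift_order_K' Ks1_sub_K' quot_map_epi[OF star_normal[OF star1] K'_normal Ks1_sub_K'] star_central_K'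
        K'_minimal; (elim conjE)?; (assumption | simp)?)
qed

end
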